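(* Let $G$ be a primitive permutation group on a finite set $\Omega$ and suppose that $G$ has Property $( * )_p$ for some prime $p$ dividing $|\Omega|$. Then one of the following holds: (1) $G$ is an almost simple group; (2) $G$ is of Affine type and $|\Omega|=p^k$ for some positive integer $k$; (3) $\Omega=\Delta^k$ for some $k\geq 2$ and $G\leq H\,\mathrm{wr}\,K$ in product action on $\Delta^k$, where $H$ is an almost simple group acting primitively on $\Delta$ with Property $( * )_p$ and $K\leq S_k$. Moreover, either $p$ is coprime to $|K|$, or $p$ divides $|K|$ and $|\Delta|$ is a power of $p$. Moreover, conversely, for a prime $p$ dividing $|\Omega|$, any primitive permutation group on $\Omega$ satisfying the conditions in (2) or (3) has Property $( * )_p$.
   Context: A finite group $G$ acting on a finite set $\Omega$ has Property $( * )_p$, for a prime $p$, if for a (equivalently, every) Sylow $p$-subgroup $P$ of $G$, the stabiliser $P_\omega=P\cap G_\omega$ is a Sylow $p$-subgroup of the point stabiliser $G_\omega$ for every $\omega\in\Omega$. A primitive permutation group is of Affine type if it has a regular normal elementary abelian subgroup. A group $H$ is almost simple if $T\leq H\leq \mathrm{Aut}(T)$ for some nonabelian finite simple group $T$ (identified with $\mathrm{Inn}(T)$). Product action: for $H$ acting on $\Delta$ and $K\leq S_k$, the wreath product $H\,\mathrm{wr}\,K=H^k\rtimes K$ acts on $\Delta^k$ by $(\delta_1,\ldots,\delta_k)^{(h_1,\ldots,h_k)}=(\delta_1^{h_1},\ldots,\delta_k^{h_k})$ and $(\delta_1,\ldots,\delta_k)^\sigma=(\delta_{1\sigma^{-1}},\ldots,\delta_{k\sigma^{-1}})$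 for $\sigma\in K$. *)

theory Defs
  imports "HOL-Algebra.Algebra"
begin

hide_const (open) Divisibility.prime

section \<open>Group actions\<close>

text \<open>
  Actions are left actions, in the style of the library's \<^locale>\<open>group_action\<close>. A permutation
  group on \<open>\<Omega>\<close> is a subgroup of \<^term>\<open>BijGroup \<Omega>\<close>, whose elements are extensional functions; it acts
  on \<open>\<Omega>\<close> through \<^term>\<open>id\<close>.
\<close>

abbreviation perm_group :: "'a set \<Rightarrow> ('a \<Rightarrow> 'a) set \<Rightarrow> ('a \<Rightarrow> 'a) monoid" where
  "perm_group \<Omega> G \<equiv> BijGroup \<Omega> \<lparr>carrier := G\<rparr>"

definition block :: "('g, 'm) monoid_scheme \<Rightarrow> 'a set \<Rightarrow> ('g \<Rightarrow> 'a \<Rightarrow> 'a) \<Rightarrow> 'a set \<Rightarrow> bool" where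
  "block G E \<phi> B \<longleftrightarrow>
     B \<subseteq> E \<and> B \<noteq> {} \<and> (\<forall>g\<in>carrier G. \<phi> g ` B = B \<or> \<phi> g ` B \<inter> B = {})"

definition primitive_action :: "('g, 'm) monoid_scheme \<Rightarrow> 'a set \<Rightarrow> ('g \<Rightarrow> 'a \<Rightarrow> 'a) \<Rightarrow> bool" where
  "primitive_action G E \<phi> \<longleftrightarrow>
     E \<noteq> {} \<and> transitive_action G E \<phi> \<and>
     (\<forall>B. block G E \<phi> B \<longrightarrow> B = E \<or> (\<exists>x. B = {x}))"

definition primitive_perm_group :: "'a set \<Rightarrow> ('a \<Rightarrow> 'a) set \<Rightarrow> bool" where
  "primitive_perm_group \<Omega> G \<longleftrightarrow>
     subgroup G (BijGroup \<Omega>) \<and> primitive_action (perm_group \<Omega> G) \<Omega> id"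

definition regular_action :: "('g, 'm) monoid_scheme \<Rightarrow> 'a set \<Rightarrow> ('g \<Rightarrow> 'a \<Rightarrow> 'a) \<Rightarrow> bool" where
  "regular_action G E \<phi> \<longleftrightarrow>
     transitive_action G E \<phi> \<and> (\<forall>x\<in>E. stabilizer G \<phi> x = {\<one>\<^bsub>G\<^esub>})"

section \<open>Property \<open>(*)\<^sub>p\<close>\<close>

text \<open>Only meaningful for finite groups.\<close>

definition sylow_subgroup :: "nat \<Rightarrow> 'g set \<Rightarrow> ('g, 'm) monoid_scheme \<Rightarrow> bool" where
  "sylow_subgroup p P G \<longleftrightarrow> subgroup P G \<and> card P = p ^ multiplicity p (order G)"

definition property_star ::
    "nat \<Rightarrow> ('g, 'm) monoid_scheme \<Rightarrow> 'a set \<Rightarrow> ('g \<Rightarrow> 'a \<Rightarrow> 'a) \<Rightarrow> bool" where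
  "property_star p G E \<phi> \<longleftrightarrow>
     (\<exists>P. sylow_subgroup p P G \<and>
          (\<forall>x\<in>E. sylow_subgroup p (P \<inter> stabilizer G \<phi> x) (G\<lparr>carrier := stabilizer G \<phi> x\<rparr>)))"

section \<open>Affine type and almost simple groups\<close>

definition elementary_abelian :: "('g, 'm) monoid_scheme \<Rightarrow> bool" where
  "elementary_abelian G \<longleftrightarrow>
     comm_group G \<and> (\<exists>q::nat. prime q \<and> (\<forall>x\<in>carrier G. x [^]\<^bsub>G\<^esub> q = \<one>\<^bsub>G\<^esub>))"

definition affine_type :: "'a set \<Rightarrow> ('a \<Rightarrow> 'a) set \<Rightarrow> bool" where
  "affine_type \<Omega> G \<longleftrightarrow>
     (\<exists>N. N \<lhd> perm_group \<Omega> G \<and> elementary_abelian (perm_group \<Omega> N) \<and>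
          regular_action (perm_group \<Omega> N) \<Omega> id)"

definition inner_automorphisms :: "('g, 'm) monoid_scheme \<Rightarrow> ('g \<Rightarrow> 'g) set" where
  "inner_automorphisms T =
     {\<lambda>x\<in>carrier T. g \<otimes>\<^bsub>T\<^esub> x \<otimes>\<^bsub>T\<^esub> inv\<^bsub>T\<^esub> g | g. g \<in> carrier T}"

text \<open>
  Since \<open>T\<close> is isomorphic to a subgroup of \<open>H\<close>, nothing is lost by taking it over the element type
  of \<open>H\<close>.
\<close>

definition almost_simple :: "('g, 'm) monoid_scheme \<Rightarrow> bool" where
  "almost_simple H \<longleftrightarrow>
     (\<exists>(T :: 'g monoid) L.
        simple_group T \<and> finite (carrier T) \<and> \<not> comm_group T \<and>
        subgroup L (AutoGroup T) \<and> inner_automorphisms T \<subseteq> L \<and>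
        H \<cong> AutoGroup T \<lparr>carrier := L\<rparr>)"

section \<open>Wreath products in product action\<close>

text \<open>
  \<open>H wr K = H\<^sup>k \<rtimes> K\<close>, where \<open>K\<close> permutes the \<open>k\<close> coordinates \<open>{1..k}\<close>. The pair \<open>(h, \<sigma>)\<close> stands for
  ``first \<open>\<sigma>\<close>, then \<open>h\<close>''; this is the left-action form of the usual right-action convention, and gives
  the same group of permutations of \<open>\<Delta>\<^sup>k\<close>.
\<close>

definition wreath_product ::
    "('h, 'm) monoid_scheme \<Rightarrow> nat \<Rightarrow> (nat \<Rightarrow> nat) set \<Rightarrow> ((nat \<Rightarrow> 'h) \<times> (nat \<Rightarrow> nat)) monoid" where
  "wreath_product H k K =
     \<lparr>carrier = ({1..k} \<rightarrow>\<^sub>E carrier H) \<times> K,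
      monoid.mult = \<lambda>(h, \<sigma>) (h', \<sigma>'). (\<lambda>i\<in>{1..k}. h i \<otimes>\<^bsub>H\<^esub> h' (inv_into UNIV \<sigma> i), \<sigma> \<circ> \<sigma>'),
      one = (\<lambda>i\<in>{1..k}. \<one>\<^bsub>H\<^esub>, id)\<rparr>"

definition product_action ::
    "nat \<Rightarrow> 'd set \<Rightarrow> ('h \<Rightarrow> 'd \<Rightarrow> 'd) \<Rightarrow> (nat \<Rightarrow> 'h) \<times> (nat \<Rightarrow> nat) \<Rightarrow> (nat \<Rightarrow> 'd) \<Rightarrow> (nat \<Rightarrow> 'd)" where
  "product_action k \<Delta> \<psi> =
     (\<lambda>(h, \<sigma>). \<lambda>\<delta>\<in>{1..k} \<rightarrow>\<^sub>E \<Delta>. \<lambda>i\<in>{1..k}. \<psi> (h i) (\<delta> (inv_into UNIV \<sigma> i)))"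

lemma wreath_perm_facts:
  assumes "subgroup K (sym_group k)" "\<sigma> \<in> K"
  shows "\<sigma> permutes {1..k}" "inv_into UNIV \<sigma> permutes {1..k}" "inv_into UNIV \<sigma> \<in> K"
    "i \<in> {1..k} \<Longrightarrow> \<sigma> i \<in> {1..k}" "i \<in> {1..k} \<Longrightarrow> inv_into UNIV \<sigma> i \<in> {1..k}"
proof -
  show p: "\<sigma> permutes {1..k}"
    using assms subgroup.subset[OF assms(1)] by (auto simp: sym_group_def)
  show q: "inv_into UNIV \<sigma> permutes {1..k}"
    using permutes_inv[OF p] .
  show "i \<in> {1..k} \<Longrightarrow> \<sigma> i \<in> {1..k}" "i \<in> {1..k} \<Longrightarrow> inv_into UNIV \<sigma> i \<in> {1..k}"
    using permutes_in_image[OF p] permutes_in_image[OF q] by simp_all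
  have "inv\<^bsub>sym_group k\<^esub> \<sigma> = inv_into UNIV \<sigma>"
    using p by (intro sym_group_inv_equality) (simp add: sym_group_def)
  then show "inv_into UNIV \<sigma> \<in> K"
    using subgroup.m_inv_closed[OF assms] by simp
qed

lemma group_wreath_product:
  assumes H: "group H" and K: "subgroup K (sym_group k)"
  shows "group (wreath_product H k K)"
proof -
  interpret H: group H by fact
  note f = wreath_perm_facts[OF K]
  have comp: "\<sigma> \<circ> \<tau> \<in> K" if "\<sigma> \<in> K" "\<tau> \<in> K" for \<sigma> \<tau>
    using subgroup.m_closed[OF K that] by (simp add: sym_group_def)
  have idK: "id \<in> K"
    using subgroup.one_closed[OF K] by (simp add: sym_group_def)
  have inv_comp: "inv_into UNIV (\<sigma> \<circ> \<tau>) = inv_into UNIV \<tau> \<circ> inv_into UNIV \<sigma>"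
    if "\<sigma> \<in> K" "\<tau> \<in> K" for \<sigma> \<tau>
    using that f(1) permutes_bij by (metis o_inv_distrib)
  have mem: "h i \<in> carrier H" if "h \<in> {1..k} \<rightarrow>\<^sub>E carrier H" "i \<in> {1..k}" for h i
    using that by auto
  show ?thesis
  proof (rule groupI)
    fix x y
    assume "x \<in> carrier (wreath_product H k K)" "y \<in> carrier (wreath_product H k K)"
    then obtain h \<sigma> h' \<sigma>' where xy: "x = (h, \<sigma>)" "y = (h', \<sigma>')"
      "h \<in> {1..k} \<rightarrow>\<^sub>E carrier H" "h' \<in> {1..k} \<rightarrow>\<^sub>E carrier H" "\<sigma> \<in> K" "\<sigma>' \<in> K"
      by (auto simp: wreath_product_def)
    then show "x \<otimes>\<^bsub>wreath_product H k K\<^esub> y \<in> carrier (wreath_product H k K)"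
      using comp f(5) mem by (simp add: wreath_product_def)
  next
    show "\<one>\<^bsub>wreath_product H k K\<^esub> \<in> carrier (wreath_product H k K)"
      using idK by (simp add: wreath_product_def)
  next
    fix x y z
    assume "x \<in> carrier (wreath_product H k K)" "y \<in> carrier (wreath_product H k K)"
      "z \<in> carrier (wreath_product H k K)"
    then obtain h \<sigma> h' \<sigma>' h'' \<sigma>'' where xyz: "x = (h, \<sigma>)" "y = (h', \<sigma>')" "z = (h'', \<sigma>'')"
      "h \<in> {1..k} \<rightarrow>\<^sub>E carrier H" "h' \<in> {1..k} \<rightarrow>\<^sub>E carrier H" "h'' \<in> {1..k} \<rightarrow>\<^sub>E carrier H"
      "\<sigma> \<in> K" "\<sigma>' \<in> K" "\<sigma>'' \<in> K"
      by (auto simp: wreath_product_def)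
    show "x \<otimes>\<^bsub>wreath_product H k K\<^esub> y \<otimes>\<^bsub>wreath_product H k K\<^esub> z =
          x \<otimes>\<^bsub>wreath_product H k K\<^esub> (y \<otimes>\<^bsub>wreath_product H k K\<^esub> z)"
      unfolding xyz(1-3) wreath_product_def
      using xyz(4-) f(5) mem inv_comp
      by (auto simp: comp_assoc intro!: restrict_ext H.m_assoc)
  next
    fix x
    assume "x \<in> carrier (wreath_product H k K)"
    then obtain h \<sigma> where x: "x = (h, \<sigma>)" "h \<in> {1..k} \<rightarrow>\<^sub>E carrier H" "\<sigma> \<in> K"
      by (auto simp: wreath_product_def)
    have "(\<lambda>i\<in>{1..k}. (\<lambda>i\<in>{1..k}. \<one>\<^bsub>H\<^esub>) i \<otimes>\<^bsub>H\<^esub> h (inv_into UNIV id i)) = h"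
      by (rule extensionalityI[of _ "{1..k}"]) (use x(2) in \<open>auto simp: PiE_iff\<close>)
    then show "\<one>\<^bsub>wreath_product H k K\<^esub> \<otimes>\<^bsub>wreath_product H k K\<^esub> x = x"
      unfolding x(1) by (simp add: wreath_product_def del: restrict_apply)
    let ?y = "(\<lambda>i\<in>{1..k}. inv\<^bsub>H\<^esub> (h (\<sigma> i)), inv_into UNIV \<sigma>)"
    have "?y \<in> carrier (wreath_product H k K)"
      using x f(3,4) mem by (simp add: wreath_product_def)
    moreover have "?y \<otimes>\<^bsub>wreath_product H k K\<^esub> x = \<one>\<^bsub>wreath_product H k K\<^esub>"
      using x f(1,4)[OF x(3)] mem
      by (auto simp: wreath_product_def permutes_inv_inv permutes_inv_o intro!: restrict_ext)
    ultimately show "\<exists>y\<in>carrier (wreath_product H k K).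
        y \<otimes>\<^bsub>wreath_product H k K\<^esub> x = \<one>\<^bsub>wreath_product H k K\<^esub>" by blast
  qed
qed

lemma product_action_is_action:
  assumes "group_action H \<Delta> \<psi>" and K: "subgroup K (sym_group k)"
  shows "group_action (wreath_product H k K) ({1..k} \<rightarrow>\<^sub>E \<Delta>) (product_action k \<Delta> \<psi>)"
proof -
  interpret A: group_action H \<Delta> \<psi> by fact
  have grpH: "group H" using A.group_hom group_hom.axioms(1) by blast
  interpret H: group H by fact
  interpret W: group "wreath_product H k K" by (rule group_wreath_product[OF grpH K])
  note f = wreath_perm_facts[OF K]
  let ?X = "{1..k} \<rightarrow>\<^sub>E \<Delta>" and ?a = "product_action k \<Delta> \<psi>" and ?W = "wreath_product H k K"
  have inv_comp: "inv_into UNIV (\<sigma> \<circ> \<tau>) = inv_into UNIV \<tau> \<circ> inv_into UNIV \<sigma>"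
    if "\<sigma> \<in> K" "\<tau> \<in> K" for \<sigma> \<tau>
    using that f(1) permutes_bij by (metis o_inv_distrib)
  have mem: "h i \<in> carrier H" if "h \<in> {1..k} \<rightarrow>\<^sub>E carrier H" "i \<in> {1..k}" for h i
    using that by auto
  have closed: "?a w \<delta> \<in> ?X" if "w \<in> carrier ?W" "\<delta> \<in> ?X" for w \<delta>
    using that f(5)
    by (auto simp: wreath_product_def product_action_def intro!: A.element_image[OF _ _ refl])
       (meson PiE_mem atLeastAtMost_iff)+
  have mult: "?a (v \<otimes>\<^bsub>?W\<^esub> w) \<delta> = ?a v (?a w \<delta>)"
    if v: "v \<in> carrier ?W" and w: "w \<in> carrier ?W" and d: "\<delta> \<in> ?X" for v w \<delta>
  proof -
    obtain h \<sigma> h' \<sigma>' where vw: "v = (h, \<sigma>)" "w = (h', \<sigma>')"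
      "h \<in> {1..k} \<rightarrow>\<^sub>E carrier H" "h' \<in> {1..k} \<rightarrow>\<^sub>E carrier H" "\<sigma> \<in> K" "\<sigma>' \<in> K"
      using v w by (auto simp: wreath_product_def)
    have "?a w \<delta> \<in> ?X" using closed w d by blast
    moreover have "\<psi> (h i \<otimes>\<^bsub>H\<^esub> h' (inv_into UNIV \<sigma> i)) (\<delta> (inv_into UNIV (\<sigma> \<circ> \<sigma>') i)) =
        \<psi> (h i) (\<psi> (h' (inv_into UNIV \<sigma> i)) (\<delta> (inv_into UNIV \<sigma>' (inv_into UNIV \<sigma> i))))"
      if "i \<in> {1..k}" for i
      unfolding inv_comp[OF vw(5,6)] o_apply
      by (rule A.composition_rule)
         (use that vw d mem f(5)[OF vw(5)] f(5)[OF vw(6)] in \<open>auto simp del: atLeastAtMost_iff\<close>)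
    ultimately show ?thesis
      using d f(5)[OF vw(5)] unfolding vw(1,2)
      by (auto simp: wreath_product_def product_action_def simp del: atLeastAtMost_iff
          intro!: restrict_ext)
  qed
  have one: "?a \<one>\<^bsub>?W\<^esub> \<delta> = \<delta>" if d: "\<delta> \<in> ?X" for \<delta>
  proof (rule extensionalityI[of _ "{1..k}"])
    show "?a \<one>\<^bsub>?W\<^esub> \<delta> \<in> extensional {1..k}" "\<delta> \<in> extensional {1..k}"
      using closed[OF W.one_closed d] d by (auto simp: PiE_iff)
    fix i assume i: "i \<in> {1..k}"
    then have "\<delta> i \<in> \<Delta>" using d by auto
    then show "?a \<one>\<^bsub>?W\<^esub> \<delta> i = \<delta> i"
      using i d A.id_eq_one[symmetric]
      by (simp add: wreath_product_def product_action_def inv_id[unfolded id_def] id_def)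
  qed
  have ext: "?a w \<in> extensional ?X" for w
    by (cases w) (simp add: product_action_def)
  have bij: "?a w \<in> Bij ?X" if w: "w \<in> carrier ?W" for w
  proof -
    have "bij_betw (?a w) ?X ?X"
    proof (rule bij_betwI[where g = "?a (inv\<^bsub>?W\<^esub> w)"])
      show "?a w \<in> ?X \<rightarrow> ?X" "?a (inv\<^bsub>?W\<^esub> w) \<in> ?X \<rightarrow> ?X"
        using closed w by blast+
      show "?a (inv\<^bsub>?W\<^esub> w) (?a w \<delta>) = \<delta>" "?a w (?a (inv\<^bsub>?W\<^esub> w) \<delta>) = \<delta>" if "\<delta> \<in> ?X" for \<delta>
        using that w mult[symmetric] one by simp_all
    qed
    then show ?thesis using ext by (simp add: Bij_def)
  qed
  show ?thesis
  proof (intro group_action.intro group_hom.intro group_hom_axioms.intro)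
    show "group ?W" by (rule W.is_group)
    show "group (BijGroup ?X)" by (rule group_BijGroup)
    show "?a \<in> hom ?W (BijGroup ?X)"
    proof (rule homI)
      fix v w assume vw: "v \<in> carrier ?W" "w \<in> carrier ?W"
      show "?a v \<in> carrier (BijGroup ?X)" using bij vw by (simp add: BijGroup_def)
      have "?a (v \<otimes>\<^bsub>?W\<^esub> w) = compose ?X (?a v) (?a w)"
        by (rule extensionalityI[of _ ?X]) (use ext mult vw in \<open>auto simp: compose_def\<close>)
      then show "?a (v \<otimes>\<^bsub>?W\<^esub> w) = ?a v \<otimes>\<^bsub>BijGroup ?X\<^esub> ?a w"
        using bij vw by (simp add: BijGroup_def)
    qed
  qed
qed

text \<open>
  \<open>G \<le> H wr K\<close> in product action, where \<open>\<Omega>\<close> is identified with \<open>\<Delta>\<^sup>k\<close> along a bijection.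
\<close>

definition in_product_action ::
    "'a set \<Rightarrow> ('a \<Rightarrow> 'a) set \<Rightarrow> 'd set \<Rightarrow> ('d \<Rightarrow> 'd) set \<Rightarrow> nat \<Rightarrow> (nat \<Rightarrow> nat) set \<Rightarrow> bool" where
  "in_product_action \<Omega> G \<Delta> H k K \<longleftrightarrow>
     (\<exists>f. bij_betw f \<Omega> ({1..k} \<rightarrow>\<^sub>E \<Delta>) \<and>
          (\<forall>g\<in>G. \<exists>w\<in>carrier (wreath_product (perm_group \<Delta> H) k K).
             \<forall>x\<in>\<Omega>. f (g x) = product_action k \<Delta> id w (f x)))"

definition product_action_case ::
    "nat \<Rightarrow> 'a set \<Rightarrow> ('a \<Rightarrow> 'a) set \<Rightarrow> 'd set \<Rightarrow> ('d \<Rightarrow> 'd) set \<Rightarrow> nat \<Rightarrow> (nat \<Rightarrow> nat) set \<Rightarrow> bool" where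
  "product_action_case p \<Omega> G \<Delta> H k K \<longleftrightarrow>
     k \<ge> 2 \<and> finite \<Delta> \<and>
     primitive_perm_group \<Delta> H \<and> almost_simple (perm_group \<Delta> H) \<and>
     property_star p (perm_group \<Delta> H) \<Delta> id \<and>
     subgroup K (sym_group k) \<and> in_product_action \<Omega> G \<Delta> H k K \<and>
     (coprime p (card K) \<or> p dvd card K \<and> (\<exists>m. card \<Delta> = p ^ m))"

end

(*
A minimal normal subgroup N of G is transitive and inherits the property; if it is abelian, G is affine
and the degree is a power of p. Otherwise N is the direct product of nonabelian simple groups
T_1, ..., T_k permuted by G, and by primitivity a point stabiliser N_w either projects onto every T_i
or is the product of its projections. In the first case the elements of N_w of minimal support form a
diagonal subgroup over some T_i and T_j, and comparing the Sylow subgroups of its conjugates by T_i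
makes a Sylow p-subgroup of T_i normal, which is absurd. In the second case the point set is
Delta^k with Delta = T_1/(T_1)_w, and G acts in product action. The group H induced on Delta has
trivial centraliser of T_1: a p-element x centralising T_1 moves w to qw with q in a Sylow subgroup Q
of T_1, and transporting this equation along T_1 puts every conjugate of q into Q. If a p-element of G
moves a coordinate, then the orbits of a Sylow p-subgroup, being orbits of its intersection with N,
can only be independent of the other coordinates if Delta is a single orbit, so |Delta| is a power
of p. Neither the Schreier conjecture nor the O'Nan-Scott theorem is needed.
*)
theory Submission
  imports Defs
begin

section \<open>Sylow subgroups of normal subgroups\<close>

text \<open>The star property is a statement about lengths: the orbits of \<open>P\<close> have as
  lengths the \<open>p\<close>-parts of the orbit lengths of \<open>G\<close>. A transitive normal
  subgroup \<open>N\<close> has the same orbit as \<open>G\<close>, so the orbits of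
  \<open>P\<close> and of \<open>P \<inter> N\<close> have equal length and coincide. Whatever an
  element of \<open>P\<close> does to a point is therefore done there by an element of
  \<open>P \<inter> N\<close>, whose action is known component by component; this is how elements
  outside \<open>N\<close> are controlled. Sylow subgroups of many nested subgroups must be compared
  for one fixed \<open>P\<close>. So all subgroups remain subsets of one ambient group, and
  \<open>normal_in\<close> and \<open>sylow_in\<close> are relations between subsets. The direct
  decomposition of \<open>N\<close> is not built as an isomorphism: an element of \<open>N\<close>
  induces an inner automorphism on each factor, and trivial centres make the inducing element, its
  component, unique. Primitivity enters in one shape: if \<open>G_w\<close> normalises a subgroup,
  the orbit of that subgroup at \<open>w\<close> is \<open>{w}\<close> or everything. For the
  converse, the star property follows from upper bounds on the orbit lengths of a Sylow subgroup,
  and product actions supply these coordinatewise.\<close>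

definition cj :: "('g, 'm) monoid_scheme \<Rightarrow> 'g \<Rightarrow> 'g \<Rightarrow> 'g" where
  "cj G g x = g \<otimes>\<^bsub>G\<^esub> x \<otimes>\<^bsub>G\<^esub> inv\<^bsub>G\<^esub> g"

definition normal_in :: "'g set \<Rightarrow> 'g set \<Rightarrow> ('g, 'm) monoid_scheme \<Rightarrow> bool" where
  "normal_in N S G \<longleftrightarrow> subgroup N G \<and> N \<subseteq> S \<and> (\<forall>s\<in>S. \<forall>n\<in>N. cj G s n \<in> N)"

definition sylow_in :: "nat \<Rightarrow> 'g set \<Rightarrow> 'g set \<Rightarrow> ('g, 'm) monoid_scheme \<Rightarrow> bool" where
  "sylow_in p P S G \<longleftrightarrow> subgroup P G \<and> P \<subseteq> S \<and> card P = p ^ multiplicity p (card S)"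

section \<open>Conjugation, Lagrange and counting by fibres\<close>

context group
begin

lemma inv_cancel [simp]:
  "\<lbrakk>x \<in> carrier G; y \<in> carrier G\<rbrakk> \<Longrightarrow> inv x \<otimes> (x \<otimes> y) = y"
  "\<lbrakk>x \<in> carrier G; y \<in> carrier G\<rbrakk> \<Longrightarrow> x \<otimes> (inv x \<otimes> y) = y"
  by (simp_all add: m_assoc[symmetric])

lemma cj_closed [simp]: "\<lbrakk>g \<in> carrier G; x \<in> carrier G\<rbrakk> \<Longrightarrow> cj G g x \<in> carrier G"
  by (simp add: cj_def)

lemma cj_mult:
  "\<lbrakk>g \<in> carrier G; x \<in> carrier G; y \<in> carrier G\<rbrakk> \<Longrightarrow> cj G g (x \<otimes> y) = cj G g x \<otimes> cj G g y"
  by (simp add: cj_def m_assoc)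

lemma cj_cj:
  "\<lbrakk>g \<in> carrier G; h \<in> carrier G; x \<in> carrier G\<rbrakk> \<Longrightarrow> cj G g (cj G h x) = cj G (g \<otimes> h) x"
  by (simp add: cj_def m_assoc inv_mult_group)

lemma cj_one [simp]: "x \<in> carrier G \<Longrightarrow> cj G \<one> x = x" "g \<in> carrier G \<Longrightarrow> cj G g \<one> = \<one>"
  by (simp_all add: cj_def)

lemma cj_inv: "\<lbrakk>g \<in> carrier G; x \<in> carrier G\<rbrakk> \<Longrightarrow> cj G g (inv x) = inv (cj G g x)"
  by (simp add: cj_def m_assoc inv_mult_group)

lemma cj_inv_cancel [simp]:
  "\<lbrakk>g \<in> carrier G; x \<in> carrier G\<rbrakk> \<Longrightarrow> cj G (inv g) (cj G g x) = x"
  "\<lbrakk>g \<in> carrier G; x \<in> carrier G\<rbrakk> \<Longrightarrow> cj G g (cj G (inv g) x) = x"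
  by (simp_all add: cj_cj)

lemma cj_eq_iff [simp]:
  "\<lbrakk>g \<in> carrier G; x \<in> carrier G; y \<in> carrier G\<rbrakk> \<Longrightarrow> cj G g x = cj G g y \<longleftrightarrow> x = y"
  by (metis cj_inv_cancel(1))

lemma cj_eq_self_iff:
  "\<lbrakk>g \<in> carrier G; x \<in> carrier G\<rbrakk> \<Longrightarrow> cj G g x = x \<longleftrightarrow> g \<otimes> x = x \<otimes> g"
  by (simp add: cj_def inv_solve_right')

lemma subgroup_Int: "\<lbrakk>subgroup A G; subgroup B G\<rbrakk> \<Longrightarrow> subgroup (A \<inter> B) G"
  by (rule subgroups_Inter_pair)

lemma subgroup_cj_closed: "\<lbrakk>subgroup A G; g \<in> A; x \<in> A\<rbrakk> \<Longrightarrow> cj G g x \<in> A"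
  by (simp add: cj_def subgroup.m_closed subgroup.m_inv_closed)

lemma subgroup_image_cj:
  assumes A: "subgroup A G" and g: "g \<in> carrier G"
  shows "subgroup (cj G g ` A) G"
proof (rule subgroupI)
  note [simp] = subgroup.mem_carrier[OF A] subgroup.m_closed[OF A] subgroup.m_inv_closed[OF A] g
  show "cj G g ` A \<subseteq> carrier G" "cj G g ` A \<noteq> {}"
    using subgroup.one_closed[OF A] by auto
  show "inv a \<in> cj G g ` A" if "a \<in> cj G g ` A" for a
    using that by (auto simp: cj_inv[symmetric])
  show "a \<otimes> b \<in> cj G g ` A" if "a \<in> cj G g ` A" "b \<in> cj G g ` A" for a b
    using that by (auto simp: cj_mult[symmetric])
qed

lemma normal_in_carrier: "normal_in N (carrier G) G \<longleftrightarrow> N \<lhd> G"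
  unfolding normal_in_def cj_def normal_inv_iff by (auto dest: subgroup.subset)

lemma normal_in_inter:
  "\<lbrakk>normal_in N S G; subgroup A G\<rbrakk> \<Longrightarrow> normal_in (N \<inter> A) (S \<inter> A) G"
  by (auto simp: normal_in_def subgroup_Int subgroup_cj_closed)

lemma card_image_cj:
  assumes "g \<in> carrier G" "A \<subseteq> carrier G"
  shows "card (cj G g ` A) = card A"
  by (rule card_image) (use assms in \<open>auto simp: inj_on_def subset_iff\<close>)

lemma subgroup_mono_dvd:
  assumes "subgroup A G" "subgroup B G" "A \<subseteq> B"
  shows "card A dvd card B"
proof -
  interpret B: group "G\<lparr>carrier := B\<rparr>" using assms(2) by (rule subgroup_imp_group)
  have "subgroup A (G\<lparr>carrier := B\<rparr>)" using assms by (rule subgroup_incl)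
  from B.lagrange[OF this] show ?thesis by (simp add: order_def) (metis dvd_triv_right)
qed

text \<open>The fibre of \<open>f\<close> through \<open>s\<close> is the left coset of
  \<open>D\<close> at \<open>s\<close>, so every fibre has the size of \<open>D\<close>. The same
  count yields the homomorphism formula, with \<open>D\<close> a kernel, and the orbit-stabiliser
  formula, with \<open>D\<close> a point stabiliser.\<close>

lemma card_subgroup_fibres:
  assumes S: "subgroup S G" "finite S" and D: "D \<subseteq> S"
    and f: "\<And>s t. \<lbrakk>s \<in> S; t \<in> S\<rbrakk> \<Longrightarrow> f s = f t \<longleftrightarrow> inv s \<otimes> t \<in> D"
  shows "card S = card (f ` S) * card D"
proof -
  note [simp] = subgroup.mem_carrier[OF S(1)] subgroup.m_closed[OF S(1)]
    subgroup.m_inv_closed[OF S(1)]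
  have "card {t \<in> S. f t = f s} = card D" if s: "s \<in> S" for s
  proof -
    have "{t \<in> S. f t = f s} = (\<lambda>d. s \<otimes> d) ` D"
    proof (intro equalityI subsetI)
      fix t assume "t \<in> {t \<in> S. f t = f s}"
      then have "inv s \<otimes> t \<in> D" "t = s \<otimes> (inv s \<otimes> t)"
        using s f[of s t] by auto
      then show "t \<in> (\<lambda>d. s \<otimes> d) ` D" by blast
    next
      fix t assume "t \<in> (\<lambda>d. s \<otimes> d) ` D"
      then obtain d where d: "d \<in> D" "t = s \<otimes> d" by blast
      then have "d \<in> S" using D by blast
      then show "t \<in> {t \<in> S. f t = f s}" using d s f[of s t] by simp
    qed
    moreover have "inj_on (\<lambda>d. s \<otimes> d) D"
      using s D by (auto simp: inj_on_def subset_iff)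
    ultimately show ?thesis by (simp add: card_image)
  qed
  then have "(\<Sum>y\<in>f ` S. card {t \<in> S. f t = y}) = (\<Sum>y\<in>f ` S. card D)"
    by (intro sum.cong) auto
  moreover have "card S = (\<Sum>y\<in>f ` S. card {t \<in> S. f t = y})"
    using card_eq_sum S(2) sum.image_gen[of S "\<lambda>_. 1::nat" f] by simp
  ultimately show ?thesis by simp
qed

lemma card_hom_image:
  assumes S: "subgroup S G" "finite S" and H: "group H"
    and f: "f ` S \<subseteq> carrier H" "\<And>s t. \<lbrakk>s \<in> S; t \<in> S\<rbrakk> \<Longrightarrow> f (s \<otimes> t) = f s \<otimes>\<^bsub>H\<^esub> f t"
  shows "card S = card (f ` S) * card {s \<in> S. f s = \<one>\<^bsub>H\<^esub>}"
    and "subgroup (f ` S) H"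
proof -
  interpret H: group H by fact
  interpret SG: group "G\<lparr>carrier := S\<rparr>" using S(1) by (rule subgroup_imp_group)
  interpret h: group_hom "G\<lparr>carrier := S\<rparr>" H f
    using f by unfold_locales (auto simp: hom_def)
  note [simp] = subgroup.mem_carrier[OF S(1)] subgroup.m_closed[OF S(1)]
    subgroup.m_inv_closed[OF S(1)]
  show "subgroup (f ` S) H" using h.img_is_subgroup by simp
  show "card S = card (f ` S) * card {s \<in> S. f s = \<one>\<^bsub>H\<^esub>}"
  proof (rule card_subgroup_fibres[OF S])
    fix s t assume st: "s \<in> S" "t \<in> S"
    then have "f t = f s \<otimes>\<^bsub>H\<^esub> f (inv s \<otimes> t)" using f(2)[of s "inv s \<otimes> t"] by simp
    then show "(f s = f t) = (inv s \<otimes> t \<in> {s \<in> S. f s = \<one>\<^bsub>H\<^esub>})"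
      using st f(1) by (simp add: image_subset_iff)
  qed auto
qed

text \<open>Both statements come from \<open>|S| = |f S| |ker f|\<close> and \<open>|P| = |f P| |P \<inter> ker f|\<close>, where the factors of
  the second product divide those of the first.\<close>

lemma sylow_in_hom:
  assumes fin: "finite (carrier G)" and p: "prime p" and S: "subgroup S G" and P: "sylow_in p P S G"
    and H: "group H" and f: "f ` S \<subseteq> carrier H"
      "\<And>s t. \<lbrakk>s \<in> S; t \<in> S\<rbrakk> \<Longrightarrow> f (s \<otimes> t) = f s \<otimes>\<^bsub>H\<^esub> f t"
  defines "K \<equiv> {s \<in> S. f s = \<one>\<^bsub>H\<^esub>}"
  shows "sylow_in p (f ` P) (f ` S) H" "sylow_in p (P \<inter> K) K G"
proof -
  have P': "subgroup P G" "P \<subseteq> S" "card P = p ^ multiplicity p (card S)"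
    using P by (auto simp: sylow_in_def)
  have finS: "finite S" "finite P" using fin S P'(1) by (meson finite_subset subgroup.subset)+
  have PK: "{s \<in> P. f s = \<one>\<^bsub>H\<^esub>} = P \<inter> K" using P'(2) by (auto simp: K_def)
  note hS = card_hom_image[OF S finS(1) H f, folded K_def]
  have "f ` P \<subseteq> carrier H" using f(1) P'(2) by blast
  note hP = card_hom_image[OF P'(1) finS(2) H this f(2)[OF subsetD[OF P'(2)] subsetD[OF P'(2)]],
      unfolded PK]
  interpret H: group H by fact
  interpret SG: group "G\<lparr>carrier := S\<rparr>" using S by (rule subgroup_imp_group)
  interpret h: group_hom "G\<lparr>carrier := S\<rparr>" H f
    by (intro group_hom.intro SG.is_group H group_hom_axioms.intro) (use f in \<open>auto simp: hom_def\<close>)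
  have K: "subgroup K G"
    using h.subgroup_kernel incl_subgroup[OF S] by (simp add: kernel_def K_def)
  have PKs: "subgroup (P \<inter> K) G" using subgroup_Int[OF P'(1) K] .
  have sub: "f ` P \<subseteq> f ` S" using P'(2) by blast
  have dvd: "card (f ` P) dvd card (f ` S)" "card (P \<inter> K) dvd card K"
    using H.subgroup_mono_dvd[OF hP(2) hS(2) sub] subgroup_mono_dvd[OF PKs K] by auto
  have pos: "card S > 0" using subgroup.finite_imp_card_positive[OF S fin] .
  obtain i j where ij: "card (f ` P) = p ^ i" "card (P \<inter> K) = p ^ j"
  proof -
    have "card (f ` P) dvd p ^ multiplicity p (card S)" "card (P \<inter> K) dvd p ^ multiplicity p (card S)"
      using hP(1) P'(3) by (metis dvd_triv_left, metis dvd_triv_right)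
    then show ?thesis using that unfolding divides_primepow_nat[OF p] by blast
  qed
  have "p ^ multiplicity p (card S) = p ^ (i + j)" using hP(1) P'(3) ij by (simp add: power_add)
  then have "multiplicity p (card S) = i + j" using prime_gt_1_nat[OF p] by simp
  moreover have "multiplicity p (card S) = multiplicity p (card (f ` S)) + multiplicity p (card K)"
    using hS(1) pos p prime_elem_multiplicity_mult_distrib[of p "card (f ` S)" "card K"] by auto
  moreover have "i \<le> multiplicity p (card (f ` S))" "j \<le> multiplicity p (card K)"
    using dvd ij hS(1) pos p by (auto intro!: multiplicity_geI)
  ultimately have "i = multiplicity p (card (f ` S))" "j = multiplicity p (card K)" by linarith+
  then show "sylow_in p (f ` P) (f ` S) H" "sylow_in p (P \<inter> K) K G"
    using ij hP(2) sub PKs by (simp_all add: sylow_in_def)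
qed

text \<open>\<open>N\<close> is the kernel of the quotient map on \<open>S\<close>, so this is the
  kernel half of \<open>sylow_in_hom\<close>.\<close>

lemma sylow_in_normal:
  assumes fin: "finite (carrier G)" and p: "prime p" and S: "subgroup S G"
    and P: "sylow_in p P S G" and N: "normal_in N S G"
  shows "sylow_in p (P \<inter> N) N G"
proof -
  let ?S = "G\<lparr>carrier := S\<rparr>"
  interpret S: group ?S using S by (rule subgroup_imp_group)
  have N': "subgroup N G" "N \<subseteq> S" "\<And>s n. \<lbrakk>s \<in> S; n \<in> N\<rbrakk> \<Longrightarrow> cj G s n \<in> N"
    using N by (auto simp: normal_in_def)
  have NS: "subgroup N ?S" using subgroup_incl[OF N'(1) S N'(2)] .
  have "N \<lhd> ?S"
    unfolding S.normal_inv_iff using NS N'(3) m_inv_consistent[OF S] by (auto simp: cj_def)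
  then interpret N: normal N ?S .
  have "{s \<in> S. N #>\<^bsub>?S\<^esub> s = \<one>\<^bsub>?S Mod N\<^esub>} = N"
    using S.coset_join1[OF _ _ NS] S.coset_join2[OF _ NS] N'(2) N.subset by (auto simp: FactGroup_def)
  moreover have "(\<lambda>s. N #>\<^bsub>?S\<^esub> s) \<in> hom ?S (?S Mod N)" by (rule N.r_coset_hom_Mod)
  ultimately show ?thesis
    using sylow_in_hom(2)[OF fin p S P N.factorgroup_is_group, of "\<lambda>s. N #>\<^bsub>?S\<^esub> s"]
    by (auto simp: hom_def)
qed

end

section \<open>Property \<open>(*)\<^sub>p\<close> and orbits of Sylow subgroups\<close>

definition nonabelian_simple_in :: "'g set \<Rightarrow> ('g, 'm) monoid_scheme \<Rightarrow> bool" where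
  "nonabelian_simple_in T G \<longleftrightarrow> subgroup T G \<and>
     (\<forall>M. normal_in M T G \<longrightarrow> M = {\<one>\<^bsub>G\<^esub>} \<or> M = T) \<and> (\<exists>x\<in>T. \<exists>y\<in>T. x \<otimes>\<^bsub>G\<^esub> y \<noteq> y \<otimes>\<^bsub>G\<^esub> x)"

text \<open>Only the values of \<open>\<alpha>\<close> on \<open>E\<close> are constrained, so the
  locale covers permutation groups, conjugation of \<open>G\<close> on itself and left translation
  of subsets of \<open>G\<close> alike.\<close>

locale finite_action = group G for G (structure) +
  fixes E :: "'x set" and \<alpha> :: "'a \<Rightarrow> 'x \<Rightarrow> 'x"
  assumes finite_carrier [simp]: "finite (carrier G)"
    and finite_E [simp]: "finite E"
    and act_closed [simp]: "\<lbrakk>g \<in> carrier G; x \<in> E\<rbrakk> \<Longrightarrow> \<alpha> g x \<in> E"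
    and act_mult: "\<lbrakk>g \<in> carrier G; h \<in> carrier G; x \<in> E\<rbrakk> \<Longrightarrow> \<alpha> (g \<otimes> h) x = \<alpha> g (\<alpha> h x)"
    and act_one [simp]: "x \<in> E \<Longrightarrow> \<alpha> \<one> x = x"
begin

definition stab :: "'a set \<Rightarrow> 'x \<Rightarrow> 'a set" where "stab S x = {s \<in> S. \<alpha> s x = x}"

definition orb :: "'a set \<Rightarrow> 'x \<Rightarrow> 'x set" where "orb S x = (\<lambda>s. \<alpha> s x) ` S"

definition transitive_on_E :: "'a set \<Rightarrow> bool" where
  "transitive_on_E S \<longleftrightarrow> (\<forall>x\<in>E. \<forall>y\<in>E. \<exists>s\<in>S. \<alpha> s x = y)"

text \<open>The witnessing Sylow subgroup is named, unlike in \<open>property_star\<close>, because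
  its intersections with normal subgroups have to witness the property there.\<close>

definition star :: "nat \<Rightarrow> 'a set \<Rightarrow> 'a set \<Rightarrow> bool" where
  "star p P S \<longleftrightarrow> sylow_in p P S G \<and> (\<forall>x\<in>E. sylow_in p (stab P x) (stab S x) G)"

lemma act_inv [simp]:
  assumes "g \<in> carrier G" "x \<in> E"
  shows "\<alpha> (inv g) (\<alpha> g x) = x" "\<alpha> g (\<alpha> (inv g) x) = x"
  using assms act_mult[of "inv g" g x] act_mult[of g "inv g" x] by simp_all

lemma act_eq_iff:
  assumes "g \<in> carrier G" "x \<in> E" "y \<in> E"
  shows "\<alpha> g x = y \<longleftrightarrow> x = \<alpha> (inv g) y"
  using assms by auto

lemma act_inj [simp]:
  assumes "g \<in> carrier G" "x \<in> E" "y \<in> E"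
  shows "\<alpha> g x = \<alpha> g y \<longleftrightarrow> x = y"
  using assms by (metis act_inv(1))

lemma finite_subgroup: "subgroup S G \<Longrightarrow> finite S"
  using finite_carrier by (blast intro: finite_subset dest: subgroup.subset)

lemma card_subgroup_pos: "subgroup S G \<Longrightarrow> card S > 0"
  using finite_subgroup subgroup.one_closed by (fastforce simp: card_gt_0_iff)

lemma stab_subgroup:
  assumes "subgroup S G" "x \<in> E"
  shows "subgroup (stab S x) G"
proof (rule subgroupI)
  note [simp] = subgroup.mem_carrier[OF assms(1)] subgroup.m_closed[OF assms(1)]
    subgroup.m_inv_closed[OF assms(1)] subgroup.one_closed[OF assms(1)]
  show "stab S x \<subseteq> carrier G" by (auto simp: stab_def)
  have "\<one> \<in> stab S x" using assms(2) by (simp add: stab_def)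
  then show "stab S x \<noteq> {}" by blast
  show "inv a \<in> stab S x" if "a \<in> stab S x" for a
    using that assms(2) by (auto simp: stab_def) (metis act_inv(1) \<open>\<And>x. x \<in> S \<Longrightarrow> x \<in> carrier G\<close>)
  show "a \<otimes> b \<in> stab S x" if "a \<in> stab S x" "b \<in> stab S x" for a b
    using that assms(2) by (auto simp: stab_def act_mult)
qed

lemma stab_Int: "stab (A \<inter> B) x = stab A x \<inter> stab B x"
  by (auto simp: stab_def)

lemma orb_subset: "\<lbrakk>subgroup S G; x \<in> E\<rbrakk> \<Longrightarrow> orb S x \<subseteq> E"
  by (auto simp: orb_def subgroup.mem_carrier)

lemma orb_self: "\<lbrakk>subgroup S G; x \<in> E\<rbrakk> \<Longrightarrow> x \<in> orb S x"
  unfolding orb_def by (rule image_eqI[of _ _ \<one>]) (simp_all add: subgroup.one_closed)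

lemma finite_orb: "subgroup S G \<Longrightarrow> finite (orb S x)"
  by (simp add: orb_def finite_subgroup)

lemma card_orb_pos: "\<lbrakk>subgroup S G; x \<in> E\<rbrakk> \<Longrightarrow> card (orb S x) > 0"
  using orb_self finite_orb by (metis card_gt_0_iff empty_iff)

lemma orb_eq:
  assumes S: "subgroup S G" and "x \<in> E" "y \<in> orb S x"
  shows "orb S y = orb S x"
proof -
  note [simp] = subgroup.mem_carrier[OF S] subgroup.m_closed[OF S] subgroup.m_inv_closed[OF S]
  obtain s where s: "s \<in> S" "y = \<alpha> s x" using assms by (auto simp: orb_def)
  have "\<alpha> t y \<in> orb S x" if "t \<in> S" for t
    unfolding orb_def by (rule image_eqI[of _ _ "t \<otimes> s"]) (use that s assms in \<open>simp_all add: act_mult\<close>)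
  moreover have "\<alpha> t x \<in> orb S y" if "t \<in> S" for t
    unfolding orb_def
    by (rule image_eqI[of _ _ "t \<otimes> inv s"]) (use that s assms in \<open>simp_all add: act_mult\<close>)
  ultimately show ?thesis by (auto simp: orb_def)
qed

lemma transitive_orb: "\<lbrakk>transitive_on_E S; subgroup S G; x \<in> E\<rbrakk> \<Longrightarrow> orb S x = E"
  by (rule equalityI[OF orb_subset]) (auto simp: transitive_on_E_def orb_def image_iff, metis)

lemma orbit_stabiliser:
  assumes "subgroup S G" "x \<in> E"
  shows "card S = card (orb S x) * card (stab S x)"
  unfolding orb_def
proof (rule card_subgroup_fibres)
  fix s t assume st: "s \<in> S" "t \<in> S"
  then have c: "s \<in> carrier G" "t \<in> carrier G" using assms by (auto simp: subgroup.mem_carrier)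
  have "inv s \<otimes> t \<in> S" using st assms by (simp add: subgroup.m_closed subgroup.m_inv_closed)
  then show "(\<alpha> s x = \<alpha> t x) = (inv s \<otimes> t \<in> stab S x)"
    using c assms(2) act_eq_iff[of s x "\<alpha> t x"] by (auto simp: stab_def act_mult)
qed (use assms in \<open>auto simp: finite_subgroup stab_def\<close>)

text \<open>Outside the fixed points every orbit of the \<open>p\<close>-group \<open>R\<close> has
  length a positive power of \<open>p\<close>, and these orbits partition
  \<open>Y - F\<close>.\<close>

lemma card_fixed_points_mod:
  assumes p: "prime p" and R: "subgroup R G" "card R = p ^ k"
    and Y: "Y \<subseteq> E" "\<And>r y. \<lbrakk>r \<in> R; y \<in> Y\<rbrakk> \<Longrightarrow> \<alpha> r y \<in> Y"
  shows "card {y \<in> Y. \<forall>r\<in>R. \<alpha> r y = y} mod p = card Y mod p"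
proof -
  define F where "F = {y \<in> Y. \<forall>r\<in>R. \<alpha> r y = y}"
  have finY: "finite Y" using Y(1) finite_E finite_subset by blast
  have YE: "y \<in> E" if "y \<in> Y" for y using that Y by blast
  have rc: "r \<in> carrier G" if "r \<in> R" for r using that R by (simp add: subgroup.mem_carrier)
  define C where "C = orb R ` (Y - F)"
  have UC: "\<Union>C = Y - F"
  proof
    show "Y - F \<subseteq> \<Union>C" using orb_self[OF R(1)] YE by (auto simp: C_def)
    show "\<Union>C \<subseteq> Y - F"
    proof
      fix z assume "z \<in> \<Union>C"
      then obtain y where y: "y \<in> Y" "y \<notin> F" "z \<in> orb R y" by (auto simp: C_def)
      then obtain s where s: "s \<in> R" "z = \<alpha> s y" by (auto simp: orb_def)
      have "z \<notin> F"
      proof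
        assume "z \<in> F"
        then have "orb R z = {z}" using subgroup.one_closed[OF R(1)] by (auto simp: orb_def F_def)
        then have "orb R y = {z}" using orb_eq[OF R(1) YE[OF y(1)] y(3)] by simp
        then have "\<alpha> r y = y" if "r \<in> R" for r
          using that orb_self[OF R(1) YE[OF y(1)]] by (auto simp: orb_def)
        then show False using y by (simp add: F_def)
      qed
      then show "z \<in> Y - F" using s y Y by simp
    qed
  qed
  have "p dvd card (\<Union>C)"
  proof (rule dvd_partition)
    show "finite (\<Union>C)" using UC finY by simp
    show "\<forall>c\<in>C. p dvd card c"
    proof
      fix c assume "c \<in> C"
      then obtain y where y: "y \<in> Y" "y \<notin> F" "c = orb R y" by (auto simp: C_def)
      have "card c dvd p ^ k"
        using orbit_stabiliser[OF R(1) YE[OF y(1)]] R(2) y(3) by (metis dvd_triv_left)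
      then obtain i where i: "card c = p ^ i" using p by (auto simp: divides_primepow_nat)
      have "card c \<noteq> 1"
      proof
        assume "card c = 1"
        then obtain z where "c = {z}" by (auto simp: card_1_singleton_iff)
        then have "\<alpha> r y = y" if "r \<in> R" for r
          using that y orb_self[OF R(1) YE[OF y(1)]] by (auto simp: orb_def)
        then show False using y by (simp add: F_def)
      qed
      then show "p dvd card c" using i by (cases i) auto
    qed
    show "\<forall>c1\<in>C. \<forall>c2\<in>C. c1 \<noteq> c2 \<longrightarrow> c1 \<inter> c2 = {}"
    proof (intro ballI impI, rule ccontr)
      fix c1 c2 assume c: "c1 \<in> C" "c2 \<in> C" "c1 \<noteq> c2" "c1 \<inter> c2 \<noteq> {}"
      then obtain y1 y2 z where "y1 \<in> E" "y2 \<in> E" "c1 = orb R y1" "c2 = orb R y2" "z \<in> c1" "z \<in> c2"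
        using YE by (auto simp: C_def)
      then have "c1 = c2" using orb_eq[OF R(1)] by metis
      then show False using c by simp
    qed
  qed
  then obtain d where d: "card (Y - F) = p * d" using UC by (metis dvdE)
  have "F \<subseteq> Y" by (auto simp: F_def)
  then have "card Y = card F + p * d"
    using d finY by (metis card_Diff_subset card_mono finite_subset le_add_diff_inverse)
  then show ?thesis by (simp add: F_def)
qed

end

text \<open>\<open>R\<close> acts on the left cosets of \<open>P\<close>, whose number is prime to
  \<open>p\<close>, so it fixes some coset \<open>gP\<close>; this puts \<open>R\<close> into the
  conjugate of \<open>P\<close> by \<open>g\<close>.\<close>

lemma (in group) sylow_conjugate:
  assumes fin: "finite (carrier G)" and p: "prime p" and R: "subgroup R G" "card R = p ^ k"
    and P: "sylow_in p P (carrier G) G"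
  shows "\<exists>g\<in>carrier G. R \<subseteq> cj G g ` P"
proof -
  have P': "subgroup P G" "P \<subseteq> carrier G" using P by (auto simp: sylow_in_def)
  note [simp] = subgroup.mem_carrier[OF P'(1)] subgroup.mem_carrier[OF R(1)]
    subgroup.m_closed[OF P'(1)] subgroup.m_inv_closed[OF P'(1)] subgroup.one_closed[OF P'(1)]
  interpret A: finite_action G "Pow (carrier G)" "\<lambda>g Y. (\<lambda>y. g \<otimes> y) ` Y"
    by unfold_locales (use fin in \<open>auto simp: image_image m_assoc image_def subset_iff\<close>)
  have G: "subgroup (carrier G) G" by (rule subgroup_self)
  define Y where "Y = A.orb (carrier G) P"
  \<comment> \<open>\<open>Y\<close> consists of the left cosets of \<open>P\<close>; knowing the
    stabiliser identifies \<open>card Y\<close> with the index of \<open>P\<close>.\<close>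
  have st: "A.stab (carrier G) P = P"
  proof
    show "A.stab (carrier G) P \<subseteq> P"
    proof
      fix g assume "g \<in> A.stab (carrier G) P"
      then have g: "g \<in> carrier G" "(\<lambda>y. g \<otimes> y) ` P = P" by (auto simp: A.stab_def)
      then have "g \<otimes> \<one> \<in> P" using subgroup.one_closed[OF P'(1)] by blast
      then show "g \<in> P" using g by simp
    qed
    show "P \<subseteq> A.stab (carrier G) P"
    proof
      fix g assume g: "g \<in> P"
      have "y \<in> (\<lambda>y. g \<otimes> y) ` P" if "y \<in> P" for y
        by (rule image_eqI[of _ _ "inv g \<otimes> y"]) (use g that in simp_all)
      then show "g \<in> A.stab (carrier G) P" using g by (auto simp: A.stab_def)
    qed
  qed
  have "card (carrier G) = card Y * card P"
    using A.orbit_stabiliser[OF G, of P] P'(2) by (simp add: Y_def st)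
  moreover have "card P = p ^ multiplicity p (card (carrier G))" using P by (simp add: sylow_in_def)
  moreover have cG: "card (carrier G) > 0" using A.card_subgroup_pos[OF G] .
  ultimately have ndvd: "\<not> p dvd card Y"
    proof -
    assume c: "card (carrier G) = card Y * card P" "card P = p ^ multiplicity p (card (carrier G))"
    show "\<not> p dvd card Y"
    proof (rule notI)
      assume "p dvd card Y"
      then have "p ^ Suc (multiplicity p (card (carrier G))) dvd card (carrier G)"
        using c by (metis dvd_refl mult_dvd_mono power_Suc)
      then have "Suc (multiplicity p (card (carrier G))) \<le> multiplicity p (card (carrier G))"
        using cG p by (intro multiplicity_geI) auto
      then show False by simp
    qed
  qed
  have "card {y \<in> Y. \<forall>r\<in>R. (\<lambda>z. r \<otimes> z) ` y = y} mod p = card Y mod p"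
  proof (rule A.card_fixed_points_mod[OF p R])
    show "Y \<subseteq> Pow (carrier G)" using A.orb_subset[OF G] P' by (auto simp: Y_def)
    fix r y assume "r \<in> R" "y \<in> Y"
    then obtain g where "g \<in> carrier G" "y = (\<lambda>x. g \<otimes> x) ` P" by (auto simp: Y_def A.orb_def)
    then show "(\<lambda>z. r \<otimes> z) ` y \<in> Y" unfolding Y_def A.orb_def
      using \<open>r \<in> R\<close> by (intro image_eqI[of _ _ "r \<otimes> g"]) (auto simp: image_image m_assoc)
  qed
  then have "{y \<in> Y. \<forall>r\<in>R. (\<lambda>z. r \<otimes> z) ` y = y} \<noteq> {}"
    using ndvd by (metis card.empty mod_0 mod_eq_0_iff_dvd)
  then obtain g where g: "g \<in> carrier G" "\<And>r. r \<in> R \<Longrightarrow> (\<lambda>z. r \<otimes> z) ` (\<lambda>x. g \<otimes> x) ` P = (\<lambda>x. g \<otimes> x) ` P"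
    by (auto simp: Y_def A.orb_def)
  have "R \<subseteq> cj G g ` P"
  proof
    fix r assume r: "r \<in> R"
    have "r \<otimes> (g \<otimes> \<one>) \<in> (\<lambda>x. g \<otimes> x) ` P" using g(2)[OF r] subgroup.one_closed[OF P'(1)] by blast
    then obtain x where x: "x \<in> P" "r \<otimes> g = g \<otimes> x" using g by auto
    then have "r = cj G g x" using g(1) r by (simp add: cj_def inv_solve_right)
    then show "r \<in> cj G g ` P" using x by blast
  qed
  then show ?thesis using g by blast
qed

lemma (in group) sylow_in_exists:
  assumes fin: "finite (carrier G)" and p: "prime p" and S: "subgroup S G"
  shows "\<exists>P. sylow_in p P S G"
proof -
  interpret S: group "G\<lparr>carrier := S\<rparr>" using S by (rule subgroup_imp_group)
  have finS: "finite S" "card S > 0"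
    using fin S by (auto intro: finite_subset dest: subgroup.subset)
      (metis card_gt_0_iff fin finite_subset subgroup.subset subgroup_nonempty)
  obtain m where "order (G\<lparr>carrier := S\<rparr>) = p ^ multiplicity p (card S) * m"
    unfolding order_def using multiplicity_dvd[of p "card S"] by (auto elim: dvdE)
  from sylow_thm[OF p S.is_group this] finS obtain P
    where P: "subgroup P (G\<lparr>carrier := S\<rparr>)" "card P = p ^ multiplicity p (card S)" by auto
  then have "subgroup P G" "P \<subseteq> S" using incl_subgroup[OF S] subgroup.subset by fastforce+
  then show ?thesis using P by (auto simp: sylow_in_def)
qed

text \<open>The Sylow existence theorem is applied with exponent 1: it yields a subgroup of order
  exactly \<open>p\<close>, any nontrivial element of which will do.\<close>

lemma (in group) cauchy:
  assumes fin: "finite (carrier G)" and p: "prime p" and S: "subgroup S G" and "p dvd card S"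
  shows "\<exists>x\<in>S. x \<noteq> \<one> \<and> x [^] p = \<one>"
proof -
  interpret S: group "G\<lparr>carrier := S\<rparr>" using S by (rule subgroup_imp_group)
  have finS: "finite S" using fin S by (auto intro: finite_subset dest: subgroup.subset)
  obtain m where "order (G\<lparr>carrier := S\<rparr>) = p ^ 1 * m"
    unfolding order_def using assms(4) by (auto elim: dvdE)
  from sylow_thm[OF p S.is_group this] finS obtain P
    where P: "subgroup P (G\<lparr>carrier := S\<rparr>)" "card P = p" by auto
  then have P': "subgroup P G" "P \<subseteq> S" using incl_subgroup[OF S] subgroup.subset by fastforce+
  interpret P: group "G\<lparr>carrier := P\<rparr>" using P'(1) by (rule subgroup_imp_group)
  have "card P > 1" using P p prime_gt_1_nat by simp
  then have "\<not> P \<subseteq> {\<one>}" using card_mono[of "{\<one>}" P] by fastforce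
  then obtain x where x: "x \<in> P" "x \<noteq> \<one>" by blast
  have "x [^]\<^bsub>G\<lparr>carrier := P\<rparr>\<^esub> card P = \<one>" using P.pow_order_eq_1[of x] x by (simp add: order_def)
  then show ?thesis using x P P' by (auto simp: nat_pow_consistent[symmetric])
qed

text \<open>The centre is the fixed point set of conjugation on \<open>T\<close>. Its size is
  divisible by \<open>p\<close> and it contains \<open>\<one>\<close>, so it is not trivial.\<close>

lemma (in group) p_group_centre:
  assumes fin: "finite (carrier G)" and p: "prime p" and T: "subgroup T G" "card T = p ^ k" "k > 0"
  shows "\<exists>z\<in>T. z \<noteq> \<one> \<and> (\<forall>t\<in>T. cj G t z = z)"
proof -
  interpret A: finite_action G "carrier G" "cj G"
    by unfold_locales (use fin in \<open>auto simp: cj_cj\<close>)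
  have "card {y \<in> T. \<forall>r\<in>T. cj G r y = y} mod p = card T mod p"
    by (rule A.card_fixed_points_mod[OF p T(1,2)])
       (use T(1) in \<open>auto dest: subgroup.subset simp: subgroup_cj_closed\<close>)
  moreover have "p dvd card T" using T by simp
  ultimately have "p dvd card {y \<in> T. \<forall>r\<in>T. cj G r y = y}" (is "p dvd card ?Z")
    by (simp add: dvd_eq_mod_eq_0)
  moreover have one: "\<one> \<in> ?Z" using T(1) by (simp add: subgroup.one_closed subgroup.mem_carrier)
  moreover have "?Z \<noteq> {\<one>}"
  proof
    assume "?Z = {\<one>}"
    then have "card ?Z = 1" by simp
    then show False using \<open>p dvd card ?Z\<close> p by simp
  qed
  ultimately show ?thesis by blast
qed

text \<open>A normal Sylow subgroup is nontrivial, hence all of \<open>T\<close>; then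
  \<open>T\<close> is a \<open>p\<close>-group, its nontrivial centre is again all of
  \<open>T\<close>, and \<open>T\<close> is abelian. Every later argument by Sylow subgroups of a
  simple factor ends in this contradiction.\<close>

lemma (in group) simple_sylow_not_normal:
  assumes fin: "finite (carrier G)" and p: "prime p" and T: "nonabelian_simple_in T G"
    and "p dvd card T" and Q: "sylow_in p Q T G"
  shows "\<not> normal_in Q T G"
proof
  assume N: "normal_in Q T G"
  have T': "subgroup T G" using T by (simp add: nonabelian_simple_in_def)
  have finT: "finite T" using fin T' by (auto intro: finite_subset dest: subgroup.subset)
  have "card T > 0" using finT T' by (metis card_gt_0_iff subgroup_nonempty)
  then have m: "multiplicity p (card T) > 0" using assms(4) p
    by (metis multiplicity_gt_zero_iff not_gr_zero not_prime_unit)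
  have "card Q \<noteq> 1" using Q m p by (auto simp: sylow_in_def)
  then have "Q = T" using N T by (auto simp: nonabelian_simple_in_def)
  then have "card T = p ^ multiplicity p (card T)" using Q by (simp add: sylow_in_def)
  from p_group_centre[OF fin p T' this m]
  obtain z where z: "z \<in> T" "z \<noteq> \<one>" "\<forall>t\<in>T. cj G t z = z" by blast
  define Z where "Z = {z \<in> T. \<forall>t\<in>T. cj G t z = z}"
  note [simp] = subgroup.mem_carrier[OF T'] subgroup.m_closed[OF T'] subgroup.m_inv_closed[OF T']
    subgroup.one_closed[OF T']
  have "subgroup Z G"
  proof (rule subgroupI)
    show "Z \<noteq> {}" using z by (auto simp: Z_def)
  qed (auto simp: Z_def cj_mult cj_inv)
  then have "normal_in Z T G" by (auto simp: normal_in_def Z_def)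
  then have "Z = T" using T z by (auto simp: nonabelian_simple_in_def Z_def)
  then have "x \<otimes> y = y \<otimes> x" if "x \<in> T" "y \<in> T" for x y
    using that cj_eq_self_iff[of x y] by (auto simp: Z_def)
  then show False using T by (auto simp: nonabelian_simple_in_def)
qed

section \<open>The star property in terms of normal subgroups and orbit lengths\<close>

context finite_action
begin

lemma star_sylow: "star p P S \<Longrightarrow> sylow_in p P S G"
  by (simp add: star_def)

text \<open>The point stabiliser in \<open>N\<close> is normal in the point stabiliser in
  \<open>S\<close>, so \<open>sylow_in_normal\<close> applies at every point as well as to
  \<open>N\<close> itself.\<close>

lemma star_normal:
  assumes p: "prime p" and S: "subgroup S G" and P: "star p P S" and N: "normal_in N S G"
  shows "star p (P \<inter> N) N"
  unfolding star_def
proof (intro conjI ballI)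
  show "sylow_in p (P \<inter> N) N G"
    using sylow_in_normal[OF finite_carrier p S star_sylow[OF P] N] .
  fix x assume x: "x \<in> E"
  have "normal_in (N \<inter> stab S x) (S \<inter> stab S x) G"
    using normal_in_inter[OF N stab_subgroup[OF S x]] .
  moreover have "N \<inter> stab S x = stab N x" "S \<inter> stab S x = stab S x"
    using N by (auto simp: normal_in_def stab_def)
  ultimately have "normal_in (stab N x) (stab S x) G" by simp
  from sylow_in_normal[OF finite_carrier p stab_subgroup[OF S x] _ this, of "stab P x"] P x
  show "sylow_in p (stab (P \<inter> N) x) (stab N x) G" by (simp add: star_def stab_Int)
qed

text \<open>An orbit length is the index of a stabiliser. In the index for \<open>P\<close> both
  orders are the \<open>p\<close>-parts of the corresponding orders for \<open>S\<close>.\<close>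

lemma star_card_orb:
  assumes p: "prime p" and S: "subgroup S G" and P: "star p P S" and x: "x \<in> E"
  shows "card (orb P x) = p ^ multiplicity p (card (orb S x))"
proof -
  have P': "subgroup P G" "card P = p ^ multiplicity p (card S)"
    "card (stab P x) = p ^ multiplicity p (card (stab S x))"
    using P x by (auto simp: star_def sylow_in_def)
  have pos: "card (orb S x) > 0" "card (stab S x) > 0"
    using card_orb_pos S x card_subgroup_pos stab_subgroup by blast+
  have "multiplicity p (card S) = multiplicity p (card (orb S x)) + multiplicity p (card (stab S x))"
    using orbit_stabiliser[OF S x] p pos by (simp add: prime_elem_multiplicity_mult_distrib)
  then have "card (orb P x) * p ^ multiplicity p (card (stab S x)) =
      p ^ multiplicity p (card (orb S x)) * p ^ multiplicity p (card (stab S x))"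
    using orbit_stabiliser[OF P'(1) x] P' by (metis power_add)
  then show ?thesis using prime_gt_0_nat[OF p] by (metis mult_right_cancel less_not_refl2 zero_less_power)
qed

text \<open>A short orbit of \<open>P\<close> means a large stabiliser, while Lagrange bounds that
  stabiliser by the \<open>p\<close>-part of the stabiliser in \<open>S\<close>. An upper bound on
  orbit lengths therefore forces equality.\<close>

lemma starI:
  assumes p: "prime p" and S: "subgroup S G" and P: "sylow_in p P S G"
    and le: "\<And>x. x \<in> E \<Longrightarrow> card (orb P x) \<le> p ^ multiplicity p (card (orb S x))"
  shows "star p P S"
  unfolding star_def
proof (intro conjI ballI P)
  fix x assume x: "x \<in> E"
  have P': "subgroup P G" "P \<subseteq> S" "card P = p ^ multiplicity p (card S)"
    using P by (auto simp: sylow_in_def)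
  have pos: "card (orb S x) > 0" "card (stab S x) > 0" "card (stab P x) > 0"
    using card_orb_pos S P'(1) x card_subgroup_pos stab_subgroup by blast+
  have mS: "multiplicity p (card S) = multiplicity p (card (orb S x)) + multiplicity p (card (stab S x))"
    using orbit_stabiliser[OF S x] p pos by (simp add: prime_elem_multiplicity_mult_distrib)
  have e: "card (orb P x) * card (stab P x) =
      p ^ multiplicity p (card (orb S x)) * p ^ multiplicity p (card (stab S x))"
    using orbit_stabiliser[OF P'(1) x] P' mS by (simp add: power_add)
  then have "card (stab P x) dvd p ^ multiplicity p (card S)"
    unfolding mS power_add by (metis dvd_triv_right)
  then obtain i where i: "card (stab P x) = p ^ i" using p by (auto simp: divides_primepow_nat)
  have "card (stab P x) dvd card (stab S x)"
    by (rule subgroup_mono_dvd) (use stab_subgroup S P' x in \<open>auto simp: stab_def\<close>)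
  then have "i \<le> multiplicity p (card (stab S x))"
    using i p pos by (intro multiplicity_geI) auto
  moreover have "p ^ multiplicity p (card (stab S x)) \<le> p ^ i"
  proof (rule ccontr)
    assume "\<not> ?thesis"
    then have "card (orb P x) * p ^ i <
        p ^ multiplicity p (card (orb S x)) * p ^ multiplicity p (card (stab S x))"
      using le[OF x] card_orb_pos[OF P'(1) x] by (intro mult_le_less_imp_less) auto
    then show False using e i by simp
  qed
  then have "multiplicity p (card (stab S x)) \<le> i" using p prime_gt_1_nat by simp
  ultimately have "card (stab P x) = p ^ multiplicity p (card (stab S x))" using i by simp
  then show "sylow_in p (stab P x) (stab S x) G"
    using stab_subgroup[OF P'(1) x] P'(2) by (auto simp: sylow_in_def stab_def)
qed

text \<open>One orbit contains the other, and both have length the \<open>p\<close>-part of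
  \<open>card E\<close>, by transitivity of \<open>N\<close> and hence of \<open>G\<close>.\<close>

lemma star_orb_eq:
  assumes p: "prime p" and P: "star p P (carrier G)" and N: "normal_in N (carrier G) G"
    and tr: "transitive_on_E N" and x: "x \<in> E"
  shows "orb P x = orb (P \<inter> N) x"
proof -
  have N': "subgroup N G" "N \<subseteq> carrier G" using N by (auto simp: normal_in_def)
  have "transitive_on_E (carrier G)" using tr N' by (fastforce simp: transitive_on_E_def)
  then have "card (orb P x) = p ^ multiplicity p (card E)"
    using star_card_orb[OF p subgroup_self P x] transitive_orb[OF _ subgroup_self x] by simp
  moreover have "card (orb (P \<inter> N) x) = p ^ multiplicity p (card E)"
    using star_card_orb[OF p N'(1) star_normal[OF p subgroup_self P N] x]
      transitive_orb[OF tr N'(1) x] by simp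
  moreover have "orb (P \<inter> N) x \<subseteq> orb P x" by (auto simp: orb_def)
  moreover have "subgroup P G" using P by (simp add: star_def sylow_in_def)
  ultimately show ?thesis by (metis card_subset_eq finite_orb)
qed

text \<open>\<open>R\<close> lies in a conjugate of \<open>P\<close>, so its orbit lies in a
  translate of an orbit of \<open>P\<close>. This covers \<open>p\<close>-subgroups that need not be
  Sylow, such as the images of a Sylow subgroup on the coordinates of a product.\<close>

lemma star_p_subgroup_card_orb:
  assumes p: "prime p" and P: "star p P (carrier G)" and tr: "transitive_on_E (carrier G)"
    and R: "subgroup R G" "card R = p ^ k" and x: "x \<in> E"
  shows "card (orb R x) \<le> p ^ multiplicity p (card E)"
proof -
  obtain g where g: "g \<in> carrier G" "R \<subseteq> cj G g ` P"
    using sylow_conjugate[OF finite_carrier p R star_sylow[OF P]] by blast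
  have P': "subgroup P G" using P by (simp add: star_def sylow_in_def)
  note [simp] = subgroup.mem_carrier[OF P']
  have "orb R x \<subseteq> \<alpha> g ` orb P (\<alpha> (inv g) x)"
  proof -
    have "\<alpha> (cj G g y) x \<in> \<alpha> g ` orb P (\<alpha> (inv g) x)" if "y \<in> P" for y
      using that g(1) x by (simp add: cj_def act_mult orb_def)
    then show ?thesis using g(2) by (auto simp: orb_def)
  qed
  then have "card (orb R x) \<le> card (orb P (\<alpha> (inv g) x))"
    by (meson card_image_le card_mono finite_imageI finite_orb P' le_trans)
  also have "\<dots> = p ^ multiplicity p (card E)"
    using star_card_orb[OF p subgroup_self P] transitive_orb[OF tr subgroup_self] g x by simp
  finally show ?thesis .
qed

text \<open>The degree is its own \<open>p\<close>-part, so the bound demanded by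
  \<open>starI\<close> is the trivial bound of an orbit by \<open>E\<close>.\<close>

lemma star_of_prime_power_degree:
  assumes p: "prime p" and tr: "transitive_on_E (carrier G)" and "card E = p ^ k"
    and P: "sylow_in p P (carrier G) G"
  shows "star p P (carrier G)"
proof (rule starI[OF p subgroup_self P])
  fix x assume x: "x \<in> E"
  have "subgroup P G" using P by (simp add: sylow_in_def)
  then have "card (orb P x) \<le> card E" using orb_subset x by (simp add: card_mono)
  also have "card E = p ^ multiplicity p (card E)"
    using assms(3) p by (simp add: multiplicity_same_power)
  finally show "card (orb P x) \<le> p ^ multiplicity p (card (orb (carrier G) x))"
    using transitive_orb[OF tr subgroup_self x] by simp
qed

end

section \<open>Primitive groups with a simple normal subgroup\<close>

text \<open>Conjugation maps \<open>G\<close> to the automorphism group of \<open>T\<close>; it is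
  injective because the centraliser of \<open>T\<close> is trivial, and its image contains the inner
  automorphisms because \<open>T\<close> is part of \<open>G\<close>.\<close>

lemma almost_simpleI:
  fixes G :: "'g monoid" (structure)
  assumes "group G" and fin: "finite (carrier G)" and T: "nonabelian_simple_in T G"
    and N: "normal_in T (carrier G) G"
    and C: "\<And>g. \<lbrakk>g \<in> carrier G; \<And>t. t \<in> T \<Longrightarrow> cj G g t = t\<rbrakk> \<Longrightarrow> g = \<one>"
  shows "almost_simple G"
proof -
  interpret group G by fact
  let ?T = "G\<lparr>carrier := T\<rparr>"
  have T': "subgroup T G" using T by (simp add: nonabelian_simple_in_def)
  note [simp] = subgroup.mem_carrier[OF T'] subgroup.m_closed[OF T'] subgroup.m_inv_closed[OF T']
    subgroup.one_closed[OF T']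
  interpret T: group ?T using T' by (rule subgroup_imp_group)
  have finT: "finite T" using fin T' by (auto intro: finite_subset dest: subgroup.subset)
  obtain x y where xy: "x \<in> T" "y \<in> T" "x \<otimes> y \<noteq> y \<otimes> x"
    using T by (auto simp: nonabelian_simple_in_def)
  have nc: "\<not> comm_group ?T"
  proof
    assume "comm_group ?T"
    then interpret c: comm_group ?T .
    show False using c.m_comm[of x y] xy by simp
  qed
  have cjT: "cj G g t \<in> T" if "g \<in> carrier G" "t \<in> T" for g t
    using that N by (auto simp: normal_in_def)
  have "simple_group ?T"
  proof (intro simple_group.intro simple_group_axioms.intro T.is_group)
    have "x \<noteq> \<one>" using xy by auto
    then have "{\<one>, x} \<subseteq> T" "card {\<one>, x} = 2" using xy by auto
    then have "2 \<le> card T" using card_mono[OF finT] by metis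
    then show "1 < order ?T" by (simp add: order_def)
    fix H assume "H \<lhd> ?T"
    then interpret H: normal H ?T .
    have "subgroup H G" using incl_subgroup[OF T' H.is_subgroup] .
    moreover have "cj G t h \<in> H" if "t \<in> T" "h \<in> H" for t h
      using H.inv_op_closed2[of t h] that T' by (simp add: cj_def m_inv_consistent)
    ultimately have "normal_in H T G" using H.subset by (simp add: normal_in_def)
    then show "H = carrier ?T \<or> H = {\<one>\<^bsub>?T\<^esub>}"
      using T by (auto simp: nonabelian_simple_in_def)
  qed
  define c where "c = (\<lambda>g. \<lambda>t\<in>T. cj G g t)"
  have bij: "c g \<in> Bij T" if "g \<in> carrier G" for g
  proof -
    have "bij_betw (c g) T T"
      by (rule bij_betwI[where g = "c (inv g)"]) (use that cjT in \<open>auto simp: c_def\<close>)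
    then show ?thesis by (simp add: Bij_def c_def)
  qed
  have auto: "c g \<in> auto ?T" if "g \<in> carrier G" for g
    using bij[OF that] cjT[OF that] that by (auto simp: auto_def hom_def c_def cj_mult)
  have mult: "c (g \<otimes> h) = c g \<otimes>\<^bsub>BijGroup T\<^esub> c h" if "g \<in> carrier G" "h \<in> carrier G" for g h
    using that bij[OF that(1)] bij[OF that(2)] cjT
    by (auto simp: BijGroup_def c_def compose_def cj_cj intro!: restrict_ext)
  interpret B: group "BijGroup T" by (rule group_BijGroup)
  interpret A: group "AutoGroup ?T" by (rule T.AutoGroup)
  interpret h: group_hom G "AutoGroup ?T" c
    by unfold_locales (auto simp: hom_def AutoGroup_def auto mult)
  define L where "L = c ` carrier G"
  have L: "subgroup L (AutoGroup ?T)" unfolding L_def by (rule h.img_is_subgroup)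
  have "inner_automorphisms ?T \<subseteq> L"
    unfolding inner_automorphisms_def
  proof safe
    fix g assume g: "g \<in> carrier ?T"
    have "(\<lambda>x\<in>carrier ?T. g \<otimes>\<^bsub>?T\<^esub> x \<otimes>\<^bsub>?T\<^esub> inv\<^bsub>?T\<^esub> g) = c g"
      using g T' by (auto simp: c_def cj_def m_inv_consistent)
    then show "(\<lambda>x\<in>carrier ?T. g \<otimes>\<^bsub>?T\<^esub> x \<otimes>\<^bsub>?T\<^esub> inv\<^bsub>?T\<^esub> g) \<in> L"
      using g by (auto simp: L_def)
  qed
  moreover have "c \<in> iso G (AutoGroup ?T\<lparr>carrier := L\<rparr>)"
  proof -
    have "inj_on c (carrier G)"
    proof (rule inj_onI)
      fix g h assume gh: "g \<in> carrier G" "h \<in> carrier G" "c g = c h"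
      have "cj G (inv h \<otimes> g) t = t" if "t \<in> T" for t
      proof -
        have "cj G g t = cj G h t" using fun_cong[OF gh(3), of t] that by (simp add: c_def)
        then show ?thesis using gh that by (simp add: cj_cj[symmetric])
      qed
      then have "inv h \<otimes> g = \<one>" using gh by (intro C) auto
      then show "g = h" using gh by (metis inv_equality inv_inv inv_closed)
    qed
    then show ?thesis
      using h.homh by (auto simp: iso_def hom_def bij_betw_def L_def)
  qed
  then have "G \<cong> AutoGroup ?T\<lparr>carrier := L\<rparr>" by (auto simp: is_iso_def)
  ultimately show ?thesis
    unfolding almost_simple_def using \<open>simple_group ?T\<close> nc finT L
    by (intro exI[of _ ?T] exI[of _ L]) auto
qed

section \<open>Consequences of primitivity\<close>

locale primitive_group = finite_action +
  assumes faithful: "\<lbrakk>g \<in> carrier G; \<And>x. x \<in> E \<Longrightarrow> \<alpha> g x = x\<rbrakk> \<Longrightarrow> g = \<one>"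
    and transitive: "transitive_on_E (carrier G)"
    and card_E: "card E > 1"
    and primitive: "\<lbrakk>B \<subseteq> E; B \<noteq> {}; \<And>g. g \<in> carrier G \<Longrightarrow> \<alpha> g ` B = B \<or> \<alpha> g ` B \<inter> B = {}\<rbrakk>
      \<Longrightarrow> B = E \<or> (\<exists>x. B = {x})"
begin

text \<open>As \<open>G_w\<close> normalises \<open>U\<close>, the product of \<open>G_w\<close> and
  \<open>U\<close> is a subgroup above \<open>G_w\<close>, and \<open>orb U w\<close> is its orbit,
  hence a block.\<close>

lemma invariant_subgroup_orbit:
  assumes U: "subgroup U G" and w: "w \<in> E"
    and inv: "\<And>a u. \<lbrakk>a \<in> stab (carrier G) w; u \<in> U\<rbrakk> \<Longrightarrow> cj G a u \<in> U"
  shows "orb U w = {w} \<or> orb U w = E"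
proof -
  note [simp] = subgroup.mem_carrier[OF U] subgroup.m_closed[OF U] subgroup.m_inv_closed[OF U]
  have sub: "\<alpha> g ` orb U w \<subseteq> orb U w"
    if g: "g \<in> carrier G" and ne: "\<alpha> g ` orb U w \<inter> orb U w \<noteq> {}" for g
  proof -
    obtain u v where uv: "u \<in> U" "v \<in> U" "\<alpha> g (\<alpha> u w) = \<alpha> v w"
      using ne by (auto simp: orb_def)
    \<comment> \<open>Chosen to fix \<open>w\<close>: then \<open>g\<close> is \<open>v\<close>
      times \<open>a\<close> times the inverse of \<open>u\<close>, where \<open>a\<close>
      normalises \<open>U\<close>, so \<open>g\<close> maps \<open>orb U w\<close> into
      itself.\<close>
    define a where "a = inv v \<otimes> g \<otimes> u"
    have a: "a \<in> carrier G" "\<alpha> a w = w" using uv g w by (simp_all add: a_def act_mult)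
    have "\<alpha> g (\<alpha> x w) \<in> orb U w" if x: "x \<in> U" for x
    proof -
      let ?y = "v \<otimes> cj G a (inv u \<otimes> x)"
      have "?y \<in> U" using a uv x inv by (simp add: stab_def)
      have "g \<otimes> x = v \<otimes> a \<otimes> (inv u \<otimes> x)"
        using uv g x by (simp add: a_def m_assoc)
      also have "\<dots> = ?y \<otimes> a"
        using uv a x by (simp add: cj_def m_assoc)
      finally have "\<alpha> (g \<otimes> x) w = \<alpha> ?y w"
        using \<open>?y \<in> U\<close> a w by (metis act_mult subgroup.mem_carrier[OF U])
      then have "\<alpha> g (\<alpha> x w) = \<alpha> ?y w" using g x w by (simp add: act_mult)
      then show ?thesis using \<open>?y \<in> U\<close> by (auto simp: orb_def)
    qed
    then show ?thesis by (auto simp: orb_def)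
  qed
  have "orb U w = E \<or> (\<exists>x. orb U w = {x})"
  proof (rule primitive)
    show "orb U w \<subseteq> E" by (rule orb_subset[OF U w])
    show "orb U w \<noteq> {}" using orb_self[OF U w] by blast
    fix g assume g: "g \<in> carrier G"
    have "card (\<alpha> g ` orb U w) = card (orb U w)"
      by (rule card_image) (use orb_subset[OF U w] g in \<open>auto simp: inj_on_def subset_iff\<close>)
    then show "\<alpha> g ` orb U w = orb U w \<or> \<alpha> g ` orb U w \<inter> orb U w = {}"
      using sub[OF g] card_subset_eq[OF finite_orb[OF U]] by blast
  qed
  then show ?thesis using orb_self[OF U w] by (metis singletonD)
qed

text \<open>Normality in the transitive group \<open>S\<close> carries the fixed point
  \<open>w\<close> to every point, and the action is faithful. Later \<open>S\<close> is also the
  socle, in which the direct factors are normal although they need not be normal in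
  \<open>G\<close>.\<close>

lemma fixes_point_normal_trivial:
  assumes N: "normal_in N S G" and S: "transitive_on_E S" "subgroup S G" and w: "w \<in> E"
    and fix_w: "\<And>n. n \<in> N \<Longrightarrow> \<alpha> n w = w"
  shows "N = {\<one>}"
proof -
  have N': "subgroup N G" "N \<subseteq> S" "\<And>s n. \<lbrakk>s \<in> S; n \<in> N\<rbrakk> \<Longrightarrow> cj G s n \<in> N"
    using N by (auto simp: normal_in_def)
  note [simp] = subgroup.mem_carrier[OF N'(1)] subgroup.mem_carrier[OF S(2)]
    subgroup.m_inv_closed[OF S(2)]
  have "n = \<one>" if n: "n \<in> N" for n
  proof (rule faithful)
    fix x assume "x \<in> E"
    then obtain s where s: "s \<in> S" "\<alpha> s w = x" using S(1) w by (auto simp: transitive_on_E_def)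
    have "n \<otimes> s = s \<otimes> cj G (inv s) n" using s n by (simp add: cj_def m_assoc)
    then have "\<alpha> (n \<otimes> s) w = \<alpha> (s \<otimes> cj G (inv s) n) w" by (rule arg_cong)
    then have "\<alpha> n (\<alpha> s w) = \<alpha> s (\<alpha> (cj G (inv s) n) w)"
      using s(1) n w by (simp add: act_mult)
    then show "\<alpha> n x = x" using fix_w N'(3)[of "inv s" n] s n by simp
  qed (use n in simp)
  then show ?thesis using subgroup.one_closed[OF N'(1)] by blast
qed

lemma normal_trivial_or_transitive:
  assumes N: "normal_in N (carrier G) G"
  shows "N = {\<one>} \<or> transitive_on_E N"
proof (cases "\<exists>w\<in>E. orb N w = {w}")
  case True
  then obtain w where "w \<in> E" "orb N w = {w}" by blast
  then have "N = {\<one>}"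
    by (intro fixes_point_normal_trivial[OF N transitive subgroup_self]) (auto simp: orb_def)
  then show ?thesis ..
next
  case False
  have "orb N w = E" if "w \<in> E" for w
    using invariant_subgroup_orbit[of N w] that False N by (auto simp: normal_in_def stab_def)
  then show ?thesis by (auto simp: transitive_on_E_def orb_def image_iff)
qed

text \<open>The fixed points of \<open>t\<close> are permuted by everything that commutes with
  \<open>t\<close>, and \<open>C\<close> reaches all points.\<close>

lemma centralised_semiregular:
  assumes C: "transitive_on_E C" "C \<subseteq> carrier G" and t: "t \<in> carrier G" "w \<in> E" "\<alpha> t w = w"
    and comm: "\<And>c. c \<in> C \<Longrightarrow> t \<otimes> c = c \<otimes> t"
  shows "t = \<one>"
proof (rule faithful[OF t(1)])
  fix x assume "x \<in> E"
  then obtain c where c: "c \<in> C" "\<alpha> c w = x" using C t unfolding transitive_on_E_def by blast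
  then have "\<alpha> (t \<otimes> c) w = \<alpha> (c \<otimes> t) w" using comm by simp
  then show "\<alpha> t x = x" using c C(2) t by (simp add: act_mult subset_iff)
qed

text \<open>A nontrivial centraliser \<open>C\<close> of \<open>T\<close> is normal, hence
  transitive, as is \<open>T\<close>. Each of the two centralises the other, so both act
  semiregularly and an equation between images of one point becomes an equation between group
  elements.\<close>

lemma centraliser_of_simple_normal:
  assumes p: "prime p" "p dvd card E" and P: "star p P (carrier G)"
    and T: "nonabelian_simple_in T G" "normal_in T (carrier G) G"
    and g: "g \<in> carrier G" "\<And>t. t \<in> T \<Longrightarrow> cj G g t = t"
  shows "g = \<one>"
proof (rule ccontr)
  assume "g \<noteq> \<one>"
  have T': "subgroup T G" using T by (simp add: nonabelian_simple_in_def)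
  have P': "subgroup P G" using P by (simp add: star_def sylow_in_def)
  note [simp] = subgroup.mem_carrier[OF T'] subgroup.m_closed[OF T'] subgroup.m_inv_closed[OF T']
    subgroup.one_closed[OF T'] subgroup.mem_carrier[OF P']
  have cjT: "cj G g t \<in> T" if "g \<in> carrier G" "t \<in> T" for g t
    using that T by (auto simp: normal_in_def)
  define C where "C = {g \<in> carrier G. \<forall>t\<in>T. cj G g t = t}"
  have C: "subgroup C G"
  proof (rule subgroupI)
    have "\<one> \<in> C" by (simp add: C_def)
    then show "C \<noteq> {}" by blast
    show "inv a \<in> C" if "a \<in> C" for a
      using that by (auto simp: C_def) (metis cj_inv_cancel(1) subgroup.mem_carrier[OF T'])
  qed (auto simp: C_def cj_cj[symmetric])
  have comm: "c \<otimes> t = t \<otimes> c" if "c \<in> C" "t \<in> T" for c t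
    using that cj_eq_self_iff[of c t] by (auto simp: C_def)
  have Cn: "normal_in C (carrier G) G"
    unfolding normal_in_def
  proof (intro conjI C ballI)
    fix s c assume sc: "s \<in> carrier G" "c \<in> C"
    have "cj G (cj G s c) t = t" if "t \<in> T" for t
    proof -
      have "cj G c (cj G (inv s) t) = cj G (inv s) t" using sc that cjT by (simp add: C_def)
      then have "cj G s (cj G c (cj G (inv s) t)) = t" using sc that by simp
      moreover have "cj G (cj G s c) t = cj G s (cj G c (cj G (inv s) t))"
        using sc that by (simp add: C_def cj_cj) (simp add: cj_def m_assoc)
      ultimately show ?thesis by simp
    qed
    then show "cj G s c \<in> C" using sc by (simp add: C_def)
  qed (auto simp: C_def)
  have "g \<in> C" using g by (simp add: C_def)
  then have Ctr: "transitive_on_E C" using normal_trivial_or_transitive[OF Cn] \<open>g \<noteq> \<one>\<close> by blast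
  have "T \<noteq> {\<one>}" using T(1) by (auto simp: nonabelian_simple_in_def)
  then have Ttr: "transitive_on_E T" using normal_trivial_or_transitive[OF T(2)] by blast
  obtain w where w: "w \<in> E" using card_E by fastforce
  have pdvd: "p dvd card S" if "subgroup S G" "transitive_on_E S" for S
    using orbit_stabiliser[OF that(1) w] transitive_orb[OF that(2,1) w] p by simp
  have "sylow_in p (P \<inter> C) C G"
    using star_sylow[OF star_normal[OF p(1) subgroup_self P Cn]] .
  moreover have "multiplicity p (card C) > 0"
    using pdvd[OF C Ctr] p card_subgroup_pos[OF C]
    by (metis multiplicity_gt_zero_iff not_gr_zero not_prime_unit)
  ultimately have "card (P \<inter> C) \<noteq> 1" using p by (auto simp: sylow_in_def)
  then have "P \<inter> C \<noteq> {\<one>}" by auto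
  moreover have "\<one> \<in> P \<inter> C" using C P' by (simp add: subgroup.one_closed)
  ultimately obtain x where x: "x \<in> P" "x \<in> C" "x \<noteq> \<one>" by blast
  have orb: "orb P v = orb (P \<inter> T) v" if "v \<in> E" for v
    using star_orb_eq[OF p(1) P T(2) Ttr that] .
  have "\<alpha> x w \<in> orb (P \<inter> T) w" using orb[OF w] x by (auto simp: orb_def)
  then obtain q where q: "q \<in> P" "q \<in> T" "\<alpha> x w = \<alpha> q w" by (auto simp: orb_def)
  \<comment> \<open>Otherwise \<open>x\<close> fixes \<open>w\<close> and commutes with the
    transitive group \<open>T\<close>.\<close>
  have "q \<noteq> \<one>"
    using centralised_semiregular[OF Ttr subgroup.subset[OF T'] _ w, of x] comm x q(3) w by auto
  have cq: "cj G t q \<in> P \<inter> T" if t: "t \<in> T" for t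
  proof -
    have "\<alpha> x (\<alpha> t w) \<in> orb (P \<inter> T) (\<alpha> t w)" using orb[of "\<alpha> t w"] x t w by (auto simp: orb_def)
    then obtain r where r: "r \<in> P" "r \<in> T" "\<alpha> x (\<alpha> t w) = \<alpha> r (\<alpha> t w)" by (auto simp: orb_def)
    have "\<alpha> x (\<alpha> t w) = \<alpha> (t \<otimes> q) w"
      using comm[OF x(2) t] x t w q by (simp add: act_mult[symmetric]) (simp add: act_mult)
    then have e: "\<alpha> (t \<otimes> q) w = \<alpha> (r \<otimes> t) w" using r t w by (simp add: act_mult)
    have "\<alpha> (inv (r \<otimes> t) \<otimes> (t \<otimes> q)) w = \<alpha> (inv (r \<otimes> t)) (\<alpha> (t \<otimes> q) w)"
      using r t q w by (intro act_mult) simp_all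
    also have "\<dots> = w" unfolding e using r t w by (intro act_inv) simp_all
    finally have "\<alpha> (inv (r \<otimes> t) \<otimes> (t \<otimes> q)) w = w" .
    moreover have zT: "inv (r \<otimes> t) \<otimes> (t \<otimes> q) \<in> T" using r t q by simp
    \<comment> \<open>An element of \<open>T\<close> that fixes \<open>w\<close> commutes with the
      transitive group \<open>C\<close>.\<close>
    ultimately have "inv (r \<otimes> t) \<otimes> (t \<otimes> q) = \<one>"
      using centralised_semiregular[OF Ctr subgroup.subset[OF C] subgroup.mem_carrier[OF T' zT] w]
        comm[OF _ zT] by metis
    then have "t \<otimes> q = r \<otimes> t" using r t q by (metis inv_cancel(2) m_closed r_one subgroup.mem_carrier[OF T'])
    then have "cj G t q = r" using r t q by (simp add: cj_def inv_solve_right')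
    then show ?thesis using r by simp
  qed
  \<comment> \<open>The core of \<open>P \<inter> T\<close> in \<open>T\<close>. It contains
    \<open>q\<close>, so by simplicity it is \<open>T\<close>, and \<open>T\<close> is its own Sylow
    subgroup.\<close>
  define Q where "Q = {q \<in> P \<inter> T. \<forall>t\<in>T. cj G t q \<in> P \<inter> T}"
  have "subgroup Q G"
  proof (rule subgroupI)
    show "Q \<noteq> {}" using cq q by (auto simp: Q_def)
  qed (use P' in \<open>auto simp: Q_def cj_mult cj_inv subgroup.m_closed subgroup.m_inv_closed\<close>)
  then have "normal_in Q T G"
    by (auto simp: normal_in_def Q_def subgroup_cj_closed[OF T'] cj_cj)
  then have "Q = T" using T(1) cq q \<open>q \<noteq> \<one>\<close> by (auto simp: nonabelian_simple_in_def Q_def)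
  then have "P \<inter> T = T" by (auto simp: Q_def)
  then have "sylow_in p T T G"
    using star_sylow[OF star_normal[OF p(1) subgroup_self P T(2)]] by simp
  moreover have "normal_in T T G" using T' by (simp add: normal_in_def subgroup_cj_closed)
  ultimately show False
    using simple_sylow_not_normal[OF finite_carrier p(1) T(1) pdvd[OF T' Ttr]] by blast
qed

end

section \<open>Nonabelian minimal normal subgroups\<close>

definition minimal_normal_in :: "'g set \<Rightarrow> 'g set \<Rightarrow> ('g, 'm) monoid_scheme \<Rightarrow> bool" where
  "minimal_normal_in N S G \<longleftrightarrow> normal_in N S G \<and> N \<noteq> {\<one>\<^bsub>G\<^esub>} \<and>
     (\<forall>M. normal_in M S G \<longrightarrow> M \<subseteq> N \<longrightarrow> M = {\<one>\<^bsub>G\<^esub>} \<or> M = N)"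

lemma (in group) minimal_normal_exists:
  assumes fin: "finite (carrier G)" and S: "subgroup S G" "S \<noteq> {\<one>}"
  shows "\<exists>N. minimal_normal_in N S G"
proof -
  let ?P = "\<lambda>N. normal_in N S G \<and> N \<noteq> {\<one>}"
  have "?P S" using S by (simp add: normal_in_def subgroup_cj_closed)
  then obtain N where N: "?P N" and min: "\<And>M. ?P M \<Longrightarrow> card N \<le> card M"
    using ex_has_least_nat[of ?P S card] by blast
  have finN: "finite N" using N fin unfolding normal_in_def by (meson finite_subset subgroup.subset)
  have "M = {\<one>} \<or> M = N" if "normal_in M S G" "M \<subseteq> N" for M
    using that min[of M] finN card_seteq by blast
  then show ?thesis using N by (auto simp: minimal_normal_in_def)
qed

text \<open>\<open>T\<close> is introduced merely as a minimal normal subgroup of \<open>N\<close>.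
  Its simplicity, and the direct decomposition of \<open>N\<close>, follow once \<open>N\<close> is
  seen to be generated by the conjugates of \<open>T\<close>.\<close>

locale nonabelian_socle = primitive_group +
  fixes p :: nat and P N T :: "'a set"
  assumes prime_p: "prime p" and p_dvd: "p dvd card E" and star_P: "star p P (carrier G)"
    and N_minimal: "minimal_normal_in N (carrier G) G"
    and N_nonabelian: "\<exists>x\<in>N. \<exists>y\<in>N. x \<otimes> y \<noteq> y \<otimes> x"
    and T_minimal: "minimal_normal_in T N G"
begin

section \<open>The conjugates of \<open>T\<close> and their position in \<open>N\<close>\<close>

definition factors :: "'a set set" where "factors = (\<lambda>g. cj G g ` T) ` carrier G"

text \<open>As \<open>U\<close> has trivial centre, this is the component of \<open>n\<close> in the direct factor \<open>U\<close>.\<close>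

definition proj :: "'a set \<Rightarrow> 'a \<Rightarrow> 'a" where
  "proj U n = (THE t. t \<in> U \<and> (\<forall>s\<in>U. cj G n s = cj G t s))"

lemma N_normal: "normal_in N (carrier G) G"
  using N_minimal by (simp add: minimal_normal_in_def)

lemma N_subgroup: "subgroup N G"
  using N_normal by (simp add: normal_in_def)

lemmas N_carrier [simp] = subgroup.mem_carrier[OF N_subgroup]
lemmas N_closed [simp] = subgroup.m_closed[OF N_subgroup] subgroup.m_inv_closed[OF N_subgroup]
  subgroup.one_closed[OF N_subgroup]

lemma N_cj [simp]: "\<lbrakk>g \<in> carrier G; n \<in> N\<rbrakk> \<Longrightarrow> cj G g n \<in> N"
  using N_normal by (simp add: normal_in_def)

lemma N_transitive: "transitive_on_E N"
  using normal_trivial_or_transitive[OF N_normal] N_nonabelian by auto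

lemma finite_factors [simp]: "finite factors"
  by (simp add: factors_def)

lemma T_subset: "T \<subseteq> carrier G"
  using T_minimal by (auto simp: minimal_normal_in_def normal_in_def dest: subgroup.subset)

lemma T_in_factors: "T \<in> factors"
proof -
  have "cj G \<one> ` T = T" using T_subset by (auto simp: image_iff subset_iff)
  then show ?thesis unfolding factors_def by (metis imageI one_closed)
qed

lemma factor_cj: 
  assumes "U \<in> factors" "g \<in> carrier G"
  shows "cj G g ` U \<in> factors"
proof -
  obtain h where h: "h \<in> carrier G" "U = cj G h ` T" using assms(1) by (auto simp: factors_def)
  have "cj G g ` U = cj G (g \<otimes> h) ` T"
    unfolding h(2) image_image using h assms(2) T_subset by (intro image_cong) (auto simp: cj_cj)
  then show ?thesis unfolding factors_def using h assms(2) by auto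
qed

lemma factors_conjugate:
  assumes "U \<in> factors" "V \<in> factors"
  shows "\<exists>g\<in>carrier G. cj G g ` U = V"
proof -
  obtain h where h: "h \<in> carrier G" "U = cj G h ` T" using assms(1) by (auto simp: factors_def)
  obtain k where k: "k \<in> carrier G" "V = cj G k ` T" using assms(2) by (auto simp: factors_def)
  have "cj G (k \<otimes> inv h) ` U = V"
    unfolding h(2) k(2) image_image using h k T_subset by (intro image_cong) (auto simp: cj_cj m_assoc)
  then show ?thesis using h k by blast
qed

text \<open>As \<open>N\<close> is normal in \<open>G\<close>, conjugation by an element of
  \<open>G\<close> is an automorphism of \<open>N\<close> and permutes the minimal normal subgroups
  of \<open>N\<close>.\<close>

lemma factor_minimal:
  assumes "U \<in> factors"
  shows "minimal_normal_in U N G"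
proof -
  obtain h where h: "h \<in> carrier G" "U = cj G h ` T" using assms(1) by (auto simp: factors_def)
  have T: "subgroup T G" "T \<subseteq> N" "\<And>n t. \<lbrakk>n \<in> N; t \<in> T\<rbrakk> \<Longrightarrow> cj G n t \<in> T" "T \<noteq> {\<one>}"
    and min: "\<And>M. \<lbrakk>normal_in M N G; M \<subseteq> T\<rbrakk> \<Longrightarrow> M = {\<one>} \<or> M = T"
    using T_minimal by (auto simp: minimal_normal_in_def normal_in_def)
  note [simp] = subgroup.mem_carrier[OF T(1)]
  have conj: "normal_in (cj G g ` M) N G" if "normal_in M N G" "g \<in> carrier G" for M g
    unfolding normal_in_def
  proof (intro conjI ballI)
    have M: "subgroup M G" "M \<subseteq> N" "\<And>n t. \<lbrakk>n \<in> N; t \<in> M\<rbrakk> \<Longrightarrow> cj G n t \<in> M"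
      using that by (auto simp: normal_in_def)
    show "subgroup (cj G g ` M) G" using subgroup_image_cj[OF M(1) that(2)] .
    show "cj G g ` M \<subseteq> N" using M that by auto
    fix n m assume "n \<in> N" "m \<in> cj G g ` M"
    then obtain m' where m': "m = cj G g m'" "m' \<in> M" by blast
    have "cj G n m = cj G g (cj G (cj G (inv g) n) m')"
      using m' M that \<open>n \<in> N\<close> by (simp add: cj_def m_assoc inv_mult_group subset_iff)
    then show "cj G n m \<in> cj G g ` M" using m' M(3) that \<open>n \<in> N\<close> by auto
  qed
  have "M = {\<one>} \<or> M = U" if M: "normal_in M N G" "M \<subseteq> U" for M
  proof -
    have MN: "M \<subseteq> N" using M by (auto simp: normal_in_def)
    have "cj G (inv h) ` M \<subseteq> T" using M(2) h by auto
    then have "cj G (inv h) ` M = {\<one>} \<or> cj G (inv h) ` M = T"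
      using min[OF conj[OF M(1)]] h by simp
    moreover have "cj G h ` cj G (inv h) ` M = M"
      unfolding image_image using MN h by (auto simp: image_iff subset_iff)
    ultimately show ?thesis using h by auto
  qed
  moreover have "U \<noteq> {\<one>}"
  proof
    assume U: "U = {\<one>}"
    have "t = \<one>" if "t \<in> T" for t
    proof -
      have "cj G h t = cj G h \<one>" using that U h by auto
      then show ?thesis using h that by (subst (asm) cj_eq_iff) auto
    qed
    then show False using T(4) subgroup.one_closed[OF T(1)] by blast
  qed
  moreover have "normal_in T N G" using T by (simp add: normal_in_def)
  ultimately show ?thesis using conj h by (auto simp: minimal_normal_in_def)
qed

lemma factor_subgroup: "U \<in> factors \<Longrightarrow> subgroup U G"
  using factor_minimal by (simp add: minimal_normal_in_def normal_in_def)

lemma factor_subset: "U \<in> factors \<Longrightarrow> U \<subseteq> N"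
  using factor_minimal by (simp add: minimal_normal_in_def normal_in_def)

lemma factor_N: "\<lbrakk>U \<in> factors; u \<in> U\<rbrakk> \<Longrightarrow> u \<in> N"
  using factor_subset by blast

lemma factor_carrier: "\<lbrakk>U \<in> factors; u \<in> U\<rbrakk> \<Longrightarrow> u \<in> carrier G"
  using factor_N by simp

lemma factor_normal: "U \<in> factors \<Longrightarrow> normal_in U N G"
  using factor_minimal by (simp add: minimal_normal_in_def)

lemma factor_N_cj: "\<lbrakk>U \<in> factors; n \<in> N; u \<in> U\<rbrakk> \<Longrightarrow> cj G n u \<in> U"
  using factor_normal by (simp add: normal_in_def)

lemma factors_Int:
  assumes "U \<in> factors" "V \<in> factors" "U \<noteq> V"
  shows "U \<inter> V = {\<one>}"
proof -
  have "normal_in (U \<inter> V) N G"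
    using factor_normal[OF assms(1)] factor_normal[OF assms(2)]
    by (auto simp: normal_in_def subgroup_Int)
  then have "U \<inter> V = {\<one>} \<or> U \<inter> V = U" "U \<inter> V = {\<one>} \<or> U \<inter> V = V"
    using factor_minimal[OF assms(1)] factor_minimal[OF assms(2)]
    by (simp_all add: minimal_normal_in_def)
  then show ?thesis using assms(3) by auto
qed

text \<open>The commutator of \<open>u\<close> and \<open>v\<close> lies in
  \<open>U \<inter> V\<close>, since both factors are normal in \<open>N\<close>.\<close>

lemma factors_commute:
  assumes UV: "U \<in> factors" "V \<in> factors" "U \<noteq> V" and u: "u \<in> U" and v: "v \<in> V"
  shows "cj G u v = v"
proof -
  note [simp] = factor_carrier[OF UV(1) u] factor_carrier[OF UV(2) v]
  have "cj G u v \<otimes> inv v \<in> V"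
    using factor_N_cj[OF UV(2) factor_N[OF UV(1) u] v] v factor_subgroup[OF UV(2)]
    by (simp add: subgroup.m_closed subgroup.m_inv_closed)
  moreover have "cj G u v \<otimes> inv v = u \<otimes> cj G v (inv u)" by (simp add: cj_def m_assoc)
  moreover have "u \<otimes> cj G v (inv u) \<in> U"
    using factor_N_cj[OF UV(1) factor_N[OF UV(2) v], of "inv u"] u factor_subgroup[OF UV(1)]
    by (simp add: subgroup.m_closed subgroup.m_inv_closed)
  ultimately have "cj G u v \<otimes> inv v = \<one>" using factors_Int[OF UV] by auto
  then show ?thesis by (metis cj_closed inv_closed inv_equality inv_inv \<open>u \<in> carrier G\<close> \<open>v \<in> carrier G\<close>)
qed

text \<open>The conjugates of \<open>T\<close> generate a normal subgroup of \<open>G\<close> inside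
  \<open>N\<close>, which is \<open>N\<close> by minimality. This acts as an induction principle: a
  condition that cuts out a subgroup holds on \<open>N\<close> once it holds on every
  factor.\<close>

lemma N_subset_if_factors_subset:
  assumes H: "subgroup H G" and sub: "\<And>U. U \<in> factors \<Longrightarrow> U \<subseteq> H"
  shows "N \<subseteq> H"
proof -
  define M where "M = generate G (\<Union>factors)"
  have UG: "\<Union>factors \<subseteq> carrier G" using factor_carrier by blast
  have M: "subgroup M G" unfolding M_def by (rule generate_is_subgroup[OF UG])
  have UM: "\<Union>factors \<subseteq> M" unfolding M_def by (intro subsetI generate.incl)
  have "M \<subseteq> N"
    unfolding M_def by (rule generate_subgroup_incl[OF _ N_subgroup]) (use factor_N in blast)
  have "cj G g m \<in> M" if "g \<in> carrier G" "m \<in> M" for g m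
  proof -
    have "M \<subseteq> cj G (inv g) ` M"
      unfolding M_def
    proof (rule generate_subgroup_incl)
      show "subgroup (cj G (inv g) ` generate G (\<Union>factors)) G"
        using subgroup_image_cj[OF M] that by (simp add: M_def)
      show "\<Union>factors \<subseteq> cj G (inv g) ` generate G (\<Union>factors)"
      proof
        fix u assume "u \<in> \<Union>factors"
        then obtain U where U: "U \<in> factors" "u \<in> U" by blast
        then have "cj G g u \<in> \<Union>factors" using factor_cj[OF U(1) that(1)] by blast
        then have "cj G g u \<in> M" using UM by blast
        moreover have "u = cj G (inv g) (cj G g u)" using that factor_carrier[OF U] by simp
        ultimately show "u \<in> cj G (inv g) ` generate G (\<Union>factors)" unfolding M_def by (rule rev_image_eqI)
      qed
    qed
    then have "m \<in> cj G (inv g) ` M" using that by blast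
    then obtain m' where "m' \<in> M" "m = cj G (inv g) m'" by blast
    then show ?thesis using that subgroup.mem_carrier[OF M] by simp
  qed
  then have "normal_in M (carrier G) G" using M by (simp add: normal_in_def subgroup.subset)
  moreover have "M \<noteq> {\<one>}"
  proof
    assume "M = {\<one>}"
    then have "T = {\<one>}"
      using UM T_in_factors subgroup.one_closed[OF factor_subgroup[OF T_in_factors]] by blast
    then show False using T_minimal by (simp add: minimal_normal_in_def)
  qed
  ultimately have "M = N" using N_minimal \<open>M \<subseteq> N\<close> by (auto simp: minimal_normal_in_def)
  moreover have "M \<subseteq> H" unfolding M_def by (rule generate_subgroup_incl[OF _ H]) (use sub in blast)
  ultimately show ?thesis by simp
qed

text \<open>Such a \<open>z\<close> is central in \<open>N\<close>. The centre of \<open>N\<close>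
  is normal in \<open>G\<close> and proper, as \<open>N\<close> is nonabelian, so it is trivial by
  minimality.\<close>

lemma centralises_factors_imp_one:
  assumes z: "z \<in> N" and c: "\<And>U u. \<lbrakk>U \<in> factors; u \<in> U\<rbrakk> \<Longrightarrow> cj G z u = u"
  shows "z = \<one>"
proof -
  have subg: "subgroup {n \<in> carrier G. z \<otimes> n = n \<otimes> z} G" if "z \<in> N" for z
  proof (rule subgroupI)
    have "\<one> \<in> {n \<in> carrier G. z \<otimes> n = n \<otimes> z}" using that by simp
    then show "{n \<in> carrier G. z \<otimes> n = n \<otimes> z} \<noteq> {}" by blast
    show "inv a \<in> {n \<in> carrier G. z \<otimes> n = n \<otimes> z}" if a: "a \<in> {n \<in> carrier G. z \<otimes> n = n \<otimes> z}" for a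
      using a \<open>z \<in> N\<close> cj_inv[of z a] cj_eq_self_iff[of z a] cj_eq_self_iff[of z "inv a"] by simp
    show "a \<otimes> b \<in> {n \<in> carrier G. z \<otimes> n = n \<otimes> z}"
      if "a \<in> {n \<in> carrier G. z \<otimes> n = n \<otimes> z}" "b \<in> {n \<in> carrier G. z \<otimes> n = n \<otimes> z}" for a b
      using that \<open>z \<in> N\<close> cj_mult[of z a b] cj_eq_self_iff[of z a] cj_eq_self_iff[of z b]
        cj_eq_self_iff[of z "a \<otimes> b"] by simp
  qed auto
  define Z where "Z = {z \<in> N. \<forall>n\<in>N. cj G n z = z}"
  have Z: "subgroup Z G"
  proof (rule subgroupI)
    have "\<one> \<in> Z" by (simp add: Z_def)
    then show "Z \<noteq> {}" by blast
  qed (auto simp: Z_def cj_mult cj_inv)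
  have "normal_in Z (carrier G) G"
    unfolding normal_in_def
  proof (intro conjI ballI Z)
    fix g y assume gy: "g \<in> carrier G" "y \<in> Z"
    have yN: "y \<in> carrier G" using gy by (simp add: Z_def)
    have "cj G n (cj G g y) = cj G g y" if "n \<in> N" for n
    proof -
      have "cj G n (cj G g y) = cj G g (cj G (cj G (inv g) n) y)"
        using gy(1) that yN by (simp add: cj_def m_assoc inv_mult_group)
      then show ?thesis using gy that by (simp add: Z_def)
    qed
    then show "cj G g y \<in> Z" using gy by (simp add: Z_def)
  qed (auto simp: Z_def)
  moreover have "Z \<noteq> N"
  proof
    assume "Z = N"
    then have "x \<otimes> y = y \<otimes> x" if "x \<in> N" "y \<in> N" for x y
      using that cj_eq_self_iff[of x y] by (auto simp: Z_def)
    then show False using N_nonabelian by blast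
  qed
  moreover have "Z \<subseteq> N" by (auto simp: Z_def)
  ultimately have "Z = {\<one>}" using N_minimal by (auto simp: minimal_normal_in_def)
  moreover have "z \<in> Z"
  proof -
    have "U \<subseteq> {n \<in> carrier G. z \<otimes> n = n \<otimes> z}" if "U \<in> factors" for U
      using c[OF that] cj_eq_self_iff[of z] z factor_carrier[OF that] by auto
    from N_subset_if_factors_subset[OF subg[OF z] this]
    have "z \<otimes> n = n \<otimes> z" if "n \<in> N" for n using that by blast
    then show ?thesis using z cj_eq_self_iff[of _ z] by (auto simp: Z_def)
  qed
  ultimately show ?thesis by blast
qed

lemma centralises_factor_imp_one:
  assumes U: "U \<in> factors" and z: "z \<in> U" "\<And>u. u \<in> U \<Longrightarrow> cj G z u = u"
  shows "z = \<one>"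
  by (rule centralises_factors_imp_one[OF factor_N[OF U z(1)]])
     (use z factors_commute[OF U] in metis)

text \<open>A normal subgroup \<open>M\<close> of \<open>U\<close> is normalised by \<open>U\<close>
  and centralised by all other factors, hence normal in \<open>N\<close>; minimality of
  \<open>U\<close> decides.\<close>

lemma factor_simple:
  assumes U: "U \<in> factors"
  shows "nonabelian_simple_in U G"
  unfolding nonabelian_simple_in_def
proof (intro conjI allI impI)
  show "subgroup U G" using factor_subgroup[OF U] .
  show "\<exists>x\<in>U. \<exists>y\<in>U. x \<otimes> y \<noteq> y \<otimes> x"
  proof (rule ccontr)
    assume "\<not> ?thesis"
    then have "cj G z u = u" if "z \<in> U" "u \<in> U" for z u
      using that cj_eq_self_iff[of z u] factor_carrier[OF U] by simp
    then have "z = \<one>" if "z \<in> U" for z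
      using centralises_factor_imp_one[OF U that] that by blast
    then have "U = {\<one>}" using subgroup.one_closed[OF factor_subgroup[OF U]] by blast
    then show False using factor_minimal[OF U] by (simp add: minimal_normal_in_def)
  qed
  fix M assume M: "normal_in M U G"
  have M': "subgroup M G" "M \<subseteq> U" "\<And>u m. \<lbrakk>u \<in> U; m \<in> M\<rbrakk> \<Longrightarrow> cj G u m \<in> M"
    using M by (auto simp: normal_in_def)
  note [simp] = subgroup.mem_carrier[OF M'(1)]
  \<comment> \<open>The normaliser of \<open>M\<close>, with the condition imposed on
    \<open>n\<close> and on its inverse so that closure under inverses is immediate.\<close>
  define H where "H = {n \<in> carrier G. (\<forall>m\<in>M. cj G n m \<in> M) \<and> (\<forall>m\<in>M. cj G (inv n) m \<in> M)}"
  have H: "subgroup H G"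
  proof (rule subgroupI)
    have "\<one> \<in> H" by (simp add: H_def)
    then show "H \<noteq> {}" by blast
  qed (auto simp: H_def cj_cj[symmetric] inv_mult_group)
  have "V \<subseteq> H" if V: "V \<in> factors" for V
  proof
    fix v assume v: "v \<in> V"
    have v': "inv v \<in> V" using v factor_subgroup[OF V] by (simp add: subgroup.m_inv_closed)
    show "v \<in> H"
    proof (cases "V = U")
      case True
      then show ?thesis using M'(3) v v' factor_carrier[OF V] by (auto simp: H_def)
    next
      case False
      then have "cj G v m = m" "cj G (inv v) m = m" if "m \<in> M" for m
        using factors_commute[OF V U] v v' that M'(2) by auto
      then show ?thesis using factor_carrier[OF V v] by (auto simp: H_def)
    qed
  qed
  from N_subset_if_factors_subset[OF H this] have "cj G n m \<in> M" if "n \<in> N" "m \<in> M" for n m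
    using that by (auto simp: H_def)
  then have "normal_in M N G" using M' factor_subset[OF U] by (auto simp: normal_in_def)
  then show "M = {\<one>} \<or> M = U" using factor_minimal[OF U] M'(2) by (auto simp: minimal_normal_in_def)
qed

section \<open>Components of elements of \<open>N\<close>\<close>

lemma proj_eqI:
  assumes U: "U \<in> factors" and t: "t \<in> U" "\<And>s. s \<in> U \<Longrightarrow> cj G n s = cj G t s"
  shows "proj U n = t"
  unfolding proj_def
proof (rule the_equality)
  fix t' assume t': "t' \<in> U \<and> (\<forall>s\<in>U. cj G n s = cj G t' s)"
  note [simp] = factor_carrier[OF U] subgroup.m_closed[OF factor_subgroup[OF U]]
    subgroup.m_inv_closed[OF factor_subgroup[OF U]]
  have "inv t \<otimes> t' = \<one>"
  proof (rule centralises_factor_imp_one[OF U])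
    show "inv t \<otimes> t' \<in> U" using t t' by simp
    show "cj G (inv t \<otimes> t') u = u" if "u \<in> U" for u
    proof -
      have "cj G t' u = cj G t u" using t t' that by simp
      then show ?thesis using t t' that by (simp add: cj_cj[symmetric])
    qed
  qed
  then show "t' = t" using t t' by (metis inv_cancel(2) r_one factor_carrier[OF U])
qed (use t in auto)

text \<open>The elements of \<open>N\<close> that induce an inner automorphism on \<open>U\<close>
  form a subgroup. It contains \<open>U\<close>, and it contains the other factors because they act
  trivially on \<open>U\<close>.\<close>

lemma proj_exists:
  assumes U: "U \<in> factors" and n: "n \<in> N"
  shows "\<exists>t\<in>U. \<forall>s\<in>U. cj G n s = cj G t s"
proof -
  note [simp] = factor_carrier[OF U] subgroup.m_closed[OF factor_subgroup[OF U]]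
    subgroup.m_inv_closed[OF factor_subgroup[OF U]] subgroup.one_closed[OF factor_subgroup[OF U]]
    factor_N_cj[OF U] factor_N[OF U]
  define H where "H = {n \<in> N. \<exists>t\<in>U. \<forall>s\<in>U. cj G n s = cj G t s}"
  have H: "subgroup H G"
  proof (rule subgroupI)
    have "\<one> \<in> H" by (auto simp: H_def intro!: bexI[of _ \<one>])
    then show "H \<noteq> {}" by blast
    show "H \<subseteq> carrier G" by (auto simp: H_def)
  next
    fix a assume "a \<in> H"
    then obtain t where t: "a \<in> N" "t \<in> U" "\<And>s. s \<in> U \<Longrightarrow> cj G a s = cj G t s" by (auto simp: H_def)
    have "cj G (inv a) s = cj G (inv t) s" if "s \<in> U" for s
    proof -
      have "cj G a (cj G (inv t) s) = s" using t that by simp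
      then have "cj G (inv a) (cj G a (cj G (inv t) s)) = cj G (inv a) s" by (rule arg_cong)
      moreover have "cj G (inv a) (cj G a (cj G (inv t) s)) = cj G (inv t) s"
        using t that by (intro cj_inv_cancel) simp_all
      ultimately show ?thesis by simp
    qed
    then show "inv a \<in> H" using t by (auto simp: H_def intro!: bexI[of _ "inv t"])
  next
    fix a b assume "a \<in> H" "b \<in> H"
    then obtain t r where t: "a \<in> N" "t \<in> U" "\<And>s. s \<in> U \<Longrightarrow> cj G a s = cj G t s"
      and r: "b \<in> N" "r \<in> U" "\<And>s. s \<in> U \<Longrightarrow> cj G b s = cj G r s" by (auto simp: H_def)
    have "cj G (a \<otimes> b) s = cj G (t \<otimes> r) s" if "s \<in> U" for s
      using t r that by (simp add: cj_cj[symmetric])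
    then show "a \<otimes> b \<in> H" using t r by (auto simp: H_def intro!: bexI[of _ "t \<otimes> r"])
  qed
  have "V \<subseteq> H" if V: "V \<in> factors" for V
  proof
    fix v assume v: "v \<in> V"
    show "v \<in> H"
    proof (cases "V = U")
      case True
      then show ?thesis using v by (auto simp: H_def)
    next
      case False
      then show ?thesis using factors_commute[OF V U _ v] factor_N[OF V v]
        by (auto simp: H_def intro!: bexI[of _ \<one>])
    qed
  qed
  from N_subset_if_factors_subset[OF H this] show ?thesis using n by (auto simp: H_def)
qed

lemma proj:
  assumes "U \<in> factors" "n \<in> N"
  shows "proj U n \<in> U" "s \<in> U \<Longrightarrow> cj G n s = cj G (proj U n) s"
proof -
  obtain t where "t \<in> U" "\<forall>s\<in>U. cj G n s = cj G t s" using proj_exists[OF assms] by blast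
  moreover from this have "proj U n = t" by (intro proj_eqI[OF assms(1)]) auto
  ultimately show "proj U n \<in> U" "s \<in> U \<Longrightarrow> cj G n s = cj G (proj U n) s" by auto
qed

lemma proj_carrier [simp]: "\<lbrakk>U \<in> factors; n \<in> N\<rbrakk> \<Longrightarrow> proj U n \<in> carrier G"
  using proj factor_carrier by blast

lemma proj_mult:
  assumes U: "U \<in> factors" and "m \<in> N" "n \<in> N"
  shows "proj U (m \<otimes> n) = proj U m \<otimes> proj U n"
proof (rule proj_eqI[OF U])
  show "proj U m \<otimes> proj U n \<in> U"
    using proj assms factor_subgroup[OF U] by (simp add: subgroup.m_closed)
  fix s assume s: "s \<in> U"
  then show "cj G (m \<otimes> n) s = cj G (proj U m \<otimes> proj U n) s"
    using assms factor_carrier[OF U] proj(2)[OF U assms(3) s]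
      proj(2)[OF U assms(2), of "cj G (proj U n) s"] proj(1)[OF U assms(3)]
      subgroup_cj_closed[OF factor_subgroup[OF U] proj(1)[OF U assms(3)] s]
    by (simp add: cj_cj[symmetric])
qed

lemma proj_self: "\<lbrakk>U \<in> factors; u \<in> U\<rbrakk> \<Longrightarrow> proj U u = u"
  by (rule proj_eqI) auto

lemma proj_other: "\<lbrakk>U \<in> factors; V \<in> factors; U \<noteq> V; v \<in> V\<rbrakk> \<Longrightarrow> proj U v = \<one>"
  using factors_commute[of V U v] factor_carrier
  by (intro proj_eqI) (auto simp: subgroup.one_closed[OF factor_subgroup])

lemma proj_one [simp]: "U \<in> factors \<Longrightarrow> proj U \<one> = \<one>"
  by (rule proj_self) (simp_all add: subgroup.one_closed[OF factor_subgroup])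

lemma proj_inv:
  assumes "U \<in> factors" "n \<in> N"
  shows "proj U (inv n) = inv (proj U n)"
proof -
  have "proj U (inv n) \<otimes> proj U n = \<one>" using assms by (simp add: proj_mult[symmetric])
  then show ?thesis using assms by (simp add: inv_equality)
qed

lemma proj_cj:
  assumes U: "U \<in> factors" and n: "n \<in> N" and g: "g \<in> carrier G"
  shows "proj (cj G g ` U) (cj G g n) = cj G g (proj U n)"
proof (rule proj_eqI[OF factor_cj[OF U g]])
  show "cj G g (proj U n) \<in> cj G g ` U" using proj[OF U n] by blast
  fix s assume "s \<in> cj G g ` U"
  then obtain u where u: "u \<in> U" "s = cj G g u" by blast
  have e: "cj G (cj G g m) (cj G g v) = cj G g (cj G m v)"
    if "m \<in> carrier G" "v \<in> carrier G" for m v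
    using that g by (simp add: cj_def m_assoc inv_mult_group)
  show "cj G (cj G g n) s = cj G (cj G g (proj U n)) s"
    unfolding u(2) using e factor_carrier[OF U u(1)] U n proj(2)[OF U n u(1)] by simp
qed

lemma proj_cj_self:
  assumes "U \<in> factors" "n \<in> N" "m \<in> N"
  shows "proj U (cj G n m) = cj G (proj U n) (proj U m)"
  using assms by (simp add: cj_def proj_mult proj_inv)

lemma proj_eq_imp_eq:
  assumes "m \<in> N" "n \<in> N" "\<And>U. U \<in> factors \<Longrightarrow> proj U m = proj U n"
  shows "m = n"
proof -
  have "inv n \<otimes> m = \<one>"
  proof (rule centralises_factors_imp_one)
    fix U u assume U: "U \<in> factors" "u \<in> U"
    have "proj U (inv n \<otimes> m) = \<one>" using assms U by (simp add: proj_mult proj_inv)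
    then show "cj G (inv n \<otimes> m) u = u"
      using proj(2)[OF U(1), of "inv n \<otimes> m" u] assms U factor_carrier by simp
  qed (use assms in simp)
  then show ?thesis using assms by (metis N_carrier inv_cancel(2) r_one)
qed

text \<open>The element is the product of the prescribed components, multiplied up one factor at a
  time. Together with \<open>proj_eq_imp_eq\<close> this says that \<open>N\<close> is the direct
  product of its factors.\<close>

lemma proj_surj:
  assumes "\<And>U. U \<in> factors \<Longrightarrow> f U \<in> U"
  shows "\<exists>n\<in>N. \<forall>U\<in>factors. proj U n = f U"
proof -
  have "\<exists>n\<in>N. (\<forall>U\<in>A. proj U n = f U) \<and> (\<forall>U\<in>factors - A. proj U n = \<one>)"
    if "finite A" "A \<subseteq> factors" for A
    using that
  proof (induction A rule: finite_induct)
    case empty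
    then show ?case by (intro bexI[of _ \<one>]) auto
  next
    case (insert V A)
    then obtain n where n: "n \<in> N" "\<And>U. U \<in> A \<Longrightarrow> proj U n = f U"
      "\<And>U. \<lbrakk>U \<in> factors; U \<notin> A\<rbrakk> \<Longrightarrow> proj U n = \<one>" by auto
    have V: "V \<in> factors" "f V \<in> V" "f V \<in> N" "f V \<in> carrier G"
      using insert assms factor_N by auto
    have "proj U (n \<otimes> f V) = (if U \<in> insert V A then f U else \<one>)" if "U \<in> factors" for U
      using that n V insert.hyps proj_self[OF V(1,2)] proj_other[OF that V(1) _ V(2)] assms factor_carrier
      by (cases "U = V") (auto simp: proj_mult)
    then show ?case using n V insert.prems by (intro bexI[of _ "n \<otimes> f V"]) auto
  qed
  from this[of factors] show ?thesis by auto
qed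

end

section \<open>Projections of a point stabiliser\<close>

lemma (in finite_action) sylow_in_maximal:
  assumes p: "prime p" and S: "subgroup S G" and A: "sylow_in p A S G"
    and B: "subgroup B G" "A \<subseteq> B" "B \<subseteq> S" "card B = p ^ i"
  shows "A = B"
proof -
  have "p ^ i dvd card S" using subgroup_mono_dvd[OF B(1) S B(3)] B(4) by simp
  then have "i \<le> multiplicity p (card S)"
    using p card_subgroup_pos[OF S] by (intro multiplicity_geI) auto
  then have "card B \<le> card A"
    using A B(4) prime_gt_0_nat[OF p] power_increasing[of i "multiplicity p (card S)" p]
    by (simp add: sylow_in_def)
  then show ?thesis using card_seteq[OF finite_subgroup[OF B(1)] B(2)] by simp
qed

section \<open>The Sylow subgroup of \<open>N\<close> and the components of a point
  stabiliser\<close>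

context nonabelian_socle
begin

definition Q :: "'a set" where "Q = P \<inter> N"

lemma P_subgroup: "subgroup P G"
  using star_P by (simp add: star_def sylow_in_def)

lemma Q_subgroup: "subgroup Q G"
  unfolding Q_def using P_subgroup N_subgroup by (rule subgroup_Int)

lemma Q_N: "q \<in> Q \<Longrightarrow> q \<in> N"
  by (simp add: Q_def)

lemma star_Q: "star p Q N"
  unfolding Q_def by (rule star_normal[OF prime_p subgroup_self star_P N_normal])

lemma star_Q_Int: "normal_in M N G \<Longrightarrow> star p (Q \<inter> M) M"
  by (rule star_normal[OF prime_p N_subgroup star_Q])

lemma orb_P_eq_orb_Q: "x \<in> E \<Longrightarrow> orb P x = orb Q x"
  unfolding Q_def by (rule star_orb_eq[OF prime_p star_P N_normal N_transitive])

lemma p_power_subgroup_card: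
  assumes "subgroup R G" "R \<subseteq> Q"
  shows "\<exists>i. card R = p ^ i"
proof -
  have "card R dvd card Q" using assms Q_subgroup by (intro subgroup_mono_dvd)
  moreover have "card Q = p ^ multiplicity p (card N)"
    using star_sylow[OF star_Q] by (simp add: sylow_in_def)
  ultimately show ?thesis using prime_p by (auto simp: divides_primepow_nat)
qed

lemma proj_image_card:
  assumes U: "U \<in> factors" and R: "subgroup R G" "R \<subseteq> N"
  shows "subgroup (proj U ` R) G" "card (proj U ` R) dvd card R"
proof -
  have 1: "proj U ` R \<subseteq> carrier G" using U R by auto
  have 2: "proj U (s \<otimes> t) = proj U s \<otimes> proj U t" if "s \<in> R" "t \<in> R" for s t
    using that U R by (intro proj_mult) auto
  note * = card_hom_image[OF R(1) finite_subgroup[OF R(1)] is_group 1 2]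
  show "subgroup (proj U ` R) G" using *(2) .
  show "card (proj U ` R) dvd card R" using *(1) by (metis dvd_triv_left)
qed

text \<open>The image is a \<open>p\<close>-subgroup of \<open>U\<close> that contains the Sylow
  subgroup \<open>Q \<inter> U\<close>, so the two are equal. In effect \<open>Q\<close> is the
  product of its intersections with the factors.\<close>

lemma proj_Q:
  assumes U: "U \<in> factors"
  shows "proj U ` Q = Q \<inter> U"
proof (rule sym, rule sylow_in_maximal[OF prime_p factor_subgroup[OF U]])
  show "sylow_in p (Q \<inter> U) U G" using star_sylow[OF star_Q_Int[OF factor_normal[OF U]]] .
  have QN: "Q \<subseteq> N" using Q_N by blast
  show "subgroup (proj U ` Q) G" using proj_image_card(1)[OF U Q_subgroup QN] .
  show "Q \<inter> U \<subseteq> proj U ` Q" using proj_self[OF U] by force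
  show "proj U ` Q \<subseteq> U" using proj(1)[OF U] Q_N by blast
  have "card (proj U ` Q) dvd p ^ multiplicity p (card N)"
    using proj_image_card(2)[OF U Q_subgroup QN] star_sylow[OF star_Q] by (simp add: sylow_in_def)
  then have "\<exists>i. card (proj U ` Q) = p ^ i" using prime_p by (auto simp: divides_primepow_nat)
  then show "card (proj U ` Q) = p ^ (SOME i. card (proj U ` Q) = p ^ i)" by (rule someI_ex)
qed

lemma p_dvd_card_transitive:
  assumes "subgroup S G" "transitive_on_E S"
  shows "p dvd card S"
proof -
  obtain w where w: "w \<in> E" using card_E by fastforce
  show ?thesis
    using orbit_stabiliser[OF assms(1) w] transitive_orb[OF assms(2,1) w] p_dvd by simp
qed

text \<open>All factors have the same order. If it were prime to \<open>p\<close>, every component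
  of \<open>Q\<close> would be trivial, hence also \<open>Q\<close>, although \<open>p\<close>
  divides \<open>card N\<close>.\<close>

lemma p_dvd_factor:
  assumes U: "U \<in> factors"
  shows "p dvd card U"
proof (rule ccontr)
  assume n: "\<not> p dvd card U"
  have "Q \<inter> V = {\<one>}" if V: "V \<in> factors" for V
  proof -
    obtain g where g: "g \<in> carrier G" "cj G g ` U = V" using factors_conjugate[OF U V] by blast
    have "card V = card U" using g card_image_cj[OF g(1)] factor_carrier[OF U] by blast
    then have "card (Q \<inter> V) = 1"
      using n star_sylow[OF star_Q_Int[OF factor_normal[OF V]]]
      by (simp add: sylow_in_def not_dvd_imp_multiplicity_0)
    moreover have "\<one> \<in> Q \<inter> V"
      using subgroup.one_closed Q_subgroup factor_subgroup[OF V] by blast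
    ultimately show ?thesis by (metis card_1_singletonE singletonD)
  qed
  then have pe: "proj V q = proj V \<one>" if "V \<in> factors" "q \<in> Q" for V q
    using that proj_Q[OF that(1)] by auto
  have "q = \<one>" if q: "q \<in> Q" for q
    by (rule proj_eq_imp_eq) (use q pe in \<open>simp_all add: Q_N\<close>)
  then have "Q \<subseteq> {\<one>}" by blast
  then have "Q = {\<one>}" using subgroup.one_closed[OF Q_subgroup] by blast
  then have "p ^ multiplicity p (card N) = 1" using star_sylow[OF star_Q] by (simp add: sylow_in_def)
  then have "multiplicity p (card N) = 0" using prime_p by (auto dest: prime_gt_1_nat)
  then show False
    using p_dvd_card_transitive[OF N_subgroup N_transitive] card_subgroup_pos[OF N_subgroup] prime_p
    using not_prime_unit multiplicity_eq_zero_iff[of "card N" p] by auto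
qed

lemma stab_N:
  assumes "w \<in> E"
  shows "subgroup (stab N w) G" "stab N w \<subseteq> N"
  using stab_subgroup[OF N_subgroup assms] by (auto simp: stab_def)

text \<open>\<open>H\<close> is the product of the projections of \<open>N_w\<close>. The group
  \<open>G_w\<close> permutes the factors and preserves \<open>N_w\<close>, so it normalises
  \<open>H\<close>, and the orbit of \<open>H\<close> at \<open>w\<close> is \<open>{w}\<close> or
  \<open>E\<close>. In the first case \<open>H\<close> lies in \<open>N_w\<close>; in the second
  every projection is full.\<close>

lemma stab_dichotomy:
  assumes w: "w \<in> E"
  shows "(\<forall>n\<in>N. (\<forall>U\<in>factors. proj U n \<in> proj U ` stab N w) \<longrightarrow> \<alpha> n w = w) \<or>
    (\<forall>U\<in>factors. proj U ` stab N w = U)"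
proof -
  let ?S = "stab N w"
  note S = stab_N[OF w]
  define H where "H = {n \<in> N. \<forall>U\<in>factors. proj U n \<in> proj U ` ?S}"
  have pS: "subgroup (proj U ` ?S) G" if "U \<in> factors" for U
    using proj_image_card(1)[OF that S] .
  have H: "subgroup H G"
  proof (rule subgroupI)
    have "\<one> \<in> H" using pS by (auto simp: H_def subgroup.one_closed)
    then show "H \<noteq> {}" by blast
  qed (use pS in \<open>auto simp: H_def proj_mult proj_inv subgroup.m_closed subgroup.m_inv_closed\<close>)
  have "orb H w = {w} \<or> orb H w = E"
  proof (rule invariant_subgroup_orbit[OF H w])
    fix a n assume a: "a \<in> stab (carrier G) w" and n: "n \<in> H"
    have a': "a \<in> carrier G" "\<alpha> a w = w" using a by (auto simp: stab_def)
    then have ai: "\<alpha> (inv a) w = w" using w by (metis act_inv(1))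
    have "proj V (cj G a n) \<in> proj V ` ?S" if V: "V \<in> factors" for V
    proof -
      let ?V = "cj G (inv a) ` V"
      have V': "?V \<in> factors" using factor_cj[OF V] a' by simp
      have VV: "cj G a ` ?V = V"
        unfolding image_image using a' factor_carrier[OF V] by (auto simp: image_iff)
      obtain s where s: "s \<in> ?S" "proj ?V n = proj ?V s" using n V' by (auto simp: H_def)
      have "proj V (cj G a n) = cj G a (proj ?V n)"
        using proj_cj[OF V' _ a'(1), of n] n by (simp add: VV H_def)
      also have "\<dots> = proj V (cj G a s)"
        using proj_cj[OF V' _ a'(1), of s] s S(2) by (auto simp: VV)
      also have "cj G a s \<in> ?S"
      proof -
        have "s \<in> N" "\<alpha> s w = w" using s by (auto simp: stab_def)
        moreover from this have "\<alpha> (cj G a s) w = w" using a' ai w by (simp add: cj_def act_mult)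
        ultimately show ?thesis using a' by (simp add: stab_def)
      qed
      ultimately show ?thesis by simp
    qed
    then show "cj G a n \<in> H" using n a' by (simp add: H_def)
  qed
  then show ?thesis
  proof
    assume "orb H w = {w}"
    then have "\<alpha> n w = w" if "n \<in> H" for n using that by (auto simp: orb_def)
    then show ?thesis by (auto simp: H_def)
  next
    assume o: "orb H w = E"
    have "u \<in> proj U ` ?S" if U: "U \<in> factors" and u: "u \<in> U" for U u
    proof -
      have uN: "u \<in> N" using factor_N[OF U u] .
      \<comment> \<open>Transitivity of \<open>H\<close> writes \<open>u\<close> as an element of
        \<open>H\<close> times an element of \<open>N_w\<close>; both have their
        \<open>U\<close>-component in the projection of \<open>N_w\<close>.\<close>
      have "\<alpha> u w \<in> orb H w" using o uN w by simp
      then obtain n where n: "n \<in> H" "\<alpha> u w = \<alpha> n w" by (auto simp: orb_def)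
      then have nN: "n \<in> N" by (simp add: H_def)
      have "\<alpha> (inv n \<otimes> u) w = \<alpha> (inv n) (\<alpha> n w)" using n nN uN w by (simp add: act_mult)
      then have "inv n \<otimes> u \<in> ?S" using nN uN w by (simp add: stab_def)
      then have "proj U (inv n \<otimes> u) \<in> proj U ` ?S" by blast
      moreover have "proj U n \<in> proj U ` ?S" using n U by (simp add: H_def)
      ultimately have "proj U n \<otimes> proj U (inv n \<otimes> u) \<in> proj U ` ?S"
        using subgroup.m_closed[OF pS[OF U]] by blast
      then show ?thesis using U nN uN u by (simp add: proj_mult[symmetric] proj_self)
    qed
    moreover have "proj U ` ?S \<subseteq> U" if U: "U \<in> factors" for U
      using proj(1)[OF U] S(2) by blast
    ultimately show ?thesis by blast
  qed
qed

text \<open>Minimal support turns the elements of \<open>N_w\<close> over \<open>I\<close> into the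
  graph of isomorphisms between the factors in \<open>I\<close>. The star property holds at every
  point, hence for every conjugate of this graph, while conjugation by an element of one factor
  changes only that component.\<close>

lemma not_subdirect:
  assumes w: "w \<in> E"
  shows "\<not> (\<forall>U\<in>factors. proj U ` stab N w = U)"
proof
  let ?S = "stab N w"
  assume full: "\<forall>U\<in>factors. proj U ` ?S = U"
  note S = stab_N[OF w]
  \<comment> \<open>\<open>M I\<close> is the product of the factors in \<open>I\<close>, and
    \<open>D I\<close> is the part of \<open>N_w\<close> supported there. The set \<open>I\<close>
    below has the least size for which \<open>D I\<close> is nontrivial.\<close>
  define M where "M = (\<lambda>I. {n \<in> N. \<forall>U\<in>factors - I. proj U n = \<one>})"
  define D where "D = (\<lambda>I. stab (M I) w)"
  have M: "normal_in (M I) N G" for I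
    unfolding normal_in_def
  proof (intro conjI ballI)
    show "subgroup (M I) G"
    proof (rule subgroupI)
      have "\<one> \<in> M I" by (simp add: M_def)
      then show "M I \<noteq> {}" by blast
    qed (auto simp: M_def proj_mult proj_inv)
    show "M I \<subseteq> N" by (auto simp: M_def)
    show "cj G n m \<in> M I" if "n \<in> N" "m \<in> M I" for n m
      using that by (auto simp: M_def proj_cj_self)
  qed
  have Msub: "subgroup (M I) G" for I using M by (simp add: normal_in_def)
  have D: "subgroup (D I) G" "D I \<subseteq> N" "D I \<subseteq> ?S" for I
    using stab_subgroup[OF Msub w] by (auto simp: D_def stab_def M_def)
  have "?S \<noteq> {\<one>}"
  proof
    assume "?S = {\<one>}"
    then have "T = {\<one>}" using full T_in_factors by force
    then show False using T_minimal by (simp add: minimal_normal_in_def)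
  qed
  moreover have "D factors = ?S" by (auto simp: D_def M_def stab_def)
  ultimately obtain I where I: "I \<subseteq> factors" "D I \<noteq> {\<one>}"
    and Imin: "\<And>J. \<lbrakk>J \<subseteq> factors; D J \<noteq> {\<one>}\<rbrakk> \<Longrightarrow> card I \<le> card J"
    using ex_has_least_nat[of "\<lambda>I. I \<subseteq> factors \<and> D I \<noteq> {\<one>}" factors card] by (metis subset_refl)
  have finI: "finite I" using I(1) finite_factors finite_subset by blast
  \<comment> \<open>Two elements with the same \<open>U\<close>-component differ by one supported on
    the smaller set \<open>I - {U}\<close>, which is trivial by the choice of
    \<open>I\<close>.\<close>
  have inj: "d = d'" if U: "U \<in> I" and d: "d \<in> D I" "d' \<in> D I" "proj U d = proj U d'" for U d d'
  proof -
    have U': "U \<in> factors" using U I by blast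
    have "card (I - {U}) < card I" using U finI by (rule card_Diff1_less[rotated])
    then have "D (I - {U}) = {\<one>}" using Imin[of "I - {U}"] I(1) by fastforce
    moreover have "inv d \<otimes> d' \<in> D I"
      using d D(1) by (simp add: subgroup.m_closed subgroup.m_inv_closed)
    then have "inv d \<otimes> d' \<in> D (I - {U})"
    proof -
      assume e: "inv d \<otimes> d' \<in> D I"
      have dN: "d \<in> N" "d' \<in> N" using d D(2) by blast+
      have "proj V (inv d \<otimes> d') = \<one>" if "V \<in> factors - (I - {U})" for V
        using that e d(3) dN U' by (cases "V = U") (auto simp: D_def M_def stab_def proj_mult proj_inv)
      then show ?thesis using e by (auto simp: D_def M_def stab_def)
    qed
    ultimately have "inv d \<otimes> d' = \<one>" by blast
    then show ?thesis using d D(1) subgroup.mem_carrier by (metis inv_cancel(2) r_one)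
  qed
  \<comment> \<open>\<open>D I\<close> is normal in \<open>N_w\<close>, and \<open>N_w\<close>
    projects onto \<open>U\<close>; so the image is a nontrivial normal subgroup of the simple group
    \<open>U\<close>.\<close>
  have surj: "proj U ` D I = U" if U: "U \<in> I" for U
  proof -
    have U': "U \<in> factors" using U I by blast
    have "normal_in (proj U ` D I) U G"
      unfolding normal_in_def
    proof (intro conjI ballI)
      show "subgroup (proj U ` D I) G" using proj_image_card(1)[OF U' D(1,2)] .
      show "proj U ` D I \<subseteq> U" using proj(1)[OF U'] D(2) by blast
      fix u x assume "u \<in> U" "x \<in> proj U ` D I"
      moreover from this have "u \<in> proj U ` ?S" using full U' by simp
      ultimately obtain s d where sd: "s \<in> ?S" "u = proj U s" "d \<in> D I" "x = proj U d" by blast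
      have "s \<in> N" "d \<in> N" using sd S(2) D(2) by blast+
      moreover have "cj G s d \<in> D I"
        using sd M[of I] subgroup_cj_closed[OF S(1) sd(1), of d] D(3)[of I] S(2)
        by (auto simp: D_def stab_def normal_in_def)
      ultimately show "cj G u x \<in> proj U ` D I" using sd U' by (metis imageI proj_cj_self)
    qed
    moreover have "proj U ` D I \<noteq> {\<one>}"
    proof
      assume "proj U ` D I = {\<one>}"
      then have "d = \<one>" if "d \<in> D I" for d
        using that inj[OF U that subgroup.one_closed[OF D(1)]] U' by auto
      then show False using I(2) subgroup.one_closed[OF D(1)] by blast
    qed
    ultimately show ?thesis using factor_simple[OF U'] by (auto simp: nonabelian_simple_in_def)
  qed
  have "I \<noteq> {}"
  proof
    assume I0: "I = {}"
    have "d = \<one>" if "d \<in> D I" for d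
      by (rule proj_eq_imp_eq) (use that I0 in \<open>auto simp: D_def M_def stab_def\<close>)
    then show False using I(2) subgroup.one_closed[OF D(1)] by blast
  qed
  then obtain U where U: "U \<in> I" by blast
  have U': "U \<in> factors" using U I by blast
  show False
  proof (cases "I = {U}")
    case True
    \<comment> \<open>With one factor in the support \<open>D I\<close> is \<open>U\<close> itself,
      a normal subgroup of the transitive group \<open>N\<close> that fixes
      \<open>w\<close>.\<close>
    have "d = proj U d" if d: "d \<in> D I" for d
    proof -
      have dN: "d \<in> N" and dM: "\<forall>V\<in>factors - I. proj V d = \<one>"
        using d by (auto simp: D_def M_def stab_def)
      show ?thesis
      proof (rule proj_eq_imp_eq)
        show "proj U d \<in> N" using proj(1)[OF U' dN] factor_N[OF U'] by blast
        fix V assume V: "V \<in> factors"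
        show "proj V d = proj V (proj U d)"
          using dM V True proj_self[OF U' proj(1)[OF U' dN]] proj_other[OF V U' _ proj(1)[OF U' dN]]
          by (cases "V = U") auto
      qed (use dN in simp)
    qed
    then have "D I = proj U ` D I" by force
    then have "U \<subseteq> ?S" using surj[OF U] D(3) by blast
    then have "U = {\<one>}"
      by (intro fixes_point_normal_trivial[OF factor_normal[OF U'] N_transitive N_subgroup w])
         (auto simp: stab_def)
    then show False using factor_minimal[OF U'] by (simp add: minimal_normal_in_def)
  next
    case False
    then obtain V where V: "V \<in> I" "V \<noteq> U" using U by blast
    have V': "V \<in> factors" using V I by blast
    \<comment> \<open>The stabiliser of the point \<open>\<alpha> g w\<close> in \<open>M I\<close>
      is the conjugate of \<open>D I\<close> by \<open>g\<close>, so \<open>Q\<close> meets it in a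
      Sylow subgroup. This conjugate is isomorphic to \<open>W\<close> under \<open>proj W\<close>,
      so the image has the order of \<open>Q \<inter> W\<close>.\<close>
    have main: "proj W ` (Q \<inter> cj G g ` D I) = Q \<inter> W" if W: "W \<in> I" and g: "g \<in> N" for W g
    proof -
      have W': "W \<in> factors" using W I by blast
      note [simp] = subgroup.mem_carrier[OF D(1)]
      have st: "stab (M I) (\<alpha> g w) = cj G g ` D I"
      proof
        show "stab (M I) (\<alpha> g w) \<subseteq> cj G g ` D I"
        proof
          fix m assume "m \<in> stab (M I) (\<alpha> g w)"
          then have m: "m \<in> M I" "\<alpha> m (\<alpha> g w) = \<alpha> g w" "m \<in> N" using M by (auto simp: stab_def normal_in_def)
          then have "cj G (inv g) m \<in> D I"
            using g w M[of I] by (auto simp: D_def stab_def cj_def act_mult normal_in_def)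
               (metis N_closed(2) inv_inv N_carrier)
          then show "m \<in> cj G g ` D I" using m g by (intro image_eqI[of _ _ "cj G (inv g) m"]) auto
        qed
        show "cj G g ` D I \<subseteq> stab (M I) (\<alpha> g w)"
        proof
          fix m assume "m \<in> cj G g ` D I"
          then obtain d where d: "m = cj G g d" "d \<in> M I" "\<alpha> d w = w" by (auto simp: D_def stab_def)
          have "d \<in> N" using d M by (auto simp: normal_in_def)
          have "m \<in> M I" using d g M by (auto simp: normal_in_def)
          moreover have "\<alpha> m (\<alpha> g w) = \<alpha> g w"
            using d g w \<open>d \<in> N\<close> by (simp add: cj_def act_mult)
          ultimately show "m \<in> stab (M I) (\<alpha> g w)" by (simp add: stab_def)
        qed
      qed
      have QM: "stab (Q \<inter> M I) (\<alpha> g w) = Q \<inter> cj G g ` D I" using st by (auto simp: stab_def)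
      let ?R = "Q \<inter> cj G g ` D I"
      have "sylow_in p ?R (cj G g ` D I) G"
        using star_Q_Int[OF M[of I]] act_closed[OF N_carrier[OF g] w] unfolding star_def
        by (metis st QM)
      then have R: "subgroup ?R G" "card ?R = p ^ multiplicity p (card (D I))"
        using card_image_cj[of g "D I"] g subgroup.subset[OF D(1)] by (auto simp: sylow_in_def)
      have injR: "inj_on (proj W) ?R"
      proof (rule inj_onI)
        fix x y assume "x \<in> ?R" "y \<in> ?R" "proj W x = proj W y"
        then obtain c d where cd: "x = cj G g c" "y = cj G g d" "c \<in> D I" "d \<in> D I"
          "proj W (cj G g c) = proj W (cj G g d)" by blast
        have "c \<in> N" "d \<in> N" using cd D(2) by blast+
        then have "proj W c = proj W d" using cd(5) W' g by (simp add: proj_cj_self)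
        then have "c = d" using inj[OF W cd(3,4)] by simp
        then show "x = y" using cd by simp
      qed
      have "card (D I) = card W"
        using surj[OF W] card_image[of "proj W" "D I"] inj[OF W] by (metis inj_onI)
      moreover have "sylow_in p (Q \<inter> W) W G" using star_sylow[OF star_Q_Int[OF factor_normal[OF W']]] .
      ultimately have "card (proj W ` ?R) = card (Q \<inter> W)"
        using R(2) card_image[OF injR] by (simp add: sylow_in_def)
      moreover have "proj W ` ?R \<subseteq> Q \<inter> W" using proj_Q[OF W'] by blast
      moreover have "finite (Q \<inter> W)" using finite_subgroup[OF Q_subgroup] by simp
      ultimately show ?thesis by (metis card_subset_eq)
    qed
    \<comment> \<open>Lift \<open>q\<close> to \<open>x\<close> in \<open>Q \<inter> D I\<close>.
      Its \<open>V\<close>-component also lifts to an element of \<open>Q\<close> in the conjugate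
      of \<open>D I\<close> by \<open>u\<close>. Since \<open>u\<close> leaves
      \<open>V\<close>-components alone and \<open>proj V\<close> is injective on
      \<open>D I\<close>, the second lift is the conjugate of the first.\<close>
    have "cj G u q \<in> Q \<inter> U" if u: "u \<in> U" and q: "q \<in> Q \<inter> U" for u q
    proof -
      have uN: "u \<in> N" using factor_N[OF U' u] .
      have "cj G \<one> ` D I = D I" using subgroup.subset[OF D(1)] by (force simp: image_iff)
      then have "q \<in> proj U ` (Q \<inter> D I)" using main[OF U N_closed(3)] q by simp
      then obtain x where x: "x \<in> Q" "x \<in> D I" "q = proj U x" by blast
      have xN: "x \<in> N" using x Q_N by blast
      have "proj V x \<in> Q \<inter> V" using x proj_Q[OF V'] by blast
      then have "proj V x \<in> proj V ` (Q \<inter> cj G u ` D I)" using main[OF V(1) uN] by simp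
      then obtain y where y: "y \<in> D I" "cj G u y \<in> Q" "proj V x = proj V (cj G u y)" by blast
      have yN: "y \<in> N" using y D(2) by blast
      have "proj V (cj G u y) = proj V y"
        using proj_other[OF V' U' _ u] V(2) uN yN V' by (simp add: proj_cj_self)
      then have "x = y" using inj[OF V(1)] x y by simp
      then have "cj G u x \<in> Q" using y by simp
      then have "proj U (cj G u x) \<in> Q \<inter> U" using proj_Q[OF U'] by blast
      then show ?thesis using U' uN xN x(3) u by (simp add: proj_cj_self proj_self)
    qed
    moreover have "subgroup (Q \<inter> U) G" using Q_subgroup factor_subgroup[OF U'] by (rule subgroup_Int)
    ultimately have "normal_in (Q \<inter> U) U G" by (auto simp: normal_in_def)
    then show False
      using simple_sylow_not_normal[OF finite_carrier prime_p factor_simple[OF U'] p_dvd_factor[OF U']]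
        star_sylow[OF star_Q_Int[OF factor_normal[OF U']]] by blast
  qed
qed

text \<open>With the subdirect case excluded, \<open>N_w\<close> is the product of its projections,
  so it contains the components of its elements.\<close>

lemma fixes_iff_projections_fix:
  assumes w: "w \<in> E" and n: "n \<in> N"
  shows "\<alpha> n w = w \<longleftrightarrow> (\<forall>U\<in>factors. \<alpha> (proj U n) w = w)"
proof
  note S = stab_N[OF w]
  have prod: "\<alpha> m w = w" if "m \<in> N" "\<And>U. U \<in> factors \<Longrightarrow> proj U m \<in> proj U ` stab N w" for m
    using stab_dichotomy[OF w] not_subdirect[OF w] that by blast
  {
    assume nw: "\<alpha> n w = w"
    show "\<forall>U\<in>factors. \<alpha> (proj U n) w = w"
    proof
      fix U assume U: "U \<in> factors"
      have t: "proj U n \<in> U" using proj(1)[OF U n] .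
      show "\<alpha> (proj U n) w = w"
      proof (rule prod)
        show "proj U n \<in> N" using factor_N[OF U t] .
        fix V assume V: "V \<in> factors"
        have "\<one> \<in> proj V ` stab N w"
          using subgroup.one_closed[OF proj_image_card(1)[OF V S]] .
        then show "proj V (proj U n) \<in> proj V ` stab N w"
          using proj_other[OF V U _ t] proj_self[OF U t] n nw by (cases "V = U") (auto simp: stab_def)
      qed
    qed
  }
  assume all: "\<forall>U\<in>factors. \<alpha> (proj U n) w = w"
  show "\<alpha> n w = w"
  proof (rule prod[OF n])
    fix U assume U: "U \<in> factors"
    have t: "proj U n \<in> U" using proj(1)[OF U n] .
    then have "proj U n \<in> stab N w" using all U factor_N[OF U t] by (simp add: stab_def)
    then show "proj U n \<in> proj U ` stab N w" using proj_self[OF U t] by (metis imageI)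
  qed
qed

section \<open>Moving factors by elements of the point stabiliser\<close>

lemma cj_image_cj:
  "\<lbrakk>g \<in> carrier G; h \<in> carrier G; A \<subseteq> carrier G\<rbrakk> \<Longrightarrow> cj G g ` cj G h ` A = cj G (g \<otimes> h) ` A"
  unfolding image_image by (rule image_cong) (auto simp: cj_cj)

lemma cj_image_inv:
  assumes "g \<in> carrier G" "A \<subseteq> carrier G"
  shows "cj G (inv g) ` cj G g ` A = A" "cj G g ` cj G (inv g) ` A = A"
  using assms by (force simp: image_image image_iff)+

lemma factor_subset_carrier: "U \<in> factors \<Longrightarrow> U \<subseteq> carrier G"
  using factor_carrier by blast

lemma cj_N_factor:
  assumes "U \<in> factors" "n \<in> N"
  shows "cj G n ` U = U"
proof
  show "cj G n ` U \<subseteq> U" using factor_N_cj assms by blast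
  have "cj G (inv n) ` U \<subseteq> U" using factor_N_cj[of U "inv n"] assms by auto
  then have "cj G n ` cj G (inv n) ` U \<subseteq> cj G n ` U" by blast
  then show "U \<subseteq> cj G n ` U" using cj_image_inv(2)[of n U] assms factor_subset_carrier by simp
qed

text \<open>\<open>N\<close> is transitive on points and fixes every factor, so an element of
  \<open>G\<close> taking \<open>T\<close> to \<open>U\<close> can be corrected by an element of
  \<open>N\<close> to fix \<open>w\<close>.\<close>

lemma stabiliser_conjugates_factors:
  assumes w: "w \<in> E"
  shows "\<exists>c. (\<forall>U\<in>factors. c U \<in> stab (carrier G) w \<and> cj G (c U) ` T = U) \<and> c T = \<one>"
proof -
  have Tc: "T \<subseteq> carrier G" using factor_subset_carrier[OF T_in_factors] .
  have "\<exists>a\<in>stab (carrier G) w. cj G a ` T = U" if U: "U \<in> factors" for U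
  proof -
    obtain g where g: "g \<in> carrier G" "cj G g ` T = U"
      using factors_conjugate[OF T_in_factors U] by blast
    obtain n where n: "n \<in> N" "\<alpha> n w = \<alpha> g w"
      using N_transitive act_closed[OF g(1) w] w unfolding transitive_on_E_def by blast
    have "inv n \<otimes> g \<in> stab (carrier G) w"
      using n g w by (simp add: stab_def act_mult n(2)[symmetric])
    moreover have "cj G (inv n \<otimes> g) ` T = cj G (inv n) ` U"
      using cj_image_cj[OF _ g(1) Tc, of "inv n"] n g(2) by simp
    ultimately show ?thesis using cj_N_factor[OF U, of "inv n"] n by auto
  qed
  then obtain c where c: "\<And>U. U \<in> factors \<Longrightarrow> c U \<in> stab (carrier G) w \<and> cj G (c U) ` T = U" by metis
  have "\<one> \<in> stab (carrier G) w" "cj G \<one> ` T = T"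
    using w cj_N_factor[OF T_in_factors, of \<one>] by (simp_all add: stab_def)
  then show ?thesis using c by (intro exI[of _ "c(T := \<one>)"]) auto
qed

lemma unique_factor_imp_N_eq:
  assumes "factors = {T}"
  shows "N = T"
  using N_subset_if_factors_subset[OF factor_subgroup[OF T_in_factors]] factor_subset[OF T_in_factors] assms
  by auto

end

section \<open>The product decomposition of the point set\<close>

lemma (in group) nonabelian_simple_in_image:
  assumes fin: "finite (carrier G)" and T: "nonabelian_simple_in T G" and H: "group H"
    and f: "f ` T \<subseteq> carrier H" "\<And>s t. \<lbrakk>s \<in> T; t \<in> T\<rbrakk> \<Longrightarrow> f (s \<otimes> t) = f s \<otimes>\<^bsub>H\<^esub> f t"
    and inj: "inj_on f T"
  shows "nonabelian_simple_in (f ` T) H"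
  unfolding nonabelian_simple_in_def
proof (intro conjI allI impI)
  interpret H: group H by fact
  have T': "subgroup T G" using T by (simp add: nonabelian_simple_in_def)
  have finT: "finite T" using fin T' by (meson finite_subset subgroup.subset)
  note [simp] = subgroup.mem_carrier[OF T'] subgroup.m_closed[OF T'] subgroup.m_inv_closed[OF T']
    subgroup.one_closed[OF T']
  interpret TG: group "G\<lparr>carrier := T\<rparr>" using T' by (rule subgroup_imp_group)
  interpret h: group_hom "G\<lparr>carrier := T\<rparr>" H f
    using f by unfold_locales (auto simp: hom_def)
  have f1: "f \<one> = \<one>\<^bsub>H\<^esub>" using h.hom_one by simp
  have fi: "f (inv t) = inv\<^bsub>H\<^esub> f t" if "t \<in> T" for t
    using h.hom_inv[of t] that T' by (simp add: m_inv_consistent)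
  have fc: "f t \<in> carrier H" if "t \<in> T" for t using f(1) that by blast
  show "subgroup (f ` T) H" using card_hom_image(2)[OF T' finT H f] .
  obtain x y where xy: "x \<in> T" "y \<in> T" "x \<otimes> y \<noteq> y \<otimes> x"
    using T by (auto simp: nonabelian_simple_in_def)
  then have "f (x \<otimes> y) \<noteq> f (y \<otimes> x)" using inj by (auto dest: inj_onD)
  then show "\<exists>x\<in>f ` T. \<exists>y\<in>f ` T. x \<otimes>\<^bsub>H\<^esub> y \<noteq> y \<otimes>\<^bsub>H\<^esub> x"
    using xy f(2) by auto
  fix M assume M: "normal_in M (f ` T) H"
  have M': "subgroup M H" "M \<subseteq> f ` T" "\<And>s m. \<lbrakk>s \<in> T; m \<in> M\<rbrakk> \<Longrightarrow> cj H (f s) m \<in> M"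
    using M by (auto simp: normal_in_def)
  define L where "L = {t \<in> T. f t \<in> M}"
  have "subgroup L G"
  proof (rule subgroupI)
    have "\<one> \<in> L" using f1 subgroup.one_closed[OF M'(1)] by (simp add: L_def)
    then show "L \<noteq> {}" by blast
  qed (auto simp: L_def f fi subgroup.m_closed[OF M'(1)] subgroup.m_inv_closed[OF M'(1)])
  moreover have "cj G s t \<in> L" if "s \<in> T" "t \<in> L" for s t
    using that M'(3)[of s "f t"] by (auto simp: L_def f fi cj_def)
  ultimately have "normal_in L T G" by (auto simp: normal_in_def L_def)
  then have "L = {\<one>} \<or> L = T" using T by (simp add: nonabelian_simple_in_def)
  moreover have "M = f ` L" using M'(2) by (auto simp: L_def)
  ultimately show "M = {\<one>\<^bsub>H\<^esub>} \<or> M = f ` T" using f1 by auto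
qed

text \<open>Since \<open>c U\<close> fixes \<open>w\<close>, the identification of all coordinate
  sets with one set keeps \<open>w\<close> as common base point; \<open>c T = \<one>\<close> makes
  the \<open>T\<close>-coordinate the identity on that set.\<close>

locale product_socle = nonabelian_socle +
  fixes w :: 'c and c :: "'a set \<Rightarrow> 'a"
  assumes w: "w \<in> E"
    and c_stab: "U \<in> factors \<Longrightarrow> c U \<in> stab (carrier G) w"
    and c_conj: "U \<in> factors \<Longrightarrow> cj G (c U) ` T = U"
    and c_T: "c T = \<one>"
begin

definition \<Delta> :: "'c set" where "\<Delta> = orb T w"

text \<open>An element normalising \<open>T\<close> permutes the orbits of \<open>T\<close>, so the
  condition at the single point \<open>w\<close> says that it preserves
  \<open>\<Delta>\<close>.\<close>

definition H0 :: "'a set" where "H0 = {h \<in> carrier G. cj G h ` T = T \<and> \<alpha> h w \<in> \<Delta>}"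

text \<open>The component of \<open>n\<close> in \<open>U\<close> and the \<open>U\<close>-coordinate of the point \<open>x\<close>, both transported from \<open>U\<close> to \<open>T\<close>
  by \<open>c U\<close>. The coordinate does not depend on the chosen \<open>n\<close>.\<close>

definition tau :: "'a set \<Rightarrow> 'a \<Rightarrow> 'a" where "tau U n = cj G (inv (c U)) (proj U n)"

definition pt :: "'c \<Rightarrow> 'a set \<Rightarrow> 'c" where
  "pt x U = \<alpha> (tau U (SOME n. n \<in> N \<and> \<alpha> n w = x)) w"

section \<open>Coordinates of points\<close>

lemmas T_factor = T_in_factors
lemmas T_subgroup = factor_subgroup[OF T_in_factors]
lemmas T_carrier [simp] = subgroup.mem_carrier[OF T_subgroup]
lemmas T_closed [simp] = subgroup.m_closed[OF T_subgroup] subgroup.m_inv_closed[OF T_subgroup]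
  subgroup.one_closed[OF T_subgroup]
lemmas T_N [simp] = factor_N[OF T_in_factors]

lemma [simp]: "w \<in> E" by (rule w)

lemma c_carrier [simp]: "U \<in> factors \<Longrightarrow> c U \<in> carrier G"
  and c_w [simp]: "U \<in> factors \<Longrightarrow> \<alpha> (c U) w = w"
  using c_stab by (auto simp: stab_def)

lemma c_inv_w [simp]: "U \<in> factors \<Longrightarrow> \<alpha> (inv (c U)) w = w"
  using act_inv(1)[OF c_carrier w] by simp

lemma c_inv_conj: "U \<in> factors \<Longrightarrow> cj G (inv (c U)) ` U = T"
  using c_conj cj_image_inv(1)[of "c U" T] factor_subset_carrier[OF T_factor] by simp

lemma tau_T [simp]: "\<lbrakk>U \<in> factors; n \<in> N\<rbrakk> \<Longrightarrow> tau U n \<in> T"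
  unfolding tau_def using c_inv_conj proj(1) by blast

lemma tau_carrier [simp]: "\<lbrakk>U \<in> factors; n \<in> N\<rbrakk> \<Longrightarrow> tau U n \<in> carrier G"
  by simp

lemma tau_mult: "\<lbrakk>U \<in> factors; m \<in> N; n \<in> N\<rbrakk> \<Longrightarrow> tau U (m \<otimes> n) = tau U m \<otimes> tau U n"
  by (simp add: tau_def proj_mult cj_mult)

lemma tau_inv: "\<lbrakk>U \<in> factors; n \<in> N\<rbrakk> \<Longrightarrow> tau U (inv n) = inv (tau U n)"
  by (simp add: tau_def proj_inv cj_inv)

lemma tau_one [simp]: "U \<in> factors \<Longrightarrow> tau U \<one> = \<one>"
  by (simp add: tau_def)

lemma tau_self: "t \<in> T \<Longrightarrow> tau T t = t"
  using proj_self[OF T_factor] T_factor by (simp add: tau_def c_T)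

lemma tau_other: "\<lbrakk>t \<in> T; U \<in> factors; U \<noteq> T\<rbrakk> \<Longrightarrow> tau U t = \<one>"
  using proj_other[OF _ T_factor] by (simp add: tau_def)

lemma tau_fix: "\<lbrakk>U \<in> factors; n \<in> N\<rbrakk> \<Longrightarrow> \<alpha> (tau U n) w = w \<longleftrightarrow> \<alpha> (proj U n) w = w"
  by (simp add: tau_def cj_def act_mult act_eq_iff)

lemma tau_act:
  "\<lbrakk>U \<in> factors; n \<in> N\<rbrakk> \<Longrightarrow> \<alpha> (tau U n) w = \<alpha> (inv (c U)) (\<alpha> (proj U n) w)"
  by (simp add: tau_def cj_def act_mult)

lemma tau_stab: "n \<in> N \<Longrightarrow> \<alpha> n w = w \<longleftrightarrow> (\<forall>U\<in>factors. \<alpha> (tau U n) w = w)"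
  using fixes_iff_projections_fix[OF w] tau_fix by simp

text \<open>The two elements differ by an element of \<open>N_w\<close>, and membership there is
  decided component by component. Hence the coordinates of a point are well defined and determine
  it.\<close>

lemma same_point_iff:
  assumes "m \<in> N" "n \<in> N"
  shows "\<alpha> m w = \<alpha> n w \<longleftrightarrow> (\<forall>U\<in>factors. \<alpha> (tau U m) w = \<alpha> (tau U n) w)"
proof -
  have e: "\<alpha> a w = \<alpha> b w \<longleftrightarrow> \<alpha> (inv a \<otimes> b) w = w" if "a \<in> carrier G" "b \<in> carrier G" for a b
    using that act_eq_iff[of a w "\<alpha> b w"] by (auto simp: act_mult)
  show ?thesis
    using assms tau_stab[of "inv m \<otimes> n"] by (simp add: e tau_mult tau_inv)
qed

lemma pt_N:
  assumes n: "n \<in> N" and U: "U \<in> factors"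
  shows "pt (\<alpha> n w) U = \<alpha> (tau U n) w"
proof -
  let ?m = "SOME m. m \<in> N \<and> \<alpha> m w = \<alpha> n w"
  have "?m \<in> N \<and> \<alpha> ?m w = \<alpha> n w" by (rule someI[of _ n]) (use n in simp)
  then show ?thesis using same_point_iff[of ?m n] n U by (simp add: pt_def)
qed

lemma N_point: "x \<in> E \<Longrightarrow> \<exists>n\<in>N. x = \<alpha> n w"
  using N_transitive w unfolding transitive_on_E_def by metis

lemma \<Delta>_point: "x \<in> \<Delta> \<Longrightarrow> \<exists>t\<in>T. x = \<alpha> t w"
  by (auto simp: \<Delta>_def orb_def)

lemma \<Delta>_I [simp]: "t \<in> T \<Longrightarrow> \<alpha> t w \<in> \<Delta>"
  by (auto simp: \<Delta>_def orb_def)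

lemma \<Delta>_E: "\<Delta> \<subseteq> E"
  unfolding \<Delta>_def by (rule orb_subset[OF T_subgroup w])

lemma finite_\<Delta> [simp]: "finite \<Delta>"
  using \<Delta>_E finite_E finite_subset by blast

lemma w_\<Delta> [simp]: "w \<in> \<Delta>"
  using \<Delta>_I[OF T_closed(3)] by simp

lemma pt_\<Delta>: "\<lbrakk>x \<in> E; U \<in> factors\<rbrakk> \<Longrightarrow> pt x U \<in> \<Delta>"
  using N_point pt_N by fastforce

lemma pt_T_\<Delta>: "x \<in> \<Delta> \<Longrightarrow> pt x T = x"
  using \<Delta>_point pt_N T_factor tau_self by fastforce

lemma pt_eq_imp_eq:
  assumes "x \<in> E" "y \<in> E" "\<And>U. U \<in> factors \<Longrightarrow> pt x U = pt y U"
  shows "x = y"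
proof -
  obtain m n where mn: "m \<in> N" "x = \<alpha> m w" "n \<in> N" "y = \<alpha> n w"
    using N_point assms(1,2) by metis
  then show ?thesis using same_point_iff[of m n] assms(3) by (simp add: pt_N)
qed

lemma pt_surj:
  assumes "\<And>U. U \<in> factors \<Longrightarrow> \<delta> U \<in> \<Delta>"
  shows "\<exists>x\<in>E. \<forall>U\<in>factors. pt x U = \<delta> U"
proof -
  have "\<forall>U\<in>factors. \<exists>t\<in>T. \<delta> U = \<alpha> t w" using assms \<Delta>_point by blast
  then obtain t where t: "\<And>U. U \<in> factors \<Longrightarrow> t U \<in> T \<and> \<delta> U = \<alpha> (t U) w" by metis
  have "cj G (c U) (t U) \<in> U" if "U \<in> factors" for U
    using t[OF that] c_conj[OF that] by blast
  then obtain n where n: "n \<in> N" "\<And>U. U \<in> factors \<Longrightarrow> proj U n = cj G (c U) (t U)"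
    using proj_surj[of "\<lambda>U. cj G (c U) (t U)"] by blast
  have "pt (\<alpha> n w) U = \<delta> U" if "U \<in> factors" for U
    using t[OF that] n that by (simp add: pt_N tau_def)
  then show ?thesis using n(1) by (intro bexI[of _ "\<alpha> n w"]) auto
qed

lemma H0_subgroup: "subgroup H0 G"
proof (rule subgroupI)
  show "H0 \<subseteq> carrier G" by (auto simp: H0_def)
  have "\<one> \<in> H0" using cj_image_inv[of \<one> T] by (auto simp: H0_def image_iff)
  then show "H0 \<noteq> {}" by blast
next
  fix h assume "h \<in> H0"
  then have h: "h \<in> carrier G" "cj G h ` T = T" "\<alpha> h w \<in> \<Delta>" by (auto simp: H0_def)
  have hT: "cj G (inv h) ` T = T"
    using cj_image_inv(1)[OF h(1) factor_subset_carrier[OF T_factor]] h(2) by simp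
  obtain t where t: "t \<in> T" "\<alpha> h w = \<alpha> t w" using h(3) \<Delta>_point by blast
  have "cj G (inv h) t \<in> T" using hT t by blast
  then have "\<alpha> (inv (cj G (inv h) t)) w \<in> \<Delta>" by simp
  moreover have "inv (cj G (inv h) t) = inv h \<otimes> (inv t \<otimes> h)"
    using h t by (simp add: cj_def inv_mult_group m_assoc)
  then have "\<alpha> (inv (cj G (inv h) t)) w = \<alpha> (inv h) (\<alpha> (inv t) (\<alpha> t w))"
    using h t by (simp add: act_mult)
  ultimately show "inv h \<in> H0" using h t hT by (simp add: H0_def)
next
  fix h k assume "h \<in> H0" "k \<in> H0"
  then have h: "h \<in> carrier G" "cj G h ` T = T" "\<alpha> h w \<in> \<Delta>"
    and k: "k \<in> carrier G" "cj G k ` T = T" "\<alpha> k w \<in> \<Delta>" by (auto simp: H0_def)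
  obtain t u where t: "t \<in> T" "\<alpha> h w = \<alpha> t w" "u \<in> T" "\<alpha> k w = \<alpha> u w" using h(3) k(3) \<Delta>_point by metis
  have hu: "cj G h u \<in> T" using h t by blast
  have "\<alpha> (h \<otimes> k) w = \<alpha> (h \<otimes> u) w" using h k t by (simp add: act_mult)
  also have "h \<otimes> u = cj G h u \<otimes> h" using h t by (simp add: cj_def m_assoc)
  also have "\<alpha> (cj G h u \<otimes> h) w = \<alpha> (cj G h u \<otimes> t) w" using h t hu by (simp add: act_mult)
  finally have "\<alpha> (h \<otimes> k) w \<in> \<Delta>" using hu t by simp
  then show "h \<otimes> k \<in> H0"
    using h k cj_image_cj[OF h(1) k(1) factor_subset_carrier[OF T_factor]] by (simp add: H0_def)
qed

lemma H0I: "\<lbrakk>h \<in> carrier G; cj G h ` T = T; \<alpha> h w \<in> \<Delta>\<rbrakk> \<Longrightarrow> h \<in> H0"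
  and H0D: "h \<in> H0 \<Longrightarrow> cj G h ` T = T" "h \<in> H0 \<Longrightarrow> \<alpha> h w \<in> \<Delta>"
  by (simp_all add: H0_def)

lemmas H0_carrier [simp] = subgroup.mem_carrier[OF H0_subgroup]
lemmas H0_closed [simp] = subgroup.m_closed[OF H0_subgroup] subgroup.m_inv_closed[OF H0_subgroup]
  subgroup.one_closed[OF H0_subgroup]

lemma H0_\<Delta> [simp]:
  assumes h: "h \<in> H0" and x: "x \<in> \<Delta>"
  shows "\<alpha> h x \<in> \<Delta>"
proof -
  obtain t where t: "t \<in> T" "x = \<alpha> t w" using x \<Delta>_point by blast
  obtain u where u: "u \<in> T" "\<alpha> h w = \<alpha> u w" using \<Delta>_point[OF H0D(2)[OF h]] by blast
  have ht: "cj G h t \<in> T" using H0D(1)[OF h] t by blast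
  have "\<alpha> h x = \<alpha> (h \<otimes> t) w" using h t by (simp add: act_mult)
  also have "h \<otimes> t = cj G h t \<otimes> h" using h t by (simp add: cj_def m_assoc)
  also have "\<alpha> (cj G h t \<otimes> h) w = \<alpha> (cj G h t \<otimes> u) w" using h t u ht by (simp add: act_mult)
  finally show ?thesis using ht u by simp
qed

lemma T_H0: "T \<subseteq> H0"
  by (intro subsetI H0I) (simp_all add: cj_N_factor T_factor)

text \<open>Split \<open>g\<close> as \<open>n'\<close> times an element \<open>a\<close> of
  \<open>G_w\<close>. The element \<open>a\<close> carries the component in \<open>V\<close> to that
  in \<open>U\<close>, and \<open>n'\<close> then acts through its own
  \<open>U\<close>-component.\<close>

lemma coordinate_action:
  assumes g: "g \<in> carrier G" and U: "U \<in> factors"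
  shows "\<exists>h\<in>H0. \<forall>x\<in>E. pt (\<alpha> g x) U = \<alpha> h (pt x (cj G (inv g) ` U))"
proof -
  obtain n' where n': "n' \<in> N" "\<alpha> g w = \<alpha> n' w" using N_point[of "\<alpha> g w"] g by auto
  define a where "a = inv n' \<otimes> g"
  have a: "a \<in> carrier G" "\<alpha> a w = w" "g = n' \<otimes> a"
    using n' g by (simp_all add: a_def act_mult)
  have ai: "\<alpha> (inv a) w = w" using a by (metis act_inv(1) w)
  define V where "V = cj G (inv g) ` U"
  have Va: "V = cj G (inv a) ` U"
  proof -
    have "V = cj G (inv a) ` cj G (inv n') ` U"
      unfolding V_def using a n' factor_subset_carrier[OF U]
      by (simp add: cj_image_cj inv_mult_group)
    then show ?thesis using cj_N_factor[OF U, of "inv n'"] n' by simp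
  qed
  have V: "V \<in> factors" unfolding Va using factor_cj[OF U] a by simp
  have UV: "cj G a ` V = U" unfolding Va using cj_image_inv(2)[OF a(1) factor_subset_carrier[OF U]] .
  \<comment> \<open>From right to left: out of \<open>T\<close> into \<open>V\<close>, across to
    \<open>U\<close> by \<open>a\<close>, the \<open>U\<close>-component of \<open>n'\<close>, and
    back to \<open>T\<close>.\<close>
  define h where "h = inv (c U) \<otimes> proj U n' \<otimes> a \<otimes> c V"
  have h: "h \<in> carrier G" using U V n' a by (simp add: h_def)
  have "cj G h ` T = T"
  proof -
    have Tc: "T \<subseteq> carrier G" using factor_subset_carrier[OF T_factor] .
    have pN: "proj U n' \<in> N" using proj(1)[OF U n'(1)] factor_N[OF U] by blast
    have "cj G h ` T = cj G (inv (c U)) ` cj G (proj U n') ` cj G a ` cj G (c V) ` T"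
      using U V n' a Tc by (simp add: h_def cj_image_cj m_assoc)
    also have "\<dots> = T" using c_conj[OF V] UV cj_N_factor[OF U pN] c_inv_conj[OF U] by simp
    finally show ?thesis .
  qed
  moreover have "\<alpha> h w = \<alpha> (tau U n') w"
    using U V n' a by (simp add: h_def tau_def cj_def act_mult)
  ultimately have hH: "h \<in> H0" using h U n' by (intro H0I) simp_all
  have "pt (\<alpha> g x) U = \<alpha> h (pt x V)" if x: "x \<in> E" for x
  proof -
    obtain n where n: "n \<in> N" "x = \<alpha> n w" using N_point x by blast
    have "\<alpha> g x = \<alpha> (n' \<otimes> cj G a n) w"
      using n n' a ai by (simp add: act_mult cj_def)
    then have "pt (\<alpha> g x) U = \<alpha> (tau U (n' \<otimes> cj G a n)) w"
      using U n n' a by (simp add: pt_N)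
    also have "\<dots> = \<alpha> (inv (c U)) (\<alpha> (proj U n') (\<alpha> (proj U (cj G a n)) w))"
      using U n n' a by (simp add: tau_act proj_mult act_mult)
    also have "proj U (cj G a n) = cj G a (proj V n)"
      using proj_cj[OF V n(1) a(1)] UV by simp
    also have "\<alpha> (cj G a (proj V n)) w = \<alpha> a (\<alpha> (proj V n) w)"
      using a ai V n by (simp add: cj_def act_mult)
    also have "\<alpha> (inv (c U)) (\<alpha> (proj U n') (\<alpha> a (\<alpha> (proj V n) w))) = \<alpha> h (\<alpha> (tau V n) w)"
      using U V n n' a by (simp add: h_def tau_def cj_def act_mult)
    finally show ?thesis using n V by (simp add: pt_N)
  qed
  then show ?thesis using hH unfolding V_def by blast
qed

text \<open>A block through \<open>w\<close> corresponds to a subgroup \<open>S\<close> of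
  \<open>T\<close>; taking a copy of \<open>S\<close> in every factor gives a subgroup of
  \<open>N\<close> normalised by \<open>G_w\<close>, and primitivity of \<open>G\<close> on the
  product leaves only the trivial possibilities for \<open>S\<close>.\<close>

lemma \<Delta>_blocks:
  assumes B: "B \<subseteq> \<Delta>" "B \<noteq> {}" and bl: "\<And>h. h \<in> H0 \<Longrightarrow> \<alpha> h ` B = B \<or> \<alpha> h ` B \<inter> B = {}"
  shows "B = \<Delta> \<or> (\<exists>x. B = {x})"
proof -
  have main: "B = \<Delta> \<or> B = {w}"
    if B: "B \<subseteq> \<Delta>" "w \<in> B" and bl: "\<And>h. h \<in> H0 \<Longrightarrow> \<alpha> h ` B = B \<or> \<alpha> h ` B \<inter> B = {}" for B
  proof -
    define S where "S = {t \<in> T. \<alpha> t w \<in> B}"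
    have TH: "t \<in> H0" if "t \<in> T" for t using that T_H0 by blast
    have SB: "\<alpha> h ` B = B" if "h \<in> H0" "\<alpha> h w \<in> B" for h
      using bl[OF that(1)] that(2) B(2) by blast
    have S: "subgroup S G"
    proof (rule subgroupI)
      have "\<one> \<in> S" using B by (simp add: S_def)
      then show "S \<noteq> {}" by blast
    next
      fix t assume "t \<in> S"
      then have t: "t \<in> T" "\<alpha> t w \<in> B" by (auto simp: S_def)
      then obtain b where "b \<in> B" "\<alpha> t b = w" using SB[OF TH] B(2) by (metis imageE)
      moreover have "b \<in> E" using \<open>b \<in> B\<close> B(1) \<Delta>_E by blast
      ultimately have "\<alpha> (inv t) w \<in> B" using t by (metis act_inv(1) T_carrier)
      then show "inv t \<in> S" using t by (simp add: S_def)
    next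
      fix s t assume "s \<in> S" "t \<in> S"
      then show "s \<otimes> t \<in> S" using SB[OF TH, of s] by (auto simp: S_def act_mult)
    qed (auto simp: S_def)
    \<comment> \<open>The copies of \<open>S\<close> in all factors together; \<open>G_w\<close>
      permutes these copies.\<close>
    define V where "V = {n \<in> N. \<forall>U\<in>factors. tau U n \<in> S}"
    have V: "subgroup V G"
    proof (rule subgroupI)
      have "\<one> \<in> V" using subgroup.one_closed[OF S] by (simp add: V_def)
      then show "V \<noteq> {}" by blast
    qed (auto simp: V_def tau_mult tau_inv subgroup.m_closed[OF S] subgroup.m_inv_closed[OF S])
    have "orb V w = {w} \<or> orb V w = E"
    proof (rule invariant_subgroup_orbit[OF V w])
      fix a n assume "a \<in> stab (carrier G) w" and n: "n \<in> V"
      then have a: "a \<in> carrier G" "\<alpha> a w = w" by (auto simp: stab_def)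
      have ai: "\<alpha> (inv a) w = w" using a by (metis act_inv(1) w)
      have nN: "n \<in> N" using n by (simp add: V_def)
      have "tau U (cj G a n) \<in> S" if U: "U \<in> factors" for U
      proof -
        define W where "W = cj G (inv a) ` U"
        have W: "W \<in> factors" unfolding W_def using factor_cj[OF U] a by simp
        have UW: "cj G a ` W = U"
          unfolding W_def using cj_image_inv(2)[OF a(1) factor_subset_carrier[OF U]] .
        \<comment> \<open>The effect of \<open>a\<close> on coordinates, read inside
          \<open>T\<close>. It fixes \<open>w\<close> and lies in \<open>H0\<close>, so it preserves
          any block through \<open>w\<close>.\<close>
        define d where "d = inv (c U) \<otimes> a \<otimes> c W"
        have d: "d \<in> carrier G" "\<alpha> d w = w" using U W a by (simp_all add: d_def act_mult)
        have di: "\<alpha> (inv d) w = w" using d by (metis act_inv(1) w)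
        have "cj G d ` T = cj G (inv (c U)) ` cj G a ` cj G (c W) ` T"
          using U W a factor_subset_carrier[OF T_factor] by (simp add: d_def cj_image_cj m_assoc)
        then have "cj G d ` T = T" using c_conj[OF W] UW c_inv_conj[OF U] by simp
        then have dH: "d \<in> H0" using d by (intro H0I) simp_all
        have "tau U (cj G a n) = cj G d (tau W n)"
          using proj_cj[OF W nN a(1)] UW U W a nN
          by (simp add: tau_def d_def cj_cj m_assoc)
        moreover have "tau W n \<in> S" using n W by (simp add: V_def)
        then have t: "tau W n \<in> T" "\<alpha> (tau W n) w \<in> B" by (auto simp: S_def)
        moreover have "cj G d (tau W n) \<in> T" using \<open>cj G d ` T = T\<close> t by blast
        moreover have "\<alpha> (cj G d (tau W n)) w = \<alpha> d (\<alpha> (tau W n) w)"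
          using d di t by (simp add: cj_def act_mult)
        moreover have "\<alpha> d (\<alpha> (tau W n) w) \<in> B" using SB[OF dH] d(2) B(2) t by auto
        ultimately show ?thesis by (simp add: S_def)
      qed
      then show "cj G a n \<in> V" using nN a by (simp add: V_def)
    qed
    then show ?thesis
    proof
      assume o: "orb V w = {w}"
      have "b = w" if b: "b \<in> B" for b
      proof -
        obtain t where t: "t \<in> T" "b = \<alpha> t w" using b B(1) \<Delta>_point by blast
        then have "tau U t \<in> S" if "U \<in> factors" for U
          using that b tau_self tau_other[of t U] subgroup.one_closed[OF S]
          by (cases "U = T") (auto simp: S_def)
        then have "t \<in> V" using t by (simp add: V_def)
        then show ?thesis using o t by (auto simp: orb_def)
      qed
      then show ?thesis using B(2) by blast
    next
      assume o: "orb V w = E"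
      have "x \<in> B" if x: "x \<in> \<Delta>" for x
      proof -
        obtain t where t: "t \<in> T" "x = \<alpha> t w" using x \<Delta>_point by blast
        have "x \<in> orb V w" using o x \<Delta>_E by blast
        then obtain v where v: "v \<in> V" "x = \<alpha> v w" by (auto simp: orb_def)
        then have "\<alpha> (tau T t) w = \<alpha> (tau T v) w"
          using t same_point_iff[of t v] T_factor by (auto simp: V_def)
        then have "x = \<alpha> (tau T v) w" using t by (simp add: tau_self)
        then show ?thesis using v T_factor by (simp add: V_def S_def)
      qed
      then show ?thesis using B(1) by blast
    qed
  qed
  obtain b where b: "b \<in> B" using B(2) by blast
  then obtain t where t: "t \<in> T" "b = \<alpha> t w" using B(1) \<Delta>_point by blast
  have BE: "y \<in> E" if "y \<in> B" for y using that B(1) \<Delta>_E by blast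
  have tH: "t \<in> H0" using t T_H0 by blast
  \<comment> \<open>An arbitrary block is moved by \<open>T\<close> to a block through the base
    point.\<close>
  let ?B = "\<alpha> (inv t) ` B"
  have inv_img: "\<alpha> t ` ?B = B"
    unfolding image_image using BE t by (simp cong: image_cong_simp)
  have "?B = \<Delta> \<or> ?B = {w}"
  proof (rule main)
    show "?B \<subseteq> \<Delta>" using B(1) tH by (auto simp: subset_iff)
    show "w \<in> ?B" using b t by (intro image_eqI[of _ _ b]) auto
    fix h assume h: "h \<in> H0"
    have img: "\<alpha> h ` ?B = \<alpha> (inv t) ` \<alpha> (cj G t h) ` B"
      unfolding image_image
      by (rule image_cong) (use BE h t in \<open>auto simp: cj_def act_mult\<close>)
    have hH: "cj G t h \<in> H0" using h tH by (simp add: cj_def)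
    show "\<alpha> h ` ?B = ?B \<or> \<alpha> h ` ?B \<inter> ?B = {}"
      using bl[OF hH]
    proof
      assume e: "\<alpha> (cj G t h) ` B \<inter> B = {}"
      have "\<alpha> h ` ?B \<inter> ?B = {}"
      proof (rule ccontr)
        assume "\<alpha> h ` ?B \<inter> ?B \<noteq> {}"
        then obtain x y where xy: "x \<in> B" "y \<in> B" "\<alpha> (inv t) (\<alpha> (cj G t h) x) = \<alpha> (inv t) y"
          unfolding img by blast
        then have "\<alpha> (cj G t h) x = y" using BE t h by simp
        then show False using e xy by blast
      qed
      then show ?thesis ..
    qed (simp add: img)
  qed
  then show ?thesis
  proof
    assume "?B = \<Delta>"
    then have "B = \<alpha> t ` \<Delta>" using inv_img by simp
    then have "card B = card \<Delta>" using \<Delta>_E t by (auto intro!: card_image simp: inj_on_def subset_iff)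
    then show ?thesis using card_subset_eq[OF finite_\<Delta> B(1)] by simp
  next
    assume "?B = {w}"
    then show ?thesis using inv_img by force
  qed
qed

lemma T_not_fix: "\<not> (\<forall>t\<in>T. \<alpha> t w = w)"
proof
  assume "\<forall>t\<in>T. \<alpha> t w = w"
  then have "T = {\<one>}"
    by (intro fixes_point_normal_trivial[OF factor_normal[OF T_factor] N_transitive N_subgroup w]) simp
  then show False using T_minimal by (simp add: minimal_normal_in_def)
qed

lemma tau_Q: "U \<in> factors \<Longrightarrow> subgroup (tau U ` Q) G \<and> (\<exists>i. card (tau U ` Q) = p ^ i)"
proof -
  assume U: "U \<in> factors"
  have "tau U ` Q = cj G (inv (c U)) ` (Q \<inter> U)"
    unfolding proj_Q[OF U, symmetric] image_image tau_def ..
  moreover have R: "subgroup (Q \<inter> U) G" using subgroup_Int Q_subgroup factor_subgroup[OF U] by blast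
  moreover have "\<exists>i. card (Q \<inter> U) = p ^ i" using p_power_subgroup_card[OF R] by simp
  ultimately show ?thesis
    using subgroup_image_cj[OF R] card_image_cj[of "inv (c U)" "Q \<inter> U"] subgroup.subset[OF R] U by simp
qed

text \<open>The orbits of \<open>P\<close> are those of \<open>Q\<close>, which moves the coordinates independently; hence an element of
  \<open>P\<close> that permutes the coordinates nontrivially forces \<open>Q\<close> to be transitive on \<open>\<Delta>\<close>.\<close>

lemma moving_factor_imp_prime_power:
  assumes x: "x \<in> P" and U: "U \<in> factors" and mv: "cj G x ` U \<noteq> U"
  shows "\<exists>i. card \<Delta> = p ^ i"
proof -
  have xc: "x \<in> carrier G" using x P_subgroup by (simp add: subgroup.mem_carrier)
  define V where "V = cj G (inv x) ` U"
  have V: "V \<in> factors" unfolding V_def using factor_cj[OF U] xc by simp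
  have VU: "V \<noteq> U"
    using mv cj_image_inv(2)[OF xc factor_subset_carrier[OF U]] unfolding V_def by metis
  obtain h where h: "h \<in> H0" "\<And>y. y \<in> E \<Longrightarrow> pt (\<alpha> x y) U = \<alpha> h (pt y V)"
    using coordinate_action[OF xc U] unfolding V_def by blast
  have R: "subgroup (tau U ` Q) G" using tau_Q[OF U] by blast
  have "\<Delta> \<subseteq> orb (tau U ` Q) w"
  proof
    fix \<delta> assume d: "\<delta> \<in> \<Delta>"
    define \<epsilon> where "\<epsilon> = \<alpha> (inv h) \<delta>"
    have e: "\<epsilon> \<in> \<Delta>" using d h by (simp add: \<epsilon>_def)
    have "\<alpha> h \<epsilon> = \<delta>" using d h \<Delta>_E by (auto simp: \<epsilon>_def)
    \<comment> \<open>At \<open>y\<close>, the element \<open>x\<close> brings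
      \<open>\<alpha> h \<epsilon> = \<delta>\<close> from coordinate \<open>V\<close> to coordinate
      \<open>U\<close>. Some \<open>q\<close> in \<open>Q\<close> has the same effect on
      \<open>y\<close> but acts on the base point in coordinate \<open>U\<close> by
      \<open>tau U q\<close>, so it moves \<open>w\<close> to \<open>\<delta>\<close> there.\<close>
    have "\<exists>y\<in>E. \<forall>W\<in>factors. pt y W = (if W = V then \<epsilon> else w)"
      by (rule pt_surj) (use e in simp)
    then obtain y where y: "y \<in> E" "\<And>W. W \<in> factors \<Longrightarrow> pt y W = (if W = V then \<epsilon> else w)"
      by blast
    obtain n where n: "n \<in> N" "y = \<alpha> n w" using N_point y(1) by blast
    have "\<alpha> x y \<in> orb Q y" using orb_P_eq_orb_Q[OF y(1)] x by (auto simp: orb_def)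
    then obtain q where q: "q \<in> Q" "\<alpha> x y = \<alpha> q y" by (auto simp: orb_def)
    have "\<alpha> x y = \<alpha> (q \<otimes> n) w" using q n Q_N by (simp add: act_mult)
    moreover have "pt (\<alpha> (q \<otimes> n) w) U = \<alpha> (tau U q) (\<alpha> (tau U n) w)"
      using q(1) n(1) Q_N U by (subst pt_N) (simp_all add: tau_mult act_mult)
    ultimately have "pt (\<alpha> x y) U = \<alpha> (tau U q) (\<alpha> (tau U n) w)" by simp
    moreover have "\<alpha> (tau U n) w = w" using y(2)[OF U] VU n U by (simp add: pt_N)
    ultimately have "\<delta> = \<alpha> (tau U q) w" using h(2)[OF y(1)] y(2)[OF V] \<open>\<alpha> h \<epsilon> = \<delta>\<close> by simp
    then show "\<delta> \<in> orb (tau U ` Q) w" using q by (auto simp: orb_def)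
  qed
  moreover have "orb (tau U ` Q) w \<subseteq> \<Delta>" using U Q_N by (auto simp: orb_def)
  ultimately have "card \<Delta> dvd card (tau U ` Q)"
    using orbit_stabiliser[OF R w] by (metis dvd_triv_left subset_antisym)
  then show ?thesis using tau_Q[OF U] prime_p by (auto simp: divides_primepow_nat)
qed

end

section \<open>The group induced on a coordinate\<close>

lemma (in finite_action) property_star_iff:
  "property_star p G E \<alpha> \<longleftrightarrow> (\<exists>P. star p P (carrier G))"
proof -
  have st: "stabilizer G \<alpha> x = stab (carrier G) x" for x
    by (simp add: stabilizer_def stab_def)
  have 1: "sylow_subgroup p P G \<longleftrightarrow> sylow_in p P (carrier G) G" for P
    by (auto simp: sylow_subgroup_def sylow_in_def order_def dest: subgroup.subset)
  have 2: "sylow_subgroup p (P \<inter> stab (carrier G) x) (G\<lparr>carrier := stab (carrier G) x\<rparr>)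
      \<longleftrightarrow> sylow_in p (stab P x) (stab (carrier G) x) G"
    if P: "subgroup P G" and x: "x \<in> E" for P x
  proof -
    have e: "P \<inter> stab (carrier G) x = stab P x" using subgroup.subset[OF P] by (auto simp: stab_def)
    have S: "subgroup (stab (carrier G) x) G" using stab_subgroup[OF subgroup_self x] .
    have sub: "stab P x \<subseteq> stab (carrier G) x" using e by blast
    have "subgroup (stab P x) (G\<lparr>carrier := stab (carrier G) x\<rparr>)"
      using subgroup_incl[OF stab_subgroup[OF P x] S sub] .
    then show ?thesis
      unfolding e using stab_subgroup[OF P x] sub by (auto simp: sylow_subgroup_def sylow_in_def order_def)
  qed
  show ?thesis
    unfolding property_star_def star_def st 1 using 2 by (meson sylow_in_def)
qed

section \<open>Permutation groups as instances of the abstract actions\<close>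

lemma bij_mult_apply: "\<lbrakk>g \<in> Bij A; h \<in> Bij A; x \<in> A\<rbrakk> \<Longrightarrow> (g \<otimes>\<^bsub>BijGroup A\<^esub> h) x = g (h x)"
  by (simp add: BijGroup_def compose_def)

lemma finite_Bij: "finite A \<Longrightarrow> finite (Bij A)"
proof -
  assume A: "finite A"
  have "Bij A \<subseteq> A \<rightarrow>\<^sub>E A" by (auto simp: Bij_def PiE_def bij_betw_def)
  then show ?thesis using finite_PiE[OF A, of "\<lambda>_. A"] A finite_subset by blast
qed

lemma finite_action_perm_group:
  assumes G: "subgroup G (BijGroup A)" and A: "finite A"
  shows "finite_action (perm_group A G) A id"
proof -
  interpret B: group "BijGroup A" by (rule group_BijGroup)
  interpret GG: group "perm_group A G" using G by (rule B.subgroup_imp_group)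
  have GB: "G \<subseteq> Bij A" using subgroup.subset[OF G] by (simp add: BijGroup_def)
  show ?thesis
  proof unfold_locales
    show "finite (carrier (perm_group A G))" using GB finite_Bij[OF A] finite_subset by auto
    show "id g x \<in> A" if "g \<in> carrier (perm_group A G)" "x \<in> A" for g x
      using that GB Bij_imp_funcset by fastforce
    show "id (g \<otimes>\<^bsub>perm_group A G\<^esub> h) x = id g (id h x)"
      if "g \<in> carrier (perm_group A G)" "h \<in> carrier (perm_group A G)" "x \<in> A" for g h x
      using that GB by (simp add: bij_mult_apply subset_iff)
    show "id \<one>\<^bsub>perm_group A G\<^esub> x = x" if "x \<in> A" for x using that by (simp add: BijGroup_def)
  qed (rule A)
qed

lemma primitive_group_of_perm_group:
  assumes pr: "primitive_perm_group A G" and A: "finite A" "card A > 1"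
  shows "primitive_group (perm_group A G) A id"
proof -
  have G: "subgroup G (BijGroup A)" and tr: "transitive_action (perm_group A G) A id"
    and bl: "\<And>B. block (perm_group A G) A id B \<Longrightarrow> B = A \<or> (\<exists>x. B = {x})"
    using pr by (auto simp: primitive_perm_group_def primitive_action_def)
  have GB: "G \<subseteq> Bij A" using subgroup.subset[OF G] by (simp add: BijGroup_def)
  interpret finite_action "perm_group A G" A id by (rule finite_action_perm_group[OF G A(1)])
  show ?thesis
  proof unfold_locales
    show "g = \<one>\<^bsub>perm_group A G\<^esub>"
      if "g \<in> carrier (perm_group A G)" "\<And>x. x \<in> A \<Longrightarrow> id g x = x" for g
    proof -
      have "g \<in> extensional A" using that GB Bij_imp_extensional by auto
      then have "g = (\<lambda>x\<in>A. x)" using that(2) by (auto simp: extensional_def)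
      then show ?thesis by (simp add: BijGroup_def)
    qed
    show "transitive_on_E (carrier (perm_group A G))"
      unfolding transitive_on_E_def using transitive_action.unique_orbit[OF tr] by blast
    show "1 < card A" by (rule A(2))
    show "B = A \<or> (\<exists>x. B = {x})"
      if "B \<subseteq> A" "B \<noteq> {}"
        "\<And>g. g \<in> carrier (perm_group A G) \<Longrightarrow> id g ` B = B \<or> id g ` B \<inter> B = {}" for B
      using bl[of B] that unfolding block_def by blast
  qed
qed

lemma group_action_perm_group:
  assumes "subgroup G (BijGroup A)"
  shows "group_action (perm_group A G) A id"
proof -
  interpret B: group "BijGroup A" by (rule group_BijGroup)
  show ?thesis
    by (intro group_action.intro group_hom.intro group_hom_axioms.intro B.subgroup_imp_group assms
        B.is_group) (use subgroup.subset[OF assms] in \<open>auto simp: hom_def\<close>)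
qed

lemma primitive_perm_groupI:
  assumes G: "subgroup G (BijGroup A)" and ne: "A \<noteq> {}"
    and tr: "\<And>x y. \<lbrakk>x \<in> A; y \<in> A\<rbrakk> \<Longrightarrow> \<exists>g\<in>G. g x = y"
    and bl: "\<And>B. \<lbrakk>B \<subseteq> A; B \<noteq> {}; \<And>g. g \<in> G \<Longrightarrow> g ` B = B \<or> g ` B \<inter> B = {}\<rbrakk>
      \<Longrightarrow> B = A \<or> (\<exists>x. B = {x})"
  shows "primitive_perm_group A G"
proof -
  have "transitive_action (perm_group A G) A id"
    by (intro transitive_action.intro group_action_perm_group G transitive_action_axioms.intro)
       (use tr in simp)
  then show ?thesis
    unfolding primitive_perm_group_def primitive_action_def block_def
    using G ne bl by auto
qed

section \<open>The group \<open>HP\<close> induced by \<open>H0\<close> on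
  \<open>\<Delta>\<close>\<close>

context product_socle
begin

definition res :: "'a \<Rightarrow> 'c \<Rightarrow> 'c" where "res h = (\<lambda>x\<in>\<Delta>. \<alpha> h x)"

definition HP :: "('c \<Rightarrow> 'c) set" where "HP = res ` H0"

lemma \<Delta>_in_E [simp]: "x \<in> \<Delta> \<Longrightarrow> x \<in> E"
  using \<Delta>_E by blast

lemma res_Bij: "h \<in> H0 \<Longrightarrow> res h \<in> Bij \<Delta>"
proof -
  assume h: "h \<in> H0"
  have "bij_betw (res h) \<Delta> \<Delta>"
    by (rule bij_betwI[where g = "res (inv h)"]) (use h in \<open>auto simp: res_def\<close>)
  then show ?thesis by (simp add: Bij_def res_def)
qed

lemma res_mult:
  assumes "h \<in> H0" "k \<in> H0"
  shows "res (h \<otimes> k) = res h \<otimes>\<^bsub>BijGroup \<Delta>\<^esub> res k"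
proof -
  have "compose \<Delta> (res h) (res k) = res (h \<otimes> k)"
    by (rule extensionalityI[of _ \<Delta>]) (use assms in \<open>auto simp: compose_def res_def act_mult\<close>)
  then show ?thesis using assms res_Bij by (simp add: BijGroup_def)
qed

lemma HP_subgroup: "subgroup HP (BijGroup \<Delta>)"
  unfolding HP_def
  by (rule card_hom_image(2)[OF H0_subgroup finite_subgroup[OF H0_subgroup] group_BijGroup])
     (use res_Bij res_mult in \<open>auto simp: BijGroup_def\<close>)

lemma HP_transitive: "\<lbrakk>x \<in> \<Delta>; y \<in> \<Delta>\<rbrakk> \<Longrightarrow> \<exists>g\<in>HP. g x = y"
proof -
  assume xy: "x \<in> \<Delta>" "y \<in> \<Delta>"
  obtain s t where st: "s \<in> T" "x = \<alpha> s w" "t \<in> T" "y = \<alpha> t w" using xy \<Delta>_point by metis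
  have "res (t \<otimes> inv s) x = y" using st xy by (simp add: res_def act_mult)
  moreover have "t \<otimes> inv s \<in> H0" using st T_H0 by auto
  ultimately show ?thesis by (auto simp: HP_def)
qed

lemma HP_primitive: "primitive_perm_group \<Delta> HP"
proof (rule primitive_perm_groupI[OF HP_subgroup])
  show "\<Delta> \<noteq> {}" using w_\<Delta> by blast
  show "\<exists>g\<in>HP. g x = y" if "x \<in> \<Delta>" "y \<in> \<Delta>" for x y using HP_transitive[OF that] .
  fix B assume B: "B \<subseteq> \<Delta>" "B \<noteq> {}" "\<And>g. g \<in> HP \<Longrightarrow> g ` B = B \<or> g ` B \<inter> B = {}"
  have "res h ` B = \<alpha> h ` B" for h
    using B(1) by (intro image_cong) (auto simp: res_def)
  then show "B = \<Delta> \<or> (\<exists>x. B = {x})"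
    using B(3) by (intro \<Delta>_blocks[OF B(1,2)]) (metis HP_def imageI)
qed

lemma pt_bij: "bij_betw (\<lambda>x. \<lambda>U\<in>factors. pt x U) E (factors \<rightarrow>\<^sub>E \<Delta>)"
  unfolding bij_betw_def
proof
  show "inj_on (\<lambda>x. \<lambda>U\<in>factors. pt x U) E"
  proof (rule inj_onI)
    fix x y assume xy: "x \<in> E" "y \<in> E" "(\<lambda>U\<in>factors. pt x U) = (\<lambda>U\<in>factors. pt y U)"
    show "x = y" by (rule pt_eq_imp_eq[OF xy(1,2)]) (use xy(3) in \<open>metis restrict_apply\<close>)
  qed
  show "(\<lambda>x. \<lambda>U\<in>factors. pt x U) ` E = factors \<rightarrow>\<^sub>E \<Delta>"
  proof
    show "(\<lambda>x. \<lambda>U\<in>factors. pt x U) ` E \<subseteq> factors \<rightarrow>\<^sub>E \<Delta>" using pt_\<Delta> by auto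
    show "factors \<rightarrow>\<^sub>E \<Delta> \<subseteq> (\<lambda>x. \<lambda>U\<in>factors. pt x U) ` E"
    proof
      fix \<delta> assume d: "\<delta> \<in> factors \<rightarrow>\<^sub>E \<Delta>"
      then obtain x where x: "x \<in> E" "\<And>U. U \<in> factors \<Longrightarrow> pt x U = \<delta> U"
        using pt_surj[of \<delta>] by blast
      have "(\<lambda>U\<in>factors. pt x U) = \<delta>"
        by (rule extensionalityI[of _ factors]) (use d x in \<open>auto simp: PiE_def\<close>)
      then show "\<delta> \<in> (\<lambda>x. \<lambda>U\<in>factors. pt x U) ` E" using x by blast
    qed
  qed
qed

lemma p_dvd_\<Delta>: "p dvd card \<Delta>"
proof -
  have "card E = card \<Delta> ^ card factors"
    using bij_betw_same_card[OF pt_bij] by (simp add: card_funcsetE)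
  then show ?thesis using p_dvd prime_p by (metis prime_dvd_power)
qed

lemma card_\<Delta>: "card \<Delta> > 1"
proof -
  have "card \<Delta> > 0" using w_\<Delta> finite_\<Delta> by (metis card_gt_0_iff empty_iff)
  then have "p \<le> card \<Delta>" using p_dvd_\<Delta> by (simp add: dvd_imp_le)
  then show ?thesis using prime_gt_1_nat[OF prime_p] by simp
qed

end

sublocale product_socle \<subseteq> H: primitive_group "perm_group \<Delta> HP" \<Delta> id
  by (rule primitive_group_of_perm_group[OF HP_primitive finite_\<Delta> card_\<Delta>])

context product_socle
begin

lemma HP_star_of_prime_power:
  assumes "card \<Delta> = p ^ i"
  shows "\<exists>R. H.star p R HP"
proof -
  obtain R where "sylow_in p R HP (perm_group \<Delta> HP)"
    using H.sylow_in_exists[OF H.finite_carrier prime_p H.subgroup_self] by auto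
  then show ?thesis using H.star_of_prime_power_degree[OF prime_p H.transitive assms] by auto
qed

text \<open>\<open>P\<close> normalises \<open>T\<close> but need not preserve
  \<open>\<Delta>\<close>, so it is not restricted to \<open>\<Delta>\<close>; instead the
  normaliser \<open>G1\<close> of \<open>T\<close> acts on the \<open>T\<close>-coordinate, with
  image \<open>HP\<close>. The image of \<open>P\<close> is Sylow there, and its orbits are bounded
  by those of \<open>Q \<inter> T\<close>.\<close>

lemma HP_star_of_fixed_factor:
  assumes fix_T: "\<And>x. x \<in> P \<Longrightarrow> cj G x ` T = T"
  shows "\<exists>R. H.star p R HP"
proof -
  have Tc: "T \<subseteq> carrier G" using factor_subset_carrier[OF T_factor] .
  define G1 where "G1 = {g \<in> carrier G. cj G g ` T = T}"
  have G1: "subgroup G1 G"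
  proof (rule subgroupI)
    have "\<one> \<in> G1" using cj_N_factor[OF T_factor, of \<one>] by (simp add: G1_def)
    then show "G1 \<noteq> {}" by blast
    show "inv g \<in> G1" if "g \<in> G1" for g
      using that cj_image_inv(1)[OF _ Tc, of g] by (simp add: G1_def)
    show "g \<otimes> h \<in> G1" if "g \<in> G1" "h \<in> G1" for g h
      using that cj_image_cj[OF _ _ Tc, of g h] by (simp add: G1_def)
  qed (auto simp: G1_def)
  have G1c: "g \<in> carrier G" if "g \<in> G1" for g using that by (simp add: G1_def)
  have PG1: "P \<subseteq> G1" using fix_T subgroup.subset[OF P_subgroup] by (auto simp: G1_def)
  \<comment> \<open>Move a point of \<open>\<Delta>\<close> by \<open>g\<close>, then return to
    \<open>\<Delta>\<close> by forgetting all other coordinates. On \<open>H0\<close> this is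
    \<open>res\<close>.\<close>
  define psi where "psi = (\<lambda>g. \<lambda>x\<in>\<Delta>. pt (\<alpha> g x) T)"
  have psi: "psi g \<in> HP \<and> (\<forall>x\<in>E. pt (\<alpha> g x) T = psi g (pt x T))" if g: "g \<in> G1" for g
  proof -
    have "cj G (inv g) ` T = T" using subgroup.m_inv_closed[OF G1 g] by (simp add: G1_def)
    then obtain h where h: "h \<in> H0" "\<And>x. x \<in> E \<Longrightarrow> pt (\<alpha> g x) T = \<alpha> h (pt x T)"
      using coordinate_action[OF G1c[OF g] T_factor] by auto
    have "psi g = res h"
      unfolding psi_def res_def by (rule restrict_ext) (use h(2) pt_T_\<Delta> in simp)
    moreover have "psi g (pt x T) = \<alpha> h (pt x T)" if "x \<in> E" for x
      unfolding \<open>psi g = res h\<close> using pt_\<Delta>[OF that T_factor] by (simp add: res_def)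
    ultimately show ?thesis using h by (simp add: HP_def)
  qed
  have HB: "g \<in> Bij \<Delta>" if "g \<in> HP" for g
    using that subgroup.subset[OF HP_subgroup] by (auto simp: BijGroup_def)
  have psi_mult: "psi (g \<otimes> h) = psi g \<otimes>\<^bsub>perm_group \<Delta> HP\<^esub> psi h" if gh: "g \<in> G1" "h \<in> G1" for g h
  proof -
    have B: "psi g \<in> Bij \<Delta>" "psi h \<in> Bij \<Delta>" using psi[OF gh(1)] psi[OF gh(2)] HB by blast+
    have "compose \<Delta> (psi g) (psi h) = psi (g \<otimes> h)"
    proof (rule extensionalityI[of _ \<Delta>])
      show "psi (g \<otimes> h) \<in> extensional \<Delta>" by (simp add: psi_def)
      fix x assume x: "x \<in> \<Delta>"
      have "psi (g \<otimes> h) x = pt (\<alpha> g (\<alpha> h x)) T"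
        using x gh G1c by (simp add: psi_def act_mult)
      also have "\<dots> = psi g (pt (\<alpha> h x) T)"
        using psi[OF gh(1)] x G1c[OF gh(2)] by simp
      also have "pt (\<alpha> h x) T = psi h x" using x by (simp add: psi_def)
      finally show "compose \<Delta> (psi g) (psi h) x = psi (g \<otimes> h) x" using x by (simp add: compose_def)
    qed simp
    then show ?thesis using B by (simp add: BijGroup_def)
  qed
  have psi_im: "psi ` G1 = HP"
  proof
    show "psi ` G1 \<subseteq> HP" using psi by blast
    show "HP \<subseteq> psi ` G1"
    proof
      fix g assume "g \<in> HP"
      then obtain h where h: "h \<in> H0" "g = res h" by (auto simp: HP_def)
      have "psi h = res h" unfolding psi_def res_def
        by (rule restrict_ext) (use h pt_T_\<Delta> in simp)
      moreover have "h \<in> G1" using h(1) H0D(1) by (simp add: G1_def)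
      ultimately show "g \<in> psi ` G1" using h by (metis imageI)
    qed
  qed
  have "sylow_in p P G1 G"
  proof -
    have "card P dvd card G1" "card G1 dvd card (carrier G)"
      using subgroup_mono_dvd[OF P_subgroup G1 PG1] subgroup_mono_dvd[OF G1 subgroup_self] G1c by auto
    moreover have cP: "card P = p ^ multiplicity p (card (carrier G))"
      using star_sylow[OF star_P] by (simp add: sylow_in_def)
    moreover have "card (carrier G) > 0" "card G1 > 0"
      using card_subgroup_pos subgroup_self G1 by blast+
    ultimately have "multiplicity p (card G1) = multiplicity p (card (carrier G))"
      using prime_p by (intro antisym dvd_imp_multiplicity_le multiplicity_geI) auto
    then show ?thesis using cP P_subgroup PG1 by (simp add: sylow_in_def)
  qed
  from sylow_in_hom(1)[OF finite_carrier prime_p G1 this H.is_group _ psi_mult]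
  have sy: "sylow_in p (psi ` P) HP (perm_group \<Delta> HP)" using psi_im by simp
  have "H.star p (psi ` P) HP"
  proof (rule H.starI[OF prime_p _ sy])
    show "subgroup HP (perm_group \<Delta> HP)" using H.subgroup_self by simp
    fix x assume x: "x \<in> \<Delta>"
    \<comment> \<open>In \<open>E\<close> the orbits of \<open>P\<close> are orbits of
      \<open>Q\<close>, and on the \<open>T\<close>-coordinate \<open>Q\<close> acts through its
      component in \<open>Q \<inter> T\<close>.\<close>
    have "H.orb (psi ` P) x \<subseteq> orb (Q \<inter> T) x"
    proof
      fix y assume "y \<in> H.orb (psi ` P) x"
      then obtain g where g: "g \<in> P" "y = pt (\<alpha> g x) T" using x by (auto simp: H.orb_def psi_def)
      have "\<alpha> g x \<in> orb Q x" using orb_P_eq_orb_Q[of x] g x by (auto simp: orb_def)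
      then obtain q where q: "q \<in> Q" "\<alpha> g x = \<alpha> q x" by (auto simp: orb_def)
      obtain t where t: "t \<in> T" "x = \<alpha> t w" using x \<Delta>_point by blast
      have qT: "tau T q \<in> Q \<inter> T"
        using proj_Q[OF T_factor] q Q_N T_factor by (auto simp: tau_def c_T)
      have "y = pt (\<alpha> (q \<otimes> t) w) T" using g q t Q_N by (simp add: act_mult)
      also have "\<dots> = \<alpha> (tau T (q \<otimes> t)) w" using q t Q_N T_factor by (intro pt_N) auto
      also have "\<dots> = \<alpha> (tau T q) x" using q t Q_N T_factor by (simp add: tau_mult tau_self act_mult)
      finally show "y \<in> orb (Q \<inter> T) x" using qT by (auto simp: orb_def)
    qed
    then have "card (H.orb (psi ` P) x) \<le> card (orb (Q \<inter> T) x)"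
      using finite_orb subgroup_Int Q_subgroup T_subgroup by (intro card_mono) blast+
    also have "\<dots> = p ^ multiplicity p (card (orb T x))"
      using star_card_orb[OF prime_p T_subgroup star_Q_Int[OF factor_normal[OF T_factor]], of x] x
      by simp
    also have "orb T x = \<Delta>" unfolding \<Delta>_def by (rule orb_eq[OF T_subgroup w]) (use x in \<open>simp add: \<Delta>_def\<close>)
    also have "\<Delta> = H.orb HP x" using H.transitive_orb[OF H.transitive H.subgroup_self x] by simp
    finally show "card (H.orb (psi ` P) x) \<le> p ^ multiplicity p (card (H.orb HP x))" .
  qed
  then show ?thesis by blast
qed

text \<open>If some element of \<open>P\<close> moves \<open>T\<close>, then
  \<open>card \<Delta>\<close> is a power of \<open>p\<close> and every Sylow subgroup of
  \<open>HP\<close> is a witness.\<close>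

lemma HP_star: "\<exists>R. H.star p R HP"
proof (cases "\<forall>x\<in>P. cj G x ` T = T")
  case True
  then show ?thesis using HP_star_of_fixed_factor by blast
next
  case False
  then obtain x where "x \<in> P" "cj G x ` T \<noteq> T" by blast
  then show ?thesis using moving_factor_imp_prime_power[OF _ T_factor] HP_star_of_prime_power by blast
qed

lemma HP_property_star: "property_star p (perm_group \<Delta> HP) \<Delta> id"
  using HP_star H.property_star_iff by simp

text \<open>\<open>HP\<close> on \<open>\<Delta>\<close> is itself primitive with the star property
  and degree divisible by \<open>p\<close>, so the centraliser argument applies to it once
  \<open>T\<close> is known to embed.\<close>

lemma HP_almost_simple: "almost_simple (perm_group \<Delta> HP)"
proof -
  have TH: "t \<in> H0" if "t \<in> T" for t using that T_H0 by blast
  have inj: "inj_on res T"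
  proof -
    \<comment> \<open>The kernel of \<open>T\<close> on \<open>\<Delta>\<close>; it is proper
      because \<open>T\<close> moves \<open>w\<close>, so simplicity makes it trivial.\<close>
    define L where "L = {t \<in> T. \<forall>x\<in>\<Delta>. \<alpha> t x = x}"
    have "subgroup L G"
    proof (rule subgroupI)
      have "\<one> \<in> L" by (simp add: L_def)
      then show "L \<noteq> {}" by blast
      show "inv a \<in> L" if "a \<in> L" for a
        using that by (auto simp: L_def) (metis act_inv(1) T_carrier \<Delta>_in_E)
    qed (auto simp: L_def act_mult)
    moreover have "cj G s t \<in> L" if "s \<in> T" "t \<in> L" for s t
    proof -
      have "\<alpha> (cj G s t) x = x" if x: "x \<in> \<Delta>" for x
      proof -
        have "\<alpha> (inv s) x \<in> \<Delta>" using TH \<open>s \<in> T\<close> x by simp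
        then have "\<alpha> t (\<alpha> (inv s) x) = \<alpha> (inv s) x" using \<open>t \<in> L\<close> by (simp add: L_def)
        then show ?thesis using \<open>s \<in> T\<close> \<open>t \<in> L\<close> x by (simp add: cj_def act_mult L_def)
      qed
      then show ?thesis using that subgroup_cj_closed[OF T_subgroup] by (simp add: L_def)
    qed
    ultimately have "normal_in L T G" by (auto simp: normal_in_def L_def)
    then have "L = {\<one>} \<or> L = T" using factor_simple[OF T_factor] by (simp add: nonabelian_simple_in_def)
    moreover have "L \<noteq> T"
    proof -
      obtain t where "t \<in> T" "\<alpha> t w \<noteq> w" using T_not_fix by blast
      then have "t \<notin> L" using w_\<Delta> unfolding L_def by blast
      then show ?thesis using \<open>t \<in> T\<close> by blast
    qed
    ultimately have L1: "L = {\<one>}" by blast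
    show ?thesis
    proof (rule inj_onI)
      fix s t assume st: "s \<in> T" "t \<in> T" "res s = res t"
      have "\<alpha> s x = \<alpha> t x" if "x \<in> \<Delta>" for x
        using fun_cong[OF st(3), of x] that by (simp add: res_def)
      then have "inv t \<otimes> s \<in> L" using st by (simp add: L_def act_mult)
      then have "inv t \<otimes> s = \<one>" using L1 by blast
      then show "s = t" using st by (metis inv_cancel(2) r_one T_carrier)
    qed
  qed
  let ?H = "perm_group \<Delta> HP"
  have im: "res ` T \<subseteq> carrier ?H" using TH by (auto simp: HP_def)
  have mult: "res (s \<otimes> t) = res s \<otimes>\<^bsub>?H\<^esub> res t" if "s \<in> H0" "t \<in> H0" for s t
    using res_mult that by simp
  have simple: "nonabelian_simple_in (res ` T) ?H"
    by (rule nonabelian_simple_in_image[OF finite_carrier factor_simple[OF T_factor] H.is_group im _ inj])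
       (use TH mult in blast)
  have "group_hom (G\<lparr>carrier := H0\<rparr>) ?H res"
    by (intro group_hom.intro group_hom_axioms.intro subgroup_imp_group H0_subgroup H.is_group)
       (use mult in \<open>auto simp: hom_def HP_def\<close>)
  then interpret h: group_hom "G\<lparr>carrier := H0\<rparr>" ?H res .
  have res_cj: "cj ?H (res h) (res k) = res (cj G h k)" if "h \<in> H0" "k \<in> H0" for h k
  proof -
    have "res (inv h) = inv\<^bsub>?H\<^esub> res h"
      using h.hom_inv[of h] that m_inv_consistent[OF H0_subgroup that(1)] by simp
    then show ?thesis using that mult by (simp add: cj_def)
  qed
  have normal: "normal_in (res ` T) (carrier ?H) ?H"
    unfolding normal_in_def
  proof (intro conjI ballI im)
    show "subgroup (res ` T) ?H" using simple by (simp add: nonabelian_simple_in_def)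
    fix g y assume "g \<in> carrier ?H" "y \<in> res ` T"
    then obtain h t where ht: "h \<in> H0" "g = res h" "t \<in> T" "y = res t" by (auto simp: HP_def)
    have "cj G h t \<in> T" using H0D(1)[OF ht(1)] ht by blast
    then show "cj ?H g y \<in> res ` T" using ht res_cj TH by auto
  qed
  obtain R where R: "H.star p R (carrier ?H)" using HP_star by auto
  show ?thesis
    by (rule almost_simpleI[OF H.is_group H.finite_carrier simple normal])
       (rule H.centraliser_of_simple_normal[OF prime_p p_dvd_\<Delta> R simple normal])
qed

end

section \<open>Product action\<close>

context product_socle
begin

text \<open>The permutations of the factors, carried to indices by \<open>e\<close>; the value
  \<open>i\<close> outside \<open>{1..k}\<close> extends them to permutations of all naturals, the
  form of elements of \<open>sym_group k\<close>. If \<open>p\<close> divides the order of the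
  image, then \<open>P\<close> cannot act trivially on the factors, and
  \<open>moving_factor_imp_prime_power\<close> applies.\<close>

lemma factor_permutation_subgroup:
  assumes e: "bij_betw e {1..k} factors"
    and s_def: "s = (\<lambda>g i. if i \<in> {1..k} then inv_into {1..k} e (cj G g ` e i) else i)"
  shows "subgroup (s ` carrier G) (sym_group k)"
    and "g \<in> carrier G \<Longrightarrow> inv_into UNIV (s g) = s (inv g)"
    and "\<lbrakk>g \<in> carrier G; i \<in> {1..k}\<rbrakk> \<Longrightarrow> e (s g i) = cj G g ` e i"
    and "coprime p (card (s ` carrier G)) \<or>
      p dvd card (s ` carrier G) \<and> (\<exists>m. card \<Delta> = p ^ m)"
proof -
  have ef: "e i \<in> factors" if "i \<in> {1..k}" for i using e that by (auto simp: bij_betw_def)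
  have es: "e (s g i) = cj G g ` e i" and sk: "s g i \<in> {1..k}"
    if "g \<in> carrier G" "i \<in> {1..k}" for g i
  proof -
    have "cj G g ` e i \<in> e ` {1..k}" using factor_cj[OF ef[OF that(2)] that(1)] e by (simp add: bij_betw_def)
    then show "e (s g i) = cj G g ` e i" "s g i \<in> {1..k}"
      using that(2) f_inv_into_f[of "cj G g ` e i" e "{1..k}"] inv_into_into[of "cj G g ` e i" e "{1..k}"]
      by (simp_all only: s_def if_True)
  qed
  then show "e (s g i) = cj G g ` e i" if "g \<in> carrier G" "i \<in> {1..k}" using that by blast
  have inj: "i = j" if "i \<in> {1..k}" "j \<in> {1..k}" "e i = e j" for i j
    using e that by (auto simp: bij_betw_def dest: inj_onD)
  have out: "s g i = i" if "i \<notin> {1..k}" for g i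
    unfolding s_def using that by (rule if_not_P)
  have mult: "s (g \<otimes> h) = s g \<circ> s h" if gh: "g \<in> carrier G" "h \<in> carrier G" for g h
  proof
    fix i
    show "s (g \<otimes> h) i = (s g \<circ> s h) i"
    proof (cases "i \<in> {1..k}")
      case True
      have "e (s (g \<otimes> h) i) = e (s g (s h i))"
        using True gh sk es cj_image_cj[OF gh factor_subset_carrier[OF ef[OF True]]] by simp
      then show ?thesis using inj sk gh True by (metis comp_apply m_closed)
    qed (simp del: atLeastAtMost_iff add: out)
  qed
  have one: "s \<one> = id"
  proof
    fix i
    show "s \<one> i = id i"
    proof (cases "i \<in> {1..k}")
      case True
      have "e (s \<one> i) = e i" using es[OF one_closed True] cj_N_factor[OF ef[OF True], of \<one>] by simp
      then show ?thesis using inj sk True by (metis id_apply one_closed)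
    qed (simp del: atLeastAtMost_iff add: out)
  qed
  have inv: "s g \<circ> s (inv g) = id" "s (inv g) \<circ> s g = id" if "g \<in> carrier G" for g
    using mult[of g "inv g"] mult[of "inv g" g] that one by simp_all
  show "inv_into UNIV (s g) = s (inv g)" if "g \<in> carrier G"
    using inv[OF that] by (rule inv_unique_comp)
  have perm: "s g permutes {1..k}" if g: "g \<in> carrier G" for g
  proof (rule bij_imp_permutes)
    have "s (inv g) (s g i) = i" "s g (s (inv g) i) = i" for i
      using inv[OF g] by (metis comp_apply id_apply)+
    then show "bij_betw (s g) {1..k} {1..k}"
      using sk g by (intro bij_betwI[where g = "s (inv g)"]) auto
  qed (rule out)
  have im: "s ` carrier G \<subseteq> carrier (sym_group k)" using perm by (auto simp: sym_group_def)
  have mult': "s (g \<otimes> h) = s g \<otimes>\<^bsub>sym_group k\<^esub> s h" if "g \<in> carrier G" "h \<in> carrier G" for g h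
    using mult[OF that] by (simp add: sym_group_def)
  note K = card_hom_image[OF subgroup_self finite_carrier sym_group_is_group im mult']
  show "subgroup (s ` carrier G) (sym_group k)" by (rule K(2))
  show "coprime p (card (s ` carrier G)) \<or>
      p dvd card (s ` carrier G) \<and> (\<exists>m. card \<Delta> = p ^ m)"
  proof (cases "p dvd card (s ` carrier G)")
    case False
    then show ?thesis using prime_imp_coprime[OF prime_p] by blast
  next
    case True
    let ?L = "{g \<in> carrier G. s g = \<one>\<^bsub>sym_group k\<^esub>}"
    \<comment> \<open>If \<open>P\<close> lay in the kernel \<open>?L\<close>, the order of
      \<open>G\<close> would be divisible by \<open>p\<close> times the order of
      \<open>P\<close>.\<close>
    have "\<exists>x\<in>P. s x \<noteq> id"
    proof (rule ccontr)
      assume "\<not> ?thesis"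
      then have PL: "P \<subseteq> ?L" using subgroup.subset[OF P_subgroup] by (auto simp: sym_group_def)
      have L: "subgroup ?L G"
      proof (rule subgroupI)
        have "\<one> \<in> ?L" using one by (simp add: sym_group_def)
        then show "?L \<noteq> {}" by blast
        show "inv g \<in> ?L" if "g \<in> ?L" for g
          using that inv(1)[of g] by (simp add: sym_group_def)
      qed (use mult in \<open>auto simp: sym_group_def\<close>)
      have "card P = p ^ multiplicity p (card (carrier G))"
        using star_sylow[OF star_P] by (simp add: sylow_in_def)
      then have "p * p ^ multiplicity p (card (carrier G)) dvd card (s ` carrier G) * card ?L"
        using True subgroup_mono_dvd[OF P_subgroup L PL] by (intro mult_dvd_mono) auto
      then have "p ^ Suc (multiplicity p (card (carrier G))) dvd card (carrier G)"
        using K(1) by simp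
      moreover have "card (carrier G) > 0" using card_subgroup_pos[OF subgroup_self] .
      ultimately have "Suc (multiplicity p (card (carrier G))) \<le> multiplicity p (card (carrier G))"
        using prime_p by (intro multiplicity_geI) auto
      then show False by simp
    qed
    then obtain x i where x: "x \<in> P" "s x i \<noteq> i" by fastforce
    then have i: "i \<in> {1..k}" using out by blast
    have xG: "x \<in> carrier G" using x P_subgroup by (simp add: subgroup.mem_carrier)
    have "cj G x ` e i \<noteq> e i" using es[OF xG i] inj[OF sk[OF xG i] i] x(2) by auto
    then show ?thesis using True moving_factor_imp_prime_power[OF x(1) ef[OF i]] by blast
  qed
qed

lemma product_action_embedding:
  "\<exists>K f. subgroup K (sym_group (card factors)) \<and>
     (coprime p (card K) \<or> p dvd card K \<and> (\<exists>m. card \<Delta> = p ^ m)) \<and>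
     bij_betw f E ({1..card factors} \<rightarrow>\<^sub>E \<Delta>) \<and>
     (\<forall>g\<in>carrier G. \<exists>v\<in>carrier (wreath_product (perm_group \<Delta> HP) (card factors) K).
        \<forall>x\<in>E. f (\<alpha> g x) = product_action (card factors) \<Delta> id v (f x))"
proof -
  let ?k = "card factors"
  obtain e where e: "bij_betw e {1..?k} factors"
    using ex_bij_betw_nat_finite_1[OF finite_factors] by blast
  have ef: "e i \<in> factors" if "i \<in> {1..?k}" for i using e that by (auto simp: bij_betw_def)
  define s where "s = (\<lambda>g i. if i \<in> {1..?k} then inv_into {1..?k} e (cj G g ` e i) else i)"
  note S = factor_permutation_subgroup[OF e s_def]
  define f where "f = (\<lambda>x. \<lambda>i\<in>{1..?k}. pt x (e i))"
  have "bij_betw f E ({1..?k} \<rightarrow>\<^sub>E \<Delta>)"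
    unfolding bij_betw_def
  proof
    show "inj_on f E"
    proof (rule inj_onI)
      fix x y assume xy: "x \<in> E" "y \<in> E" "f x = f y"
      have "pt x U = pt y U" if "U \<in> factors" for U
      proof -
        have "U \<in> e ` {1..?k}" using e that unfolding bij_betw_def by blast
        then obtain i where "i \<in> {1..?k}" "U = e i" by blast
        then show ?thesis using fun_cong[OF xy(3), of i] by (simp add: f_def)
      qed
      then show "x = y" by (rule pt_eq_imp_eq[OF xy(1,2)])
    qed
    show "f ` E = {1..?k} \<rightarrow>\<^sub>E \<Delta>"
    proof
      show "f ` E \<subseteq> {1..?k} \<rightarrow>\<^sub>E \<Delta>" using pt_\<Delta> ef by (auto simp: f_def)
      show "{1..?k} \<rightarrow>\<^sub>E \<Delta> \<subseteq> f ` E"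
      proof
        fix \<delta> assume d: "\<delta> \<in> {1..?k} \<rightarrow>\<^sub>E \<Delta>"
        have inv: "inv_into {1..?k} e U \<in> {1..?k}" if "U \<in> factors" for U
          using e that by (metis bij_betw_def inv_into_into)
        have "\<exists>x\<in>E. \<forall>U\<in>factors. pt x U = \<delta> (inv_into {1..?k} e U)"
          by (rule pt_surj) (use d inv in \<open>blast intro: PiE_mem\<close>)
        then obtain x where x: "x \<in> E" "\<And>U. U \<in> factors \<Longrightarrow> pt x U = \<delta> (inv_into {1..?k} e U)" by blast
        have "f x = \<delta>"
        proof (rule extensionalityI[of _ "{1..?k}"])
          fix i assume i: "i \<in> {1..?k}"
          then have "inv_into {1..?k} e (e i) = i" using e by (metis bij_betw_def inv_into_f_f)
          then show "f x i = \<delta> i" using x(2)[OF ef[OF i]] i by (simp add: f_def)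
        qed (use d in \<open>auto simp: f_def PiE_def\<close>)
        then show "\<delta> \<in> f ` E" using x by blast
      qed
    qed
  qed
  moreover have "\<exists>v\<in>carrier (wreath_product (perm_group \<Delta> HP) ?k (s ` carrier G)).
        \<forall>x\<in>E. f (\<alpha> g x) = product_action ?k \<Delta> id v (f x)" if g: "g \<in> carrier G" for g
  proof -
    have "\<forall>i\<in>{1..?k}. \<exists>h\<in>H0. \<forall>x\<in>E. pt (\<alpha> g x) (e i) = \<alpha> h (pt x (cj G (inv g) ` e i))"
      using coordinate_action[OF g ef] by blast
    then obtain h where h: "\<And>i. i \<in> {1..?k} \<Longrightarrow> h i \<in> H0"
      "\<And>i x. \<lbrakk>i \<in> {1..?k}; x \<in> E\<rbrakk> \<Longrightarrow> pt (\<alpha> g x) (e i) = \<alpha> (h i) (pt x (cj G (inv g) ` e i))"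
      by metis
    \<comment> \<open>The product action reads coordinate \<open>i\<close> through the inverse of
      \<open>s g\<close>, that is through \<open>s (inv g)\<close>; this matches the factor
      \<open>cj G (inv g)\<close> of \<open>e i\<close> occurring in
      \<open>coordinate_action\<close>.\<close>
    let ?v = "(\<lambda>i\<in>{1..?k}. res (h i), s g)"
    have sinv: "s (inv g) i \<in> {1..?k}" if "i \<in> {1..?k}" for i
      using that g factor_cj[OF ef[OF that], of "inv g"] e unfolding s_def
      by (metis bij_betw_def inv_closed inv_into_into)
    have "?v \<in> carrier (wreath_product (perm_group \<Delta> HP) ?k (s ` carrier G))"
      using h(1) g by (auto simp: wreath_product_def HP_def)
    moreover have "f (\<alpha> g x) = product_action ?k \<Delta> id ?v (f x)" if x: "x \<in> E" for x
    proof -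
      have fx: "f x \<in> {1..?k} \<rightarrow>\<^sub>E \<Delta>" using pt_\<Delta>[OF x] ef by (auto simp: f_def)
      have "pt (\<alpha> g x) (e i) = res (h i) (f x (inv_into UNIV (s g) i))" if i: "i \<in> {1..?k}" for i
      proof -
        have "f x (s (inv g) i) = pt x (cj G (inv g) ` e i)"
          using sinv[OF i] S(3)[OF inv_closed[OF g] i] unfolding f_def by (metis restrict_apply')
        moreover have "pt x (cj G (inv g) ` e i) \<in> \<Delta>"
          using pt_\<Delta>[OF x factor_cj[OF ef[OF i] inv_closed[OF g]]] .
        ultimately show ?thesis using h(2)[OF i x] S(2)[OF g] by (simp add: res_def)
      qed
      then show ?thesis using fx by (auto simp: product_action_def f_def intro!: restrict_ext)
    qed
    ultimately show ?thesis by blast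
  qed
  ultimately show ?thesis using S(1,4) by blast
qed

end

text \<open>When \<open>p\<close> does not divide \<open>card K\<close>, a \<open>p\<close>-element
  permutes no coordinates. The orbits of \<open>P\<close> then lie in products of orbits of
  \<open>p\<close>-subgroups of \<open>H\<close>, each bounded by the \<open>p\<close>-part of
  \<open>card \<Delta>\<close>.\<close>

lemma (in finite_action) star_of_product_action:
  fixes \<Delta> :: "'d set"
  assumes p: "prime p" and tr: "transitive_on_E (carrier G)" and \<Delta>: "finite \<Delta>"
    and H: "subgroup H (BijGroup \<Delta>)" "property_star p (perm_group \<Delta> H) \<Delta> id"
      "transitive_action (perm_group \<Delta> H) \<Delta> id"
    and K: "subgroup K (sym_group k)" "coprime p (card K)"
    and f: "bij_betw f E ({1..k} \<rightarrow>\<^sub>E \<Delta>)"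
    and rep: "\<And>g. g \<in> carrier G \<Longrightarrow> \<exists>v\<in>carrier (wreath_product (perm_group \<Delta> H) k K).
      \<forall>x\<in>E. f (\<alpha> g x) = product_action k \<Delta> id v (f x)"
  shows "\<exists>P. star p P (carrier G)"
proof -
  let ?H = "perm_group \<Delta> H" and ?W = "wreath_product (perm_group \<Delta> H) k K"
  interpret HA: finite_action ?H \<Delta> id by (rule finite_action_perm_group[OF H(1) \<Delta>])
  interpret WA: group_action ?W "{1..k} \<rightarrow>\<^sub>E \<Delta>" "product_action k \<Delta> id"
    by (rule product_action_is_action[OF group_action_perm_group[OF H(1)] K(1)])
  interpret W: group ?W using WA.group_hom group_hom.axioms(1) by blast
  interpret S: group "sym_group k" by (rule sym_group_is_group)
  interpret KG: group "sym_group k\<lparr>carrier := K\<rparr>" using K(1) by (rule S.subgroup_imp_group)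
  have HB: "H \<subseteq> Bij \<Delta>" using subgroup.subset[OF H(1)] by (simp add: BijGroup_def)
  have Htr: "HA.transitive_on_E (carrier ?H)"
    unfolding HA.transitive_on_E_def using transitive_action.unique_orbit[OF H(3)] by blast
  obtain R where R: "HA.star p R (carrier ?H)" using H(2) HA.property_star_iff by auto
  obtain P where P: "sylow_in p P (carrier G) G"
    using sylow_in_exists[OF finite_carrier p subgroup_self] by blast
  then have P': "subgroup P G" "card P = p ^ multiplicity p (card (carrier G))"
    by (auto simp: sylow_in_def)
  note [simp] = subgroup.mem_carrier[OF P'(1)] subgroup.m_closed[OF P'(1)]
  interpret PG: group "G\<lparr>carrier := P\<rparr>" using P'(1) by (rule subgroup_imp_group)
  have fE: "f x \<in> {1..k} \<rightarrow>\<^sub>E \<Delta>" if "x \<in> E" for x using f that by (auto simp: bij_betw_def)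
  have fi: "f x i \<in> \<Delta>" if "x \<in> E" "i \<in> {1..k}" for x i using fE[OF that(1)] that(2) by (rule PiE_mem)
  \<comment> \<open>A relation, since an element of \<open>G\<close> is only given some representing
    wreath product element; it is compatible with products and powers.\<close>
  define represents where "represents = (\<lambda>g v. v \<in> carrier ?W \<and>
    (\<forall>x\<in>E. f (\<alpha> g x) = product_action k \<Delta> id v (f x)))"
  have rmult: "represents (g \<otimes> h) (u \<otimes>\<^bsub>?W\<^esub> v)"
    if "g \<in> carrier G" "h \<in> carrier G" "represents g u" "represents h v" for g h u v
    using that fE WA.composition_rule by (auto simp: represents_def act_mult)
  have rone: "represents \<one> \<one>\<^bsub>?W\<^esub>"
    using fE WA.id_eq_one by (auto simp: represents_def) (metis restrict_apply')
  have rpow: "represents (g [^] n) (v [^]\<^bsub>?W\<^esub> n)" if "g \<in> carrier G" "represents g v" for g v and n :: nat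
    by (induction n) (use rone rmult that in auto)
  have finK: "finite K"
    using subgroup.subset[OF K(1)] finite_permutations[of "{1..k}"]
    by (auto simp: sym_group_def intro: finite_subset)
  have cK: "card K > 0"
    using finK subgroup.one_closed[OF K(1)] by (metis card_gt_0_iff empty_iff)
  have snd_mult: "snd (u \<otimes>\<^bsub>?W\<^esub> v) = snd u \<circ> snd v" for u v
    by (cases u; cases v) (simp add: wreath_product_def)
  have snd_pow: "snd (v [^]\<^bsub>?W\<^esub> n) = snd v [^]\<^bsub>sym_group k\<lparr>carrier := K\<rparr>\<^esub> n" for v and n :: nat
    by (induction n) (simp_all add: snd_mult, simp_all add: wreath_product_def sym_group_def)
  have base: "\<exists>h\<in>{1..k} \<rightarrow>\<^sub>E H. \<forall>x\<in>E. \<forall>i\<in>{1..k}. f (\<alpha> g x) i = h i (f x i)" if g: "g \<in> P" for g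
  proof -
    \<comment> \<open>The exponent \<open>card K * a\<close> is 1 modulo \<open>card P\<close>:
      raising to it leaves \<open>g\<close> unchanged and kills the coordinate permutation of any
      representative of \<open>g\<close>.\<close>
    obtain a b where ab: "card K * a = card P * b + 1"
    proof -
      obtain a b where "card K * a = card P * b + gcd (card K) (card P)"
        using bezout_nat[of "card K" "card P"] cK by auto
      moreover have "coprime (card K) (card P)"
        using K(2) P'(2) by (metis coprime_commute coprime_power_left_iff)
      ultimately show ?thesis using that by (simp add: coprime_iff_gcd_eq_1)
    qed
    have "g [^] card P = \<one>"
      using PG.pow_order_eq_1[of g] g by (simp add: order_def nat_pow_consistent[symmetric])
    then have gp: "g [^] (card K * a) = g"
      unfolding ab using g by (simp add: nat_pow_mult[symmetric] nat_pow_pow[symmetric])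
    obtain v where v: "represents g v" using rep[of g] g by (auto simp: represents_def)
    have "represents g (v [^]\<^bsub>?W\<^esub> (card K * a))" using rpow[OF _ v, of "card K * a"] gp g by simp
    moreover have "snd (v [^]\<^bsub>?W\<^esub> (card K * a)) = id"
    proof -
      have sv: "snd v \<in> K" using v by (auto simp: represents_def wreath_product_def)
      have "snd v [^]\<^bsub>sym_group k\<lparr>carrier := K\<rparr>\<^esub> card K = \<one>\<^bsub>sym_group k\<lparr>carrier := K\<rparr>\<^esub>"
        using KG.pow_order_eq_1[of "snd v"] sv by (simp add: order_def)
      then show ?thesis
        unfolding snd_pow using sv KG.nat_pow_pow[of "snd v" "card K" a] KG.nat_pow_one[of a]
        by (simp add: sym_group_def)
    qed
    ultimately obtain h where h: "represents g (h, id)" by (metis prod.collapse)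
    then have "h \<in> {1..k} \<rightarrow>\<^sub>E H" by (auto simp: represents_def wreath_product_def)
    moreover have "f (\<alpha> g x) i = h i (f x i)" if "x \<in> E" "i \<in> {1..k}" for x i
      using h that fE[OF that(1)] unfolding represents_def product_action_def by simp
    ultimately show ?thesis by blast
  qed
  then have "\<forall>g\<in>P. \<exists>h. h \<in> {1..k} \<rightarrow>\<^sub>E H \<and> (\<forall>x\<in>E. \<forall>i\<in>{1..k}. f (\<alpha> g x) i = h i (f x i))" by blast
  from bchoice[OF this] obtain \<theta> where \<theta>: "\<And>g. g \<in> P \<Longrightarrow> \<theta> g \<in> {1..k} \<rightarrow>\<^sub>E H"
    "\<And>g x i. \<lbrakk>g \<in> P; x \<in> E; i \<in> {1..k}\<rbrakk> \<Longrightarrow> f (\<alpha> g x) i = \<theta> g i (f x i)" by blast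
  have \<theta>H: "\<theta> g i \<in> H" if "g \<in> P" "i \<in> {1..k}" for g i using \<theta>(1)[OF that(1)] that(2) by (rule PiE_mem)
  \<comment> \<open>Every point of \<open>\<Delta>\<close> occurs as an \<open>i\<close>-th
    coordinate, so the action of \<open>g\<close> determines \<open>\<theta> g i\<close>. This makes
    the separately chosen \<open>\<theta> g\<close> multiplicative in \<open>g\<close>.\<close>
  have surj: "\<exists>x\<in>E. f x i = d" if d: "d \<in> \<Delta>" and i: "i \<in> {1..k}" for d i
  proof -
    have "(\<lambda>j\<in>{1..k}. d) \<in> f ` E" using f d by (auto simp: bij_betw_def)
    then obtain x where "x \<in> E" "f x = (\<lambda>j\<in>{1..k}. d)" by auto
    then show ?thesis using i by (intro bexI[of _ x]) auto
  qed
  have \<theta>mult: "\<theta> (g \<otimes> h) i = \<theta> g i \<otimes>\<^bsub>?H\<^esub> \<theta> h i" if gh: "g \<in> P" "h \<in> P" and i: "i \<in> {1..k}" for g h i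
  proof -
    have gh': "g \<otimes> h \<in> P" using gh by simp
    have B: "\<theta> g i \<in> Bij \<Delta>" "\<theta> h i \<in> Bij \<Delta>" "\<theta> (g \<otimes> h) i \<in> Bij \<Delta>"
      using \<theta>H[OF gh(1) i] \<theta>H[OF gh(2) i] \<theta>H[OF gh' i] HB by auto
    have "\<theta> (g \<otimes> h) i = compose \<Delta> (\<theta> g i) (\<theta> h i)"
    proof (rule extensionalityI[of _ \<Delta>])
      fix d assume d: "d \<in> \<Delta>"
      then obtain x where x: "x \<in> E" "f x i = d" using surj i by blast
      have "\<theta> (g \<otimes> h) i d = f (\<alpha> (g \<otimes> h) x) i" using \<theta>(2)[OF gh' x(1) i] x by simp
      also have "\<dots> = \<theta> g i (\<theta> h i d)" using \<theta>(2) gh x i by (simp add: act_mult)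
      finally show "\<theta> (g \<otimes> h) i d = compose \<Delta> (\<theta> g i) (\<theta> h i) d" using d by (simp add: compose_eq)
    qed (use B in \<open>auto simp: Bij_def\<close>)
    then show ?thesis using B by (simp add: BijGroup_def)
  qed
  have le: "card (HA.orb ((\<lambda>g. \<theta> g i) ` P) d) \<le> p ^ multiplicity p (card \<Delta>)"
    if i: "i \<in> {1..k}" and d: "d \<in> \<Delta>" for i d
  proof -
    have im: "(\<lambda>g. \<theta> g i) ` P \<subseteq> carrier ?H" using \<theta>H i by auto
    note I = card_hom_image[OF P'(1) finite_subgroup[OF P'(1)] HA.is_group im \<theta>mult[OF _ _ i]]
    have "card ((\<lambda>g. \<theta> g i) ` P) dvd card P" by (rule dvdI[OF I(1)])
    then obtain j where "card ((\<lambda>g. \<theta> g i) ` P) = p ^ j"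
      unfolding P'(2) divides_primepow_nat[OF p] by blast
    from HA.star_p_subgroup_card_orb[OF p R Htr I(2) this d] show ?thesis .
  qed
  have cE: "card E = card \<Delta> ^ k"
    using bij_betw_same_card[OF f] by (simp add: card_funcsetE)
  have "star p P (carrier G)"
  proof (rule starI[OF p subgroup_self P])
    fix x assume x: "x \<in> E"
    have sub: "f ` orb P x \<subseteq> (\<Pi>\<^sub>E i\<in>{1..k}. HA.orb ((\<lambda>g. \<theta> g i) ` P) (f x i))"
    proof
      fix y assume "y \<in> f ` orb P x"
      then obtain g where g: "g \<in> P" "y = f (\<alpha> g x)" by (auto simp: orb_def)
      have "y i \<in> HA.orb ((\<lambda>g. \<theta> g i) ` P) (f x i)" if i: "i \<in> {1..k}" for i
        using g \<theta>(2)[OF g(1) x i] by (auto simp: HA.orb_def)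
      moreover have "y \<in> extensional {1..k}" using fE[of "\<alpha> g x"] g x by (auto simp: PiE_def)
      ultimately show "y \<in> (\<Pi>\<^sub>E i\<in>{1..k}. HA.orb ((\<lambda>g. \<theta> g i) ` P) (f x i))" by (simp add: PiE_def)
    qed
    have finP: "finite ((\<lambda>g. \<theta> g i) ` P)" for i using finite_subgroup[OF P'(1)] by simp
    have "orb P x \<subseteq> E" using orb_subset[OF P'(1) x] .
    then have "inj_on f (orb P x)" using f by (meson bij_betw_def inj_on_subset)
    then have "card (orb P x) = card (f ` orb P x)" by (simp add: card_image)
    also have "\<dots> \<le> card (\<Pi>\<^sub>E i\<in>{1..k}. HA.orb ((\<lambda>g. \<theta> g i) ` P) (f x i))"
      by (rule card_mono[OF finite_PiE sub]) (use finP in \<open>simp_all add: HA.orb_def\<close>)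
    also have "\<dots> = (\<Prod>i\<in>{1..k}. card (HA.orb ((\<lambda>g. \<theta> g i) ` P) (f x i)))"
      by (simp add: card_PiE)
    also have "\<dots> \<le> (\<Prod>i\<in>{1..k}. p ^ multiplicity p (card \<Delta>))"
      by (rule prod_mono) (use le fi x in blast)
    also have "\<dots> = p ^ (k * multiplicity p (card \<Delta>))" by (simp add: power_mult[symmetric] mult.commute)
    \<comment> \<open>The \<open>k\<close>-th power of the \<open>p\<close>-part of
      \<open>card \<Delta>\<close> divides \<open>card E\<close>, which turns the coordinatewise
      bounds into the one required by \<open>starI\<close>.\<close>
    also have "k * multiplicity p (card \<Delta>) \<le> multiplicity p (card E)"
    proof (rule multiplicity_geI)
      have "(p ^ multiplicity p (card \<Delta>)) ^ k dvd card \<Delta> ^ k"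
        by (intro dvd_power_same multiplicity_dvd)
      then show "p ^ (k * multiplicity p (card \<Delta>)) dvd card E"
        unfolding cE by (simp add: power_mult[symmetric] mult.commute)
      show "card E \<noteq> 0" using x finite_E by auto
      show "\<not> is_unit p" using p by auto
    qed
    then have "p ^ (k * multiplicity p (card \<Delta>)) \<le> p ^ multiplicity p (card E)"
      using prime_gt_0_nat[OF p] by (intro power_increasing) auto
    also have "card E = card (orb (carrier G) x)" using transitive_orb[OF tr subgroup_self x] by simp
    finally show "card (orb P x) \<le> p ^ multiplicity p (card (orb (carrier G) x))" .
  qed
  then show ?thesis by blast
qed

section \<open>Abelian minimal normal subgroups\<close>

lemma (in group) coprime_pow_eq_one:
  assumes x: "x \<in> carrier G" "x [^] (m::nat) = \<one>" "x [^] (n::nat) = \<one>" and c: "coprime m n" "m \<noteq> 0"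
  shows "x = \<one>"
proof -
  obtain a b where "m * a = n * b + gcd m n" using bezout_nat[OF c(2)] by blast
  then have ab: "m * a = n * b + 1" using c(1) by (simp add: coprime_iff_gcd_eq_1)
  have "x [^] (m * a) = \<one>" "x [^] (n * b) = \<one>"
    using x by (simp_all add: nat_pow_pow[symmetric])
  then show ?thesis using x(1) unfolding ab by (simp add: nat_pow_mult[symmetric])
qed

text \<open>Another prime divisor \<open>r\<close> of the order would give a nontrivial element
  killed both by \<open>r\<close> and by \<open>p\<close>.\<close>

lemma (in group) card_eq_prime_power_of_exponent:
  assumes fin: "finite (carrier G)" and p: "prime p" and N: "subgroup N G"
    and exp: "\<And>x. x \<in> N \<Longrightarrow> x [^] p = \<one>"
  shows "\<exists>k. card N = p ^ k"
proof -
  have pos: "card N > 0" using subgroup.finite_imp_card_positive[OF N fin] .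
  obtain m where m: "card N = p ^ multiplicity p (card N) * m" "\<not> p dvd m"
    using multiplicity_decompose'[of "card N" p] pos p by (metis not_prime_unit less_not_refl2)
  have "m = 1"
  proof (rule ccontr)
    assume "m \<noteq> 1"
    then obtain r where r: "prime r" "r dvd m" using prime_factor_nat by blast
    then obtain x where x: "x \<in> N" "x \<noteq> \<one>" "x [^] r = \<one>"
      using cauchy[OF fin r(1) N] m(1) by (metis dvd_mult)
    have "coprime p r" using primes_coprime[OF p r(1)] m(2) r(2) by blast
    then have "x = \<one>"
      using x exp[OF x(1)] subgroup.mem_carrier[OF N] p by (intro coprime_pow_eq_one[of x p r]) auto
    then show False using x by simp
  qed
  then show ?thesis using m(1) by auto
qed

context primitive_group
begin

text \<open>A transitive abelian group centralises itself, so it is regular and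
  \<open>card N = card E\<close>. Hence \<open>p\<close> divides \<open>card N\<close>, which
  identifies the prime of the elementary abelian group as \<open>p\<close>.\<close>

lemma abelian_minimal_normal:
  assumes p: "prime p" "p dvd card E" and N: "minimal_normal_in N (carrier G) G"
    and ab: "\<forall>x\<in>N. \<forall>y\<in>N. x \<otimes> y = y \<otimes> x"
  shows "transitive_on_E N" "w \<in> E \<Longrightarrow> stab N w = {\<one>}" "x \<in> N \<Longrightarrow> x [^] p = \<one>"
    "\<exists>k>0. card E = p ^ k"
proof -
  have N': "normal_in N (carrier G) G" "subgroup N G" "N \<noteq> {\<one>}"
    "\<And>g n. \<lbrakk>g \<in> carrier G; n \<in> N\<rbrakk> \<Longrightarrow> cj G g n \<in> N"
    using N by (auto simp: minimal_normal_in_def normal_in_def)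
  note [simp] = subgroup.mem_carrier[OF N'(2)] subgroup.m_closed[OF N'(2)]
    subgroup.m_inv_closed[OF N'(2)] subgroup.one_closed[OF N'(2)]
  show tr: "transitive_on_E N" using normal_trivial_or_transitive[OF N'(1)] N'(3) by blast
  show reg: "stab N w = {\<one>}" if w: "w \<in> E" for w
  proof -
    have "t = \<one>" if "t \<in> N" "\<alpha> t w = w" for t
      using centralised_semiregular[OF tr subgroup.subset[OF N'(2)] _ w that(2)] that(1) ab by simp
    then show ?thesis using w by (auto simp: stab_def)
  qed
  obtain w where w: "w \<in> E" using card_E by fastforce
  have cN: "card N = card E"
    using orbit_stabiliser[OF N'(2) w] transitive_orb[OF tr N'(2) w] reg[OF w] by simp
  \<comment> \<open>The kernel of the \<open>p\<close>-th power map, a homomorphism of the abelian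
    group \<open>N\<close> that commutes with conjugation; so \<open>M\<close> is normal in
    \<open>G\<close>, and it is nontrivial by Cauchy.\<close>
  define M where "M = {x \<in> N. x [^] p = \<one>}"
  have "subgroup M G"
  proof (rule subgroupI)
    have "\<one> \<in> M" by (simp add: M_def)
    then show "M \<noteq> {}" by blast
    show "x \<otimes> y \<in> M" if "x \<in> M" "y \<in> M" for x y
      using that ab by (simp add: M_def pow_mult_distrib)
  qed (auto simp: M_def nat_pow_inv)
  moreover have cj_pow: "cj G g x [^] n = cj G g (x [^] n)"
    if "g \<in> carrier G" "x \<in> carrier G" for g x and n :: nat
    by (induction n) (use that in \<open>simp_all add: cj_mult\<close>)
  then have "cj G g x \<in> M" if "g \<in> carrier G" "x \<in> M" for g x
    using that N'(4) by (simp add: M_def)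
  ultimately have "normal_in M (carrier G) G" by (auto simp: normal_in_def M_def)
  moreover obtain x where "x \<in> N" "x \<noteq> \<one>" "x [^] p = \<one>"
    using cauchy[OF finite_carrier p(1) N'(2)] p(2) cN by auto
  then have "M \<noteq> {\<one>}" by (auto simp: M_def)
  moreover have "M \<subseteq> N" by (auto simp: M_def)
  ultimately have "M = N" using N unfolding minimal_normal_in_def by blast
  then show exp: "x [^] p = \<one>" if "x \<in> N" for x using that by (auto simp: M_def)
  obtain k where k: "card N = p ^ k"
    using card_eq_prime_power_of_exponent[OF finite_carrier p(1) N'(2) exp] by blast
  then have "k > 0" using card_E cN by (cases k) auto
  then show "\<exists>k>0. card E = p ^ k" using k cN by auto
qed

end

section \<open>The two implications for permutation groups\<close>

lemma affine_or_almost_simple_or_product_action: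
  fixes \<Omega> :: "'a set" and G :: "('a \<Rightarrow> 'a) set"
  assumes fin: "finite \<Omega>" and prim: "primitive_perm_group \<Omega> G"
    and p: "prime p" "p dvd card \<Omega>" and star: "property_star p (perm_group \<Omega> G) \<Omega> id"
  shows "almost_simple (perm_group \<Omega> G) \<or>
    (affine_type \<Omega> G \<and> (\<exists>k>0. card \<Omega> = p ^ k)) \<or>
    (\<exists>(\<Delta> :: 'a set) H k K. product_action_case p \<Omega> G \<Delta> H k K)"
proof -
  let ?G = "perm_group \<Omega> G"
  have G: "subgroup G (BijGroup \<Omega>)" using prim by (simp add: primitive_perm_group_def)
  have "\<Omega> \<noteq> {}" using prim by (simp add: primitive_perm_group_def primitive_action_def)
  then have "card \<Omega> > 0" using fin by (simp add: card_gt_0_iff)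
  then have "p \<le> card \<Omega>" using p(2) by (simp add: dvd_imp_le)
  then have card: "card \<Omega> > 1" using prime_gt_1_nat[OF p(1)] by simp
  interpret A: primitive_group ?G \<Omega> id by (rule primitive_group_of_perm_group[OF prim fin card])
  interpret B: group "BijGroup \<Omega>" by (rule group_BijGroup)
  obtain P where P: "A.star p P (carrier ?G)" using star A.property_star_iff by auto
  \<comment> \<open>A trivial group is not transitive on more than one point; so a minimal normal
    subgroup exists.\<close>
  have "carrier ?G \<noteq> {\<one>\<^bsub>?G\<^esub>}"
  proof
    assume "carrier ?G = {\<one>\<^bsub>?G\<^esub>}"
    then have "A.orb (carrier ?G) x = {x}" if "x \<in> \<Omega>" for x
      using that A.act_one by (simp add: A.orb_def)
    then have "\<Omega> = {x}" if "x \<in> \<Omega>" for x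
      using A.transitive_orb[OF A.transitive A.subgroup_self that] that by simp
    then show False using card \<open>\<Omega> \<noteq> {}\<close> by (metis card_1_singleton_iff all_not_in_conv less_irrefl One_nat_def)
  qed
  then obtain N where N: "minimal_normal_in N (carrier ?G) ?G"
    using A.minimal_normal_exists[OF A.finite_carrier A.subgroup_self] by blast
  then have N': "normal_in N (carrier ?G) ?G" "subgroup N ?G" "N \<noteq> {\<one>\<^bsub>?G\<^esub>}"
    by (auto simp: minimal_normal_in_def normal_in_def)
  show ?thesis
  proof (cases "\<forall>x\<in>N. \<forall>y\<in>N. x \<otimes>\<^bsub>?G\<^esub> y = y \<otimes>\<^bsub>?G\<^esub> x")
    case True
    note M = A.abelian_minimal_normal[OF p N True]
    have NB: "subgroup N (BijGroup \<Omega>)" using B.incl_subgroup[OF G N'(2)] .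
    have "comm_group (perm_group \<Omega> N)"
      by (rule group.group_comm_groupI[OF B.subgroup_imp_group[OF NB]]) (use True in simp)
    moreover have "x [^]\<^bsub>perm_group \<Omega> N\<^esub> p = \<one>\<^bsub>perm_group \<Omega> N\<^esub>" if "x \<in> N" for x
      using M(3)[OF that] by (simp add: B.nat_pow_consistent[symmetric])
    ultimately have "elementary_abelian (perm_group \<Omega> N)"
      using p(1) by (auto simp: elementary_abelian_def)
    moreover have "transitive_action (perm_group \<Omega> N) \<Omega> id"
      by (intro transitive_action.intro group_action_perm_group NB transitive_action_axioms.intro)
         (use M(1) in \<open>auto simp: A.transitive_on_E_def\<close>)
    moreover have "stabilizer (perm_group \<Omega> N) id x = {\<one>\<^bsub>perm_group \<Omega> N\<^esub>}" if "x \<in> \<Omega>" for x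
      using M(2)[OF that] by (simp add: stabilizer_def A.stab_def)
    ultimately have "affine_type \<Omega> G"
      using N'(1) A.normal_in_carrier by (auto simp: affine_type_def regular_action_def)
    then show ?thesis using M(4) by blast
  next
    case False
    obtain T where T: "minimal_normal_in T N ?G"
      using A.minimal_normal_exists[OF A.finite_carrier N'(2,3)] by blast
    interpret S: nonabelian_socle ?G \<Omega> id p P N T
      by unfold_locales (use p P N T False in auto)
    show ?thesis
    proof (cases "S.factors = {T}")
      case True
      \<comment> \<open>With a single conjugate, \<open>T\<close> is all of \<open>N\<close>: a
        simple normal subgroup, with trivial centraliser by the star property.\<close>
      have simple: "nonabelian_simple_in T ?G" using S.factor_simple[OF S.T_in_factors] .
      have normal: "normal_in T (carrier ?G) ?G" using N'(1) S.unique_factor_imp_N_eq[OF True] by simp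
      have "almost_simple ?G"
        by (rule almost_simpleI[OF A.is_group A.finite_carrier simple normal])
           (rule A.centraliser_of_simple_normal[OF p P simple normal])
      then show ?thesis ..
    next
      case F: False
      obtain w where w: "w \<in> \<Omega>" using \<open>\<Omega> \<noteq> {}\<close> by blast
      obtain c where c: "\<forall>U\<in>S.factors. c U \<in> A.stab (carrier ?G) w \<and> cj ?G (c U) ` T = U"
        "c T = \<one>\<^bsub>?G\<^esub>"
        using S.stabiliser_conjugates_factors[OF w] by (elim exE conjE)
      \<comment> \<open>Here \<open>\<Delta>\<close> is an orbit of \<open>T\<close> inside
        \<open>\<Omega>\<close>, so it lives over the point type of \<open>\<Omega>\<close>.\<close>
      interpret product_socle ?G \<Omega> id p P N T w c
        by unfold_locales (use w c in auto)
      obtain K f where K: "subgroup K (sym_group (card S.factors))"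
        "coprime p (card K) \<or> p dvd card K \<and> (\<exists>m. card \<Delta> = p ^ m)"
        "bij_betw f \<Omega> ({1..card S.factors} \<rightarrow>\<^sub>E \<Delta>)"
        "\<forall>g\<in>carrier ?G. \<exists>v\<in>carrier (wreath_product (perm_group \<Delta> HP) (card S.factors) K).
          \<forall>x\<in>\<Omega>. f (id g x) = product_action (card S.factors) \<Delta> id v (f x)"
        using product_action_embedding by blast
      have "in_product_action \<Omega> G \<Delta> HP (card S.factors) K"
        unfolding in_product_action_def using K(3,4) by auto
      moreover have "card S.factors \<ge> 2"
      proof (rule ccontr)
        assume "\<not> ?thesis"
        then have "card S.factors \<le> card {T}" by simp
        then show False using card_seteq[of S.factors "{T}"] S.T_in_factors F S.finite_factors by auto
      qed
      ultimately have "product_action_case p \<Omega> G \<Delta> HP (card S.factors) K"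
        unfolding product_action_case_def
        using finite_\<Delta> HP_primitive HP_almost_simple HP_property_star K(1,2) by blast
      then show ?thesis by blast
    qed
  qed
qed

text \<open>Prime power degree makes the property automatic. This also settles product actions with
  \<open>card \<Delta>\<close> a power of \<open>p\<close>, and the others have \<open>p\<close>
  coprime to \<open>card K\<close>.\<close>

lemma property_star_of_affine_or_product_action:
  fixes \<Omega> :: "'a set" and G :: "('a \<Rightarrow> 'a) set"
  assumes fin: "finite \<Omega>" and prim: "primitive_perm_group \<Omega> G" and p: "prime p"
    and cases: "(\<exists>k. card \<Omega> = p ^ k) \<or>
      (\<exists>(\<Delta> :: 'b set) H k K. product_action_case p \<Omega> G \<Delta> H k K)"
  shows "property_star p (perm_group \<Omega> G) \<Omega> id"
proof -
  let ?G = "perm_group \<Omega> G"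
  have G: "subgroup G (BijGroup \<Omega>)" and tra: "transitive_action ?G \<Omega> id"
    using prim by (auto simp: primitive_perm_group_def primitive_action_def)
  interpret A: finite_action ?G \<Omega> id by (rule finite_action_perm_group[OF G fin])
  have tr: "A.transitive_on_E (carrier ?G)"
    unfolding A.transitive_on_E_def using transitive_action.unique_orbit[OF tra] by blast
  have power: "\<exists>P. A.star p P (carrier ?G)" if "card \<Omega> = p ^ k" for k
    using A.sylow_in_exists[OF A.finite_carrier p A.subgroup_self] A.star_of_prime_power_degree[OF p tr that]
    by blast
  have "\<exists>P. A.star p P (carrier ?G)"
    using cases
  proof
    assume "\<exists>k. card \<Omega> = p ^ k"
    then show ?thesis using power by blast
  next
    assume "\<exists>(\<Delta> :: 'b set) H k K. product_action_case p \<Omega> G \<Delta> H k K"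
    then obtain \<Delta> :: "'b set" and H k K where c: "product_action_case p \<Omega> G \<Delta> H k K" by blast
    then have \<Delta>: "finite \<Delta>" "property_star p (perm_group \<Delta> H) \<Delta> id" "subgroup K (sym_group k)"
      and H: "subgroup H (BijGroup \<Delta>)" "transitive_action (perm_group \<Delta> H) \<Delta> id"
      by (auto simp: product_action_case_def primitive_perm_group_def primitive_action_def)
    obtain f where f: "bij_betw f \<Omega> ({1..k} \<rightarrow>\<^sub>E \<Delta>)"
      "\<forall>g\<in>G. \<exists>v\<in>carrier (wreath_product (perm_group \<Delta> H) k K).
         \<forall>x\<in>\<Omega>. f (g x) = product_action k \<Delta> id v (f x)"
      using c by (auto simp: product_action_case_def in_product_action_def)
    show ?thesis
    proof (cases "coprime p (card K)")
      case True
      show ?thesis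
        by (rule A.star_of_product_action[OF p tr \<Delta>(1) H(1) \<Delta>(2) H(2) \<Delta>(3) True f(1)]) (use f(2) in auto)
    next
      case False
      then obtain m where "card \<Delta> = p ^ m" using c by (auto simp: product_action_case_def)
      moreover have "card \<Omega> = card \<Delta> ^ k"
        using bij_betw_same_card[OF f(1)] by (simp add: card_funcsetE)
      ultimately show ?thesis using power[of "m * k"] by (simp add: power_mult)
    qed
  qed
  then show ?thesis using A.property_star_iff by simp
qed

theorem theorem1p3:
  fixes p :: nat and \<Omega> :: "'a set" and G :: "('a \<Rightarrow> 'a) set"
  assumes "finite \<Omega>" and "primitive_perm_group \<Omega> G"
    and "prime p" and "p dvd card \<Omega>"
  shows "(property_star p (perm_group \<Omega> G) \<Omega> id \<longrightarrow>
            almost_simple (perm_group \<Omega> G) \<or>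
            (affine_type \<Omega> G \<and> (\<exists>k>0. card \<Omega> = p ^ k)) \<or>
            (\<exists>(\<Delta> :: 'a set) H k K. product_action_case p \<Omega> G \<Delta> H k K)) \<and>
         ((affine_type \<Omega> G \<and> (\<exists>k>0. card \<Omega> = p ^ k)) \<or>
            (\<exists>(\<Delta> :: 'b set) H k K. product_action_case p \<Omega> G \<Delta> H k K) \<longrightarrow>
            property_star p (perm_group \<Omega> G) \<Omega> id)"
  using affine_or_almost_simple_or_product_action[OF assms]
    property_star_of_affine_or_product_action[OF assms(1-3), where 'b = 'b] by blast

end
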